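(* Let $\{\tilde\lambda_n,\tilde\mu_n\}_{n\ge0}$ be a rate set with $\tilde\mu_0=0$ for which the series $\sum_{n=0}^\infty\left(\tilde\pi_n+\frac{1}{\tilde\lambda_n\tilde\pi_n}\right)$ diverges, where $\tilde\pi_0=1$ and $\tilde\pi_n=\frac{\tilde\lambda_0\cdots\tilde\lambda_{n-1}}{\tilde\mu_1\cdots\tilde\mu_n}$ for $n\ge1$. Let $\tilde{\mathcal{X}}$ be the (unique) birth-death process defined by this rate set and $\tilde\phi$ the corresponding measure. Let $a:=\tilde\phi(\{0\})/(1-\tilde\phi(\{0\}))$. Then there is a birth-death process $\mathcal{X}$, uniquely determined by its rates $\{\lambda_n,\mu_n\}$, whose corresponding measure is a natural measure $\psi$ with $m_{-1}(\psi)<\infty$, such that $\mu_0=((a+1)m_{-1}(\psi))^{-1}>0$ and $\tilde\phi=\phi^{(a)}$, where $\phi^{(a)}$ is the measure constructed from $\psi$ as described in the context. Moreover, $\tilde{\mathcal{X}}=\mathcal{X}^d$, the dual process of $\mathcal{X}$.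
   Context: Measures. A measure is a Borel probability measure on $\mathbb{R}$ with infinite support and finite moments of all positive orders. A measure with support in $[0,\infty)$ is det(S) if it is the only measure with support in $[0,\infty)$ having its moments, and indet(S) otherwise; det(H) and indet(H) are defined in the same way with $\mathbb{R}$ in place of $[0,\infty)$. If a measure with left-bounded support is indet(H), then among all measures on $\mathbb{R}$ with the same moments there is a unique one for which the minimum of the support is maximal; it is called the natural solution. A measure that is the solution of a determined moment problem is also called natural. For a measure $\psi$ on $[0,\infty)$ put $m_{-1}(\psi):=\int_{[0,\infty)}x^{-1}\psi(dx)$. Rate sets. A rate set is a collection of numbers $\lambda_n>0$, $\mu_{n+1}>0$ ($n\ge 0$) and $\mu_0\ge 0$. Put $\pi_0:=1$ and $\pi_n:=\frac{\lambda_0\cdots\lambda_{n-1}}{\mu_1\cdots\mu_n}$ for $n\ge1$. The monic polynomials $P_n$ of the rate set are given by $P_0=1$, $P_1(x)=x-\lambda_0-\mu_0$, $P_n(x)=(x-\lambda_{n-1}-\mu_{n-1})P_{n-1}(x)-\lambda_{n-2}\mu_{n-1}P_{n-2}(x)$ for $n>1$. There is a unique natural measure on $[0,\infty)$ with respect to which the $P_n$ are orthogonal; it is the natural measure defined by the rate set. Birth-death processes. Let $Q=(q_{ij})_{i,j\ge0}$ be the tridiagonal matrix with $q_{n,n+1}=\lambda_n$, $q_{n,n}=-(\lambda_n+\mu_n)$, $q_{n+1,n}=\mu_{n+1}$. A birth-death process with these rates (a $Q$-process) is identified with its matrix of transition functions $P(t)=(p_{ij}(t))_{i,j\ge 0}$,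 $t\ge0$, satisfying $p_{ij}(t)\ge0$, $\sum_j p_{ij}(t)\le1$, $P(s+t)=P(s)P(t)$, $P(0)=I$, and both $P'(t)=QP(t)$ and $P'(t)=P(t)Q$. (If $\mu_0>0$ the process may be absorbed in an extra state $-1$.) The $Q$-process is uniquely determined by its rates if and only if $\sum_{n\ge 0}\left(\pi_n+\frac{1}{\lambda_n\pi_n}\right)=\infty$. The measure corresponding to a birth-death process is the unique measure $\psi$ on $[0,\infty)$ such that $$p_{ij}(t)=\frac{(-1)^{i+j}}{\lambda_0\cdots\lambda_{i-1}\,\mu_1\cdots\mu_j}\int_{[0,\infty)}e^{-xt}P_i(x)P_j(x)\,\psi(dx),\qquad i,j\ge0,\ t\ge0$$ (empty products are $1$); for a process uniquely determined by its rates this is the natural measure defined by the rate set. Duality. If $\mathcal{X}$ is a birth-death process with rates $\{\lambda_n,\mu_n\}$, $\mu_0>0$, that is uniquely determined by its rates, its dual $\mathcal{X}^d$ is the birth-death process with rates $\mu_0^d:=0$, $\lambda_n^d:=\mu_n$, $\mu_{n+1}^d:=\lambda_n$ ($n\ge0$); it is also uniquely determined by its rates. The measures $\phi^{(a)}$. For a natural measure $\psi$ on $[0,\infty)$ with $m_{-1}(\psi)<\infty$ define $\phi^{(0)}([0,x]):=\frac{1}{m_{-1}(\psi)}\int_{[0,x]}y^{-1}\psi(dy)$, $x\ge0$, and, for $a>0$, $\phi^{(a)}:=\frac{1}{a+1}\left(a\delta_0+\phi^{(0)}\right)$, where $\delta_0$ is the Dirac measure at $0$. *)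

theory Defs
  imports "HOL-Probability.Probability" "HOL-Computational_Algebra.Polynomial"
begin

section \<open>Measures and moment problems\<close>

definition supp :: "real measure \<Rightarrow> real set" where
  "supp M = {x. \<forall>U. open U \<longrightarrow> x \<in> U \<longrightarrow> emeasure M U > 0}"

definition moment_measure :: "real measure \<Rightarrow> bool" where
  "moment_measure M \<longleftrightarrow> prob_space M \<and> sets M = sets borel \<and> infinite (supp M) \<and>
     (\<forall>n::nat. integrable M (\<lambda>x. x ^ n))"

definition same_moments :: "real measure \<Rightarrow> real measure \<Rightarrow> bool" where
  "same_moments M N \<longleftrightarrow> (\<forall>n::nat. (LINT x|M. x ^ n) = (LINT x|N. x ^ n))"

definition det_S :: "real measure \<Rightarrow> bool" where
  "det_S M \<longleftrightarrow> moment_measure M \<and> supp M \<subseteq> {0..} \<and>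
     (\<forall>N. moment_measure N \<and> supp N \<subseteq> {0..} \<and> same_moments M N \<longrightarrow> N = M)"

definition det_H :: "real measure \<Rightarrow> bool" where
  "det_H M \<longleftrightarrow> moment_measure M \<and>
     (\<forall>N. moment_measure N \<and> same_moments M N \<longrightarrow> N = M)"

definition indet_H :: "real measure \<Rightarrow> bool" where
  "indet_H M \<longleftrightarrow> moment_measure M \<and> \<not> det_H M"

text \<open>Supports are closed and nonempty, so \<open>Inf\<close> is the minimum of a left-bounded support.
  A solution whose support is not left-bounded has minimum \<open>- \<infinity>\<close> and is never a competitor.
  Strictness expresses that the maximiser is unique.\<close>

definition natural_solution :: "real measure \<Rightarrow> bool" where
  "natural_solution M \<longleftrightarrow> indet_H M \<and> bdd_below (supp M) \<and>
     (\<forall>N. moment_measure N \<and> same_moments M N \<and> bdd_below (supp N) \<and> N \<noteq> M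
        \<longrightarrow> Inf (supp N) < Inf (supp M))"

definition natural_measure :: "real measure \<Rightarrow> bool" where
  "natural_measure M \<longleftrightarrow> det_S M \<or> det_H M \<or> natural_solution M"

section \<open>Rate sets and birth-death processes\<close>

definition rate_set :: "(nat \<Rightarrow> real) \<Rightarrow> (nat \<Rightarrow> real) \<Rightarrow> bool" where
  "rate_set l m \<longleftrightarrow> (\<forall>n. l n > 0) \<and> (\<forall>n. m (Suc n) > 0) \<and> m 0 \<ge> 0"

definition pi_coeff :: "(nat \<Rightarrow> real) \<Rightarrow> (nat \<Rightarrow> real) \<Rightarrow> nat \<Rightarrow> real" where
  "pi_coeff l m n = (\<Prod>k<n. l k) / (\<Prod>k=1..n. m k)"

fun bd_poly :: "(nat \<Rightarrow> real) \<Rightarrow> (nat \<Rightarrow> real) \<Rightarrow> nat \<Rightarrow> real poly" where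
  "bd_poly l m 0 = 1"
| "bd_poly l m (Suc 0) = [:- l 0 - m 0, 1:]"
| "bd_poly l m (Suc (Suc n)) =
     [:- l (Suc n) - m (Suc n), 1:] * bd_poly l m (Suc n)
       - smult (l n * m (Suc n)) (bd_poly l m n)"

type_synonym matrix = "nat \<Rightarrow> nat \<Rightarrow> real"

definition Q_matrix :: "(nat \<Rightarrow> real) \<Rightarrow> (nat \<Rightarrow> real) \<Rightarrow> matrix" where
  "Q_matrix l m i j =
     (if j = Suc i then l i else if j = i then - (l i + m i) else if i = Suc j then m i else 0)"

text \<open>All products formed below converge: either one factor is tridiagonal, or the rows of the
  left factor are nonnegative and summable and the right factor is bounded.\<close>

definition mprod :: "matrix \<Rightarrow> matrix \<Rightarrow> matrix" where
  "mprod A B i j = (\<Sum>k. A i k * B k j)"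

text \<open>The matrix of transition functions is only constrained at times \<open>t \<ge> 0\<close>; two processes
  are the same if they agree there.\<close>

definition bd_process :: "(nat \<Rightarrow> real) \<Rightarrow> (nat \<Rightarrow> real) \<Rightarrow> (real \<Rightarrow> matrix) \<Rightarrow> bool" where
  "bd_process l m P \<longleftrightarrow> rate_set l m \<and>
     (\<forall>t\<ge>0. \<forall>i j. P t i j \<ge> 0) \<and>
     (\<forall>t\<ge>0. \<forall>i. summable (P t i) \<and> (\<Sum>j. P t i j) \<le> 1) \<and>
     (\<forall>s\<ge>0. \<forall>t\<ge>0. P (s + t) = mprod (P s) (P t)) \<and>
     (\<forall>i j. P 0 i j = (if i = j then 1 else 0)) \<and>
     (\<forall>t\<ge>0. \<forall>i j. ((\<lambda>u. P u i j) has_real_derivative mprod (Q_matrix l m) (P t) i j)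
                        (at t within {0..})) \<and>
     (\<forall>t\<ge>0. \<forall>i j. ((\<lambda>u. P u i j) has_real_derivative mprod (P t) (Q_matrix l m) i j)
                        (at t within {0..}))"

definition uniquely_determined ::
    "(nat \<Rightarrow> real) \<Rightarrow> (nat \<Rightarrow> real) \<Rightarrow> (real \<Rightarrow> matrix) \<Rightarrow> bool" where
  "uniquely_determined l m P \<longleftrightarrow> bd_process l m P \<and>
     (\<forall>P'. bd_process l m P' \<longrightarrow> (\<forall>t\<ge>0. P' t = P t))"

definition corresponding_measure ::
    "(nat \<Rightarrow> real) \<Rightarrow> (nat \<Rightarrow> real) \<Rightarrow> (real \<Rightarrow> matrix) \<Rightarrow> real measure \<Rightarrow> bool" where
  "corresponding_measure l m P M \<longleftrightarrow> moment_measure M \<and> supp M \<subseteq> {0..} \<and>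
     (\<forall>i j. \<forall>t\<ge>0. P t i j =
        (-1) ^ (i + j) / ((\<Prod>k<i. l k) * (\<Prod>k=1..j. m k)) *
        (LINT x:{0..}|M. exp (- x * t) * poly (bd_poly l m i) x * poly (bd_poly l m j) x))"

definition dual_birth :: "(nat \<Rightarrow> real) \<Rightarrow> (nat \<Rightarrow> real) \<Rightarrow> nat \<Rightarrow> real" where
  "dual_birth l m n = m n"

definition dual_death :: "(nat \<Rightarrow> real) \<Rightarrow> (nat \<Rightarrow> real) \<Rightarrow> nat \<Rightarrow> real" where
  "dual_death l m n = (case n of 0 \<Rightarrow> 0 | Suc k \<Rightarrow> l k)"

text \<open>The process with rates \<open>ld\<close>, \<open>md\<close> and transition functions \<open>Pd\<close> is the dual of the
  process with rates \<open>l\<close>, \<open>m\<close> and transition functions \<open>P\<close>.\<close>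

definition is_dual_process ::
    "(nat \<Rightarrow> real) \<Rightarrow> (nat \<Rightarrow> real) \<Rightarrow> (real \<Rightarrow> matrix) \<Rightarrow>
     (nat \<Rightarrow> real) \<Rightarrow> (nat \<Rightarrow> real) \<Rightarrow> (real \<Rightarrow> matrix) \<Rightarrow> bool" where
  "is_dual_process l m P ld md Pd \<longleftrightarrow>
     m 0 > 0 \<and> uniquely_determined l m P \<and>
     ld = dual_birth l m \<and> md = dual_death l m \<and> uniquely_determined ld md Pd"

section \<open>The measures \<open>\<phi>\<^sup>(\<^sup>a\<^sup>)\<close>\<close>

text \<open>The integrand is \<open>ennreal\<close>-valued so that \<open>1/0 = \<infinity>\<close>: an atom at \<open>0\<close> makes the
  integral infinite.\<close>

definition m_inv :: "real measure \<Rightarrow> ennreal" where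
  "m_inv M = (\<integral>\<^sup>+x\<in>{0..}. inverse (ennreal x) \<partial>M)"

definition phi0 :: "real measure \<Rightarrow> real measure" where
  "phi0 M = density M (\<lambda>y. inverse (ennreal y) * indicator {0..} y / m_inv M)"

text \<open>For \<open>a = 0\<close> the formula returns \<open>phi0\<close> itself, see \<open>phi_zero\<close> below.\<close>

definition phi :: "real \<Rightarrow> real measure \<Rightarrow> real measure" where
  "phi a M = measure_of UNIV (sets borel)
     (\<lambda>A. inverse (ennreal (a + 1)) *
        (ennreal a * emeasure (return borel 0) A + emeasure (phi0 M) A))"

lemma emeasure_phi0_Icc:
  assumes "sets M = sets borel"
  shows "emeasure (phi0 M) {0..x} = (\<integral>\<^sup>+y\<in>{0..x}. inverse (ennreal y) \<partial>M) / m_inv M"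
proof -
  note [measurable_cong] = assms
  have "emeasure (phi0 M) {0..x} =
      (\<integral>\<^sup>+y. inverse (ennreal y) * indicator {0..} y / m_inv M * indicator {0..x} y \<partial>M)"
    unfolding phi0_def by (rule emeasure_density) (auto simp: assms)
  also have "\<dots> = (\<integral>\<^sup>+y. inverse (ennreal y) * indicator {0..x} y / m_inv M \<partial>M)"
    by (intro nn_integral_cong) (auto split: split_indicator)
  also have "\<dots> = (\<integral>\<^sup>+y\<in>{0..x}. inverse (ennreal y) \<partial>M) / m_inv M"
    by (rule nn_integral_divide) measurable
  finally show ?thesis .
qed

lemma sets_phi [simp]: "sets (phi a M) = sets borel"
  by (metis phi_def sets.sigma_sets_eq sets_measure_of space_borel subset_UNIV Pow_UNIV)

lemma emeasure_phi:
  assumes "sets M = sets borel" "A \<in> sets borel"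
  shows "emeasure (phi a M) A = inverse (ennreal (a + 1)) *
     (ennreal a * emeasure (return borel 0) A + emeasure (phi0 M) A)"
  unfolding phi_def
proof (rule emeasure_measure_of_sigma)
  show "sigma_algebra UNIV (sets (borel :: real measure))"
    by (metis sets.sigma_algebra_axioms space_borel)
  show "countably_additive (sets borel) (\<lambda>A. inverse (ennreal (a + 1)) *
        (ennreal a * emeasure (return borel 0) A + emeasure (phi0 M) A))"
  proof (rule countably_additiveI)
    fix B :: "nat \<Rightarrow> real set"
    assume *: "range B \<subseteq> sets borel" "disjoint_family B"
    have "(\<Sum>i. emeasure (return borel 0) (B i)) = emeasure (return borel 0) (\<Union>i. B i)"
      using * by (intro suminf_emeasure) auto
    moreover have "(\<Sum>i. emeasure (phi0 M) (B i)) = emeasure (phi0 M) (\<Union>i. B i)"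
      using * assms by (intro suminf_emeasure) (auto simp: phi0_def)
    ultimately show "(\<Sum>i. inverse (ennreal (a + 1)) *
        (ennreal a * emeasure (return borel 0) (B i) + emeasure (phi0 M) (B i))) =
        inverse (ennreal (a + 1)) *
        (ennreal a * emeasure (return borel 0) (\<Union>i. B i) + emeasure (phi0 M) (\<Union>i. B i))"
      by (simp flip: suminf_add)
  qed
qed (use assms in \<open>auto simp: positive_def\<close>)

lemma phi_zero:
  assumes "sets M = sets borel"
  shows "phi 0 M = phi0 M"
  by (rule measure_eqI) (use assms in \<open>auto simp: emeasure_phi phi0_def\<close>)

end

theory Submission
  imports Defs "HOL-Computational_Algebra.Fundamental_Theorem_Algebra"
begin

text \<open>
  Write \<open>lt, mt\<close> for the given rates and put \<open>l n = mt (n + 1)\<close>, \<open>m = lt\<close>, so that \<open>lt, mt\<close> are the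
  dual rates of \<open>l, m\<close>; take \<open>psi(dx) = x phit(dx) / lt 0\<close>.  In Siegmund duality the process for
  \<open>l, m\<close> is \<open>P t i j = (\<Sum>k\<le>i. Pt t j k - Pt t (j + 1) k)\<close>, and the polynomials for \<open>l, m\<close>
  are the kernel polynomials of \<open>phit\<close>, so \<open>psi\<close> represents \<open>P\<close>.  The Kolmogorov equations and
  \<open>(\<Sum>j. P t i j) \<le> 1\<close> are inherited from \<open>Pt\<close>; positivity of \<open>P\<close> comes from that of all powers
  of the resolvent.  Uniqueness follows by Laplace transform, because the homogeneous resolvent
  equation has, up to a factor, only one solution.

  For naturality let \<open>E n\<close> be the orthogonal polynomial of \<open>psi\<close> scaled to \<open>E n (- s) = 1\<close>.  The
  divergence hypothesis makes \<open>\<integral> (E n y)\<^sup>2 / (y + s) psi(dy)\<close> tend to \<open>0\<close>.  For another solution \<open>N\<close> the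
  limit of these integrals is the difference \<open>\<delta>\<close> of the two Stieltjes transforms at \<open>- s\<close>.  If the support of
  \<open>N\<close> starts no earlier than that of \<open>psi\<close>, at \<open>xi\<close> say, then \<open>\<delta> > 0\<close> would keep \<open>E n (xi)\<close>
  away from \<open>0\<close> and all roots away from \<open>xi\<close>, hence \<open>E n\<close> away from \<open>0\<close> on an interval of positive
  \<open>psi\<close>-measure.  So \<open>\<delta> = 0\<close> for all \<open>s\<close>, and \<open>N = psi\<close>.
\<close>

section \<open>Supports and Laplace transforms\<close>

text \<open>Up to the factor \<open>lt 0\<close>, the weights of \<open>l, m\<close> are the other
  half of the divergent series: \<open>pd n = lt 0 / (lt n * pt n)\<close>. So the hypothesis says
  that \<open>pt\<close> or \<open>pd\<close> is not summable, and this dichotomy is used wherever a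
  limit has to vanish. Positivity of \<open>P\<close> is the obstacle in the construction:
  differences of distribution functions of \<open>Pt\<close> have no evident sign, nor has the
  integral of \<open>exp (- x * t) * q i x * q j x\<close>. The exponential is the limit of the
  functions \<open>1 / (1 + x * t / n) ^ n\<close>, that is, of powers of the resolvent, whose signs
  can be followed through the orthogonal polynomials. The factor \<open>x\<close> in
  \<open>psi\<close> erases the atom of \<open>phit\<close> at \<open>0\<close>; the number
  \<open>a\<close> is exactly what puts it back. Naturality is obtained without deciding whether the
  moment problem is determined: only competitors whose support starts no earlier than that of
  \<open>psi\<close> have to be excluded. These live on the half-line again, so their Stieltjes
  transforms at \<open>- s\<close> make sense.\<close>

lemma AE_in_supp:
  assumes [measurable_cong]: "sets M = sets borel"
  shows "AE x in M. x \<in> supp M"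
proof -
  define F where "F = {U::real set. open U \<and> emeasure M U = 0}"
  \<comment> \<open>By Lindelof, countably many null open sets already cover the complement of the
    support.\<close>
  obtain G where G: "G \<subseteq> F" "countable G" "\<Union>G = \<Union>F"
    using Lindelof[of F] unfolding F_def by auto
  have "(\<Union>U\<in>G. U) \<in> null_sets M"
    by (rule null_sets_UN') (use G in \<open>auto simp: F_def null_sets_def assms\<close>)
  then have "\<Union>G \<in> null_sets M" by simp
  then have "AE x in M. x \<notin> \<Union>F"
    unfolding G(3) by (rule AE_not_in)
  then show ?thesis
    by eventually_elim (auto simp: F_def supp_def zero_less_iff_neq_zero)
qed

lemma supp_subset_closed:
  assumes "AE x in M. x \<in> C" "closed C" "sets M = sets borel"
  shows "supp M \<subseteq> C"
proof
  fix x assume x: "x \<in> supp M"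
  show "x \<in> C"
  proof (rule ccontr)
    assume "x \<notin> C"
    then have "emeasure M (-C) > 0"
      using x assms(2) by (auto simp: supp_def)
    moreover have "emeasure M (-C) = 0"
      using assms by (intro AE_iff_measurable[THEN iffD1, OF _ _ assms(1)])
        (auto dest: sets_eq_imp_space_eq)
    ultimately show False by simp
  qed
qed

lemma emeasure_near_Inf_supp:
  assumes "sets M = sets borel" "supp M \<noteq> {}" "bdd_below (supp M)" "d > 0"
  shows "emeasure M {..<Inf (supp M) + d} > 0"
proof -
  obtain x where "x \<in> supp M" "x < Inf (supp M) + d"
    using cInf_lessD[of "supp M" "Inf (supp M) + d"] assms by auto
  then show ?thesis by (auto simp: supp_def)
qed

text \<open>Pushing the measures forward by \<open>x \<mapsto> exp (- x)\<close> moves them to \<open>[0, 1]\<close>, where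
  the hypothesis says that all moments agree.\<close>

lemma laplace_transform_unique:
  fixes M N :: "real measure"
  assumes "prob_space M" "prob_space N" and sets: "sets M = sets borel" "sets N = sets borel"
    and pos: "AE x in M. x \<ge> 0" "AE x in N. x \<ge> 0"
    and eq: "\<And>n::nat. (LINT x|M. exp (- (real n * x))) = (LINT x|N. exp (- (real n * x)))"
  shows "M = N"
proof -
  note [measurable_cong] = sets
  interpret M: prob_space M by fact
  interpret N: prob_space N by fact
  define T where "T K = distr K borel (\<lambda>x::real. exp (- x))" for K
  have Mb: "(\<lambda>x. exp (- x)) \<in> borel_measurable M" and Nb: "(\<lambda>x. exp (- x)) \<in> borel_measurable N"
    by measurable
  interpret TM: prob_space "T M" unfolding T_def by (rule M.prob_space_distr[OF Mb])
  interpret TN: prob_space "T N" unfolding T_def by (rule N.prob_space_distr[OF Nb])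
  have rd: "real_distribution (T M)" "real_distribution (T N)"
    unfolding real_distribution_def real_distribution_axioms_def
    using TM.prob_space_axioms TN.prob_space_axioms by (auto simp: T_def)
  have [simp, measurable_cong]: "sets (T K) = sets borel" for K by (simp add: T_def)
  have ae: "AE u in T M. 0 \<le> u \<and> u \<le> 1" "AE u in T N. 0 \<le> u \<and> u \<le> 1"
    unfolding T_def using pos by (simp_all add: AE_distr_iff)
  have mom: "(LINT u|T M. u ^ n) = (LINT u|T N. u ^ n)" for n
    unfolding T_def using eq[of n]
    by (simp add: integral_distr sets flip: exp_of_nat_mult)
  have cont: "(LINT u|T M. f u) = (LINT u|T N. f u)"
    if f: "continuous_on UNIV f" and bd: "\<And>u. \<bar>f u\<bar> \<le> B" for f :: "real \<Rightarrow> real" and B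
  proof -
    have [measurable]: "f \<in> borel_measurable borel"
      using f by (rule borel_measurable_continuous_onI)
    have intf: "integrable (T M) f" "integrable (T N) f"
      using bd by (auto intro!: TM.integrable_const_bound[where B=B] TN.integrable_const_bound[where B=B])
    have "\<bar>(LINT u|T M. f u) - (LINT u|T N. f u)\<bar> \<le> 2 * e" if "e > 0" for e
    proof -
      obtain g where g: "real_polynomial_function g" "\<And>x. x \<in> {0..1} \<Longrightarrow> \<bar>f x - g x\<bar> < e"
        using Stone_Weierstrass_real_polynomial_function[of "{0..1}" f e] f \<open>e > 0\<close>
        by (auto intro: continuous_on_subset)
      obtain a n where g': "g = (\<lambda>x. \<Sum>i\<le>n. a i * x ^ i)"
        using g(1) unfolding real_polynomial_function_iff_sum by auto
      have "AE u in T M. norm (u ^ i) \<le> 1" for i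
        using ae(1) by eventually_elim (simp add: power_le_one)
      moreover have "AE u in T N. norm (u ^ i) \<le> 1" for i
        using ae(2) by eventually_elim (simp add: power_le_one)
      ultimately have pw: "integrable (T M) (\<lambda>x. x ^ i)" "integrable (T N) (\<lambda>x. x ^ i)" for i
        by (auto intro!: TM.integrable_const_bound[where B=1] TN.integrable_const_bound[where B=1])
      have intg: "integrable (T M) g" "integrable (T N) g"
        unfolding g' using pw by auto
      have geq: "(LINT u|T M. g u) = (LINT u|T N. g u)"
        unfolding g' using pw mom by (subst (1 2) Bochner_Integration.integral_sum) auto
      have "AE u in T M. \<bar>f u - g u\<bar> \<le> e"
        using ae(1) by eventually_elim (use g(2) in \<open>force intro: less_imp_le\<close>)
      then have *: "\<bar>LINT u|T M. f u - g u\<bar> \<le> (LINT u|T M. e)"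
        using intf intg by (intro order_trans[OF integral_abs_bound] integral_mono_AE) auto
      have "AE u in T N. \<bar>f u - g u\<bar> \<le> e"
        using ae(2) by eventually_elim (use g(2) in \<open>force intro: less_imp_le\<close>)
      then have **: "\<bar>LINT u|T N. f u - g u\<bar> \<le> (LINT u|T N. e)"
        using intf intg by (intro order_trans[OF integral_abs_bound] integral_mono_AE) auto
      show ?thesis
        using * ** geq intf intg by (simp add: TM.prob_space TN.prob_space)
    qed
    \<comment> \<open>With \<open>e\<close> a quarter of the difference, the difference would be at
      most half of itself.\<close>
    from this[of "\<bar>(LINT u|T M. f u) - (LINT u|T N. f u)\<bar> / 4"] show ?thesis
      by (cases "(LINT u|T M. f u) = (LINT u|T N. f u)") auto
  qed
  have "char (T M) = char (T N)"
  proof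
    fix t
    have chr: "char K t = Complex (LINT x|K. cos (t * x)) (LINT x|K. sin (t * x))"
      if "prob_space K" "sets K = sets borel" for K
    proof -
      interpret prob_space K by fact
      note [measurable_cong] = that(2)
      have "integrable K (\<lambda>x. iexp (t * x))"
        by (rule integrable_const_bound[where B=1]) auto
      from integral_Re[OF this] integral_Im[OF this] show ?thesis
        unfolding char_def by (simp add: complex_eq_iff Re_exp Im_exp del: integral_Re integral_Im)
    qed
    have "(LINT x|T M. cos (t * x)) = (LINT x|T N. cos (t * x))"
      by (rule cont[of _ 1]) (auto intro!: continuous_intros)
    moreover have "(LINT x|T M. sin (t * x)) = (LINT x|T N. sin (t * x))"
      by (rule cont[of _ 1]) (auto intro!: continuous_intros)
    ultimately show "char (T M) t = char (T N) t"
      by (simp add: chr TM.prob_space_axioms TN.prob_space_axioms)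
  qed
  then have eqT: "T M = T N" by (rule Levy_uniqueness[OF rd])
  have pull: "distr (T K) borel (\<lambda>u. - ln u) = K" if K: "sets K = sets borel" for K
  proof -
    have "(\<lambda>x::real. exp (- x)) \<in> borel_measurable K"
      unfolding measurable_cong_sets[OF K refl] by measurable
    then have "distr (T K) borel (\<lambda>u. - ln u) = distr K borel ((\<lambda>u. - ln u) \<circ> (\<lambda>x. exp (- x)))"
      unfolding T_def by (intro distr_distr) auto
    also have "(\<lambda>u. - ln u) \<circ> (\<lambda>x::real. exp (- x)) = (\<lambda>x. x)" by (simp add: fun_eq_iff)
    also have "distr K borel (\<lambda>x. x) = K" by (rule distr_id2) (rule K[symmetric])
    finally show ?thesis .
  qed
  show ?thesis using pull[OF sets(1)] pull[OF sets(2)] unfolding eqT by (rule trans[OF sym])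
qed

section \<open>Orthogonal polynomials on the half-line\<close>

lemma map_poly_of_real_add:
  "map_poly of_real (p + q) = (map_poly of_real p + map_poly of_real q :: complex poly)"
  by (rule poly_eqI) (simp add: coeff_map_poly)

lemma map_poly_of_real_mult:
  "map_poly of_real (p * q) = (map_poly of_real p * map_poly of_real q :: complex poly)"
proof (induction p)
  case (pCons a p)
  have "map_poly of_real (smult a q) = (smult (of_real a) (map_poly of_real q) :: complex poly)"
    by (rule poly_eqI) (simp add: coeff_map_poly)
  then show ?case using pCons by (simp add: map_poly_of_real_add map_poly_pCons)
qed simp

text \<open>A complex root \<open>a + i b\<close> has \<open>b \<noteq> 0\<close>. The remainder
  modulo its real quadratic is linear with real coefficients and vanishes at this root, hence is
  zero.\<close>

lemma real_poly_quadratic_factor: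
  fixes p :: "real poly"
  assumes "degree p > 0" "\<And>x. poly p x \<noteq> 0"
  obtains a b where "b \<noteq> 0" "[:a\<^sup>2 + b\<^sup>2, - 2 * a, 1:] dvd p"
proof -
  let ?P = "map_poly complex_of_real p"
  have ev: "poly (map_poly complex_of_real r) (of_real x) = of_real (poly r x)" for r x
    by (induction r) (auto simp: map_poly_pCons)
  have "\<not> constant (poly ?P)"
    using assms(1) by (subst constant_degree) (simp add: degree_map_poly)
  then obtain z where z: "poly ?P z = 0" using fundamental_theorem_of_algebra by blast
  define a b where "a = Re z" and "b = Im z"
  have "b \<noteq> 0"
  proof
    assume "b = 0"
    then have "z = of_real a" by (simp add: a_def b_def complex_eq_iff)
    then show False using z ev[of p a] assms(2)[of a] by simp
  qed
  define q where "q = [:a\<^sup>2 + b\<^sup>2, - 2 * a, 1:]"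
  define r where "r = p mod q"
  have "degree q = 2" by (simp add: q_def)
  then have "r = 0 \<or> degree r < 2" using degree_mod_less[of q p] unfolding r_def by fastforce
  then have "degree r \<le> 1" by auto
  then have "r = [:coeff r 0, coeff r 1:]"
    by (intro poly_eqI) (auto simp: coeff_pCons coeff_eq_0 split: nat.splits)
  then obtain c d where r: "r = [:c, d:]" by blast
  have qz: "poly (map_poly complex_of_real q) z = 0"
    unfolding q_def by (simp add: map_poly_pCons a_def b_def complex_eq_iff power2_eq_square algebra_simps)
  have "p = q * (p div q) + r" unfolding r_def by simp
  then have "?P = map_poly of_real q * map_poly of_real (p div q) + map_poly of_real r"
    by (metis map_poly_of_real_add map_poly_of_real_mult)
  then have "poly (map_poly complex_of_real r) z = 0"
    using z qz by simp
  then have "of_real c + z * of_real d = 0" by (simp add: r map_poly_pCons)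
  then have "c + a * d = 0" "b * d = 0"
    by (auto simp: complex_eq_iff a_def b_def)
  then have "r = 0" using \<open>b \<noteq> 0\<close> r by simp
  then have "q dvd p" unfolding r_def by (simp add: mod_eq_0_iff_dvd)
  then show ?thesis using that \<open>b \<noteq> 0\<close> q_def by blast
qed

lemma real_poly_splits:
  fixes p :: "real poly"
  assumes "lead_coeff p = 1"
    and "\<And>a b. b \<noteq> 0 \<Longrightarrow> \<not> [:a\<^sup>2 + b\<^sup>2, - 2 * a, 1:] dvd p"
  shows "\<exists>xs. length xs = degree p \<and> p = (\<Prod>x\<leftarrow>xs. [:-x, 1:])"
  using assms
proof (induction "degree p" arbitrary: p)
  case 0
  then have "p = 1" by (metis degree_0_id one_poly_eq_simps(1) pCons_one)
  then show ?case by (intro exI[of _ "[]"]) simp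
next
  case (Suc n)
  obtain x where "poly p x = 0"
    using real_poly_quadratic_factor[of p] Suc.hyps(2) Suc.prems(2) by (metis zero_less_Suc)
  then obtain h where h: "p = [:-x, 1:] * h" by (metis poly_eq_0_iff_dvd dvdE)
  have "h \<noteq> 0" using Suc.prems(1) h by auto
  then have deg: "degree p = Suc (degree h)" by (simp add: h degree_mult_eq del: mult_pCons_left)
  have "lead_coeff h = 1" using Suc.prems(1) unfolding h lead_coeff_mult by simp
  moreover have "\<not> [:a\<^sup>2 + b\<^sup>2, - 2 * a, 1:] dvd h" if "b \<noteq> 0" for a b
    using Suc.prems(2)[OF that] h dvd_mult by metis
  ultimately obtain xs where "length xs = degree h" "h = (\<Prod>x\<leftarrow>xs. [:-x, 1:])"
    using Suc.hyps(1)[of h] Suc.hyps(2) deg by auto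
  then show ?case using deg h by (intro exI[of _ "x # xs"]) simp
qed

lemma borel_measurable_poly [measurable]: "poly (p :: real poly) \<in> borel_measurable borel"
  by (intro borel_measurable_continuous_onI continuous_intros)

text \<open>Only values on \<open>{0..}\<close> matter, because the measures have no mass elsewhere.
  Boundedness there makes \<open>poly p x * w x\<close> integrable, positivity makes the inner
  product definite.\<close>

definition weight :: "(real \<Rightarrow> real) \<Rightarrow> bool" where
  "weight w \<longleftrightarrow> w \<in> borel_measurable borel \<and> (\<forall>x\<ge>0. w x > 0) \<and> (\<exists>B. \<forall>x\<ge>0. w x \<le> B)"

locale half_line_measure =
  fixes M :: "real measure"
  assumes moment_measure: "moment_measure M" and supp_nonneg: "supp M \<subseteq> {0..}"
begin

lemma sets_M [simp, measurable_cong]: "sets M = sets borel"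
  using moment_measure by (simp add: moment_measure_def)

lemma space_M [simp]: "space M = UNIV"
  using sets_eq_imp_space_eq[OF sets_M] by simp

sublocale prob_space M
  using moment_measure by (simp add: moment_measure_def)

lemma infinite_supp: "infinite (supp M)"
  using moment_measure by (simp add: moment_measure_def)

lemma AE_nonneg: "AE x in M. x \<ge> 0"
  using AE_in_supp[OF sets_M] by eventually_elim (use supp_nonneg in auto)

lemma integrable_poly [intro, simp]: "integrable M (poly p)"
proof -
  have "poly p = (\<lambda>x. \<Sum>i\<le>degree p. coeff p i * x ^ i)" by (auto simp: poly_altdef)
  then show ?thesis using moment_measure by (auto simp: moment_measure_def)
qed

lemma integrable_poly_mult:
  assumes [measurable]: "w \<in> borel_measurable borel" and "\<And>x. x \<ge> 0 \<Longrightarrow> \<bar>w x\<bar> \<le> B"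
  shows "integrable M (\<lambda>x. poly p x * w x)"
proof (rule Bochner_Integration.integrable_bound)
  show "integrable M (\<lambda>x. B * poly p x)" by simp
  show "(\<lambda>x. poly p x * w x) \<in> borel_measurable M" by measurable
  show "AE x in M. norm (poly p x * w x) \<le> norm (B * poly p x)"
    using AE_nonneg
  proof eventually_elim
    case (elim x)
    then show ?case using mult_right_mono[of "\<bar>w x\<bar>" "\<bar>B\<bar>" "\<bar>poly p x\<bar>"] assms(2)[of x]
      by (auto simp: abs_mult mult.commute)
  qed
qed

text \<open>If the integral were zero, the measure would be concentrated on a finite, hence closed,
  set of zeros, and the support would be finite.\<close>

lemma integral_pos:
  fixes f :: "real \<Rightarrow> real"
  assumes f: "integrable M f" and nn: "AE x in M. 0 \<le> f x" and fin: "finite {x \<in> supp M. f x = 0}"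
  shows "(LINT x|M. f x) > 0"
proof (rule ccontr)
  assume "\<not> ?thesis"
  then have "(LINT x|M. f x) = 0" using integral_nonneg_AE[OF nn] by linarith
  then have "AE x in M. f x = 0" using integral_nonneg_eq_0_iff_AE[OF f nn] by simp
  then have "AE x in M. x \<in> {x \<in> supp M. f x = 0}"
    using AE_in_supp[OF sets_M] by eventually_elim auto
  then have "supp M \<subseteq> {x \<in> supp M. f x = 0}"
    by (rule supp_subset_closed) (use fin in \<open>auto intro: finite_imp_closed\<close>)
  then show False using fin infinite_supp finite_subset by blast
qed

section \<open>Weighted inner products and monic orthogonal polynomials\<close>

definition ip :: "(real \<Rightarrow> real) \<Rightarrow> real poly \<Rightarrow> real poly \<Rightarrow> real" where
  "ip w p q = (LINT x|M. poly p x * poly q x * w x)"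

lemma weight_integrable:
  assumes "weight w"
  shows "integrable M (\<lambda>x. poly p x * w x)"
proof -
  obtain B where B: "\<And>x. x \<ge> 0 \<Longrightarrow> w x \<le> B" "\<And>x. x \<ge> 0 \<Longrightarrow> w x > 0"
    using assms by (auto simp: weight_def)
  show ?thesis
    by (rule integrable_poly_mult[where B=B])
       (use assms B in \<open>auto simp: weight_def abs_of_pos\<close>)
qed

lemma ip_integrable: "weight w \<Longrightarrow> integrable M (\<lambda>x. poly p x * poly q x * w x)"
  using weight_integrable[of w "p * q"] by simp

lemma ip_commute: "ip w p q = ip w q p"
  by (simp add: ip_def mult_ac)

lemma ip_add_left: "weight w \<Longrightarrow> ip w (p + p') q = ip w p q + ip w p' q"
  unfolding ip_def by (simp add: ring_distribs ip_integrable)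

lemma ip_diff_left: "weight w \<Longrightarrow> ip w (p - p') q = ip w p q - ip w p' q"
  unfolding ip_def by (simp add: ring_distribs ip_integrable)

lemma ip_smult_left: "ip w (smult c p) q = c * ip w p q"
  unfolding ip_def by (simp add: mult.assoc)

lemma ip_sum_left:
  assumes w: "weight w" and "finite A"
  shows "ip w (\<Sum>k\<in>A. f k) q = (\<Sum>k\<in>A. ip w (f k) q)"
  using assms(2) by (induction A rule: finite_induct) (auto simp: ip_add_left[OF w], simp add: ip_def)

lemma ip_smult_right: "ip w q (smult c p) = c * ip w q p"
  by (simp add: ip_commute[of w q] ip_smult_left)

lemma ip_sum_right:
  "weight w \<Longrightarrow> finite A \<Longrightarrow> ip w q (\<Sum>k\<in>A. f k) = (\<Sum>k\<in>A. ip w q (f k))"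
  by (simp add: ip_commute[of w q] ip_sum_left)

lemma ip_pos:
  assumes w: "weight w" and "g \<noteq> 0" and "finite {x. poly f x = 0}" and "\<And>x. x \<in> supp M \<Longrightarrow> poly f x \<ge> 0"
  shows "ip w (f * g) g > 0"
  unfolding ip_def
proof (rule integral_pos)
  show "integrable M (\<lambda>x. poly (f * g) x * poly g x * w x)" by (rule ip_integrable[OF w])
  have wp: "w x > 0" if "x \<in> supp M" for x using that w supp_nonneg by (auto simp: weight_def)
  show "AE x in M. 0 \<le> poly (f * g) x * poly g x * w x"
    using AE_in_supp[OF sets_M]
  proof eventually_elim
    case (elim x)
    have "0 \<le> poly f x * (poly g x * poly g x) * w x"
      using assms(4) elim wp[OF elim] by (auto intro!: mult_nonneg_nonneg)
    then show ?case by (simp add: mult_ac)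
  qed
  have "{x \<in> supp M. poly (f * g) x * poly g x * w x = 0} \<subseteq> {x. poly f x = 0} \<union> {x. poly g x = 0}"
    using wp by force
  then show "finite {x \<in> supp M. poly (f * g) x * poly g x * w x = 0}"
    using assms(3) poly_roots_finite[OF \<open>g \<noteq> 0\<close>] finite_subset by blast
qed

lemma ip_self_pos:
  assumes "weight w" "g \<noteq> 0"
  shows "ip w g g > 0"
  using ip_pos[OF assms, of 1] by simp

definition monic_orth :: "(real \<Rightarrow> real) \<Rightarrow> nat \<Rightarrow> real poly \<Rightarrow> bool" where
  "monic_orth w n p \<longleftrightarrow> degree p = n \<and> lead_coeff p = 1 \<and> (\<forall>q. degree q < n \<longrightarrow> ip w q p = 0)"

lemma monic_orth_nonzero: "monic_orth w n p \<Longrightarrow> p \<noteq> 0"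
  by (auto simp: monic_orth_def)

lemma monic_orth_expand:
  assumes w: "weight w" and S: "\<And>k. k \<le> n \<Longrightarrow> monic_orth w k (S k)" and "degree p \<le> n"
  shows "p = (\<Sum>k\<le>n. smult (ip w p (S k) / ip w (S k) (S k)) (S k))"
  using assms(2,3)
proof (induction n arbitrary: p)
  case 0
  have "S 0 = 1" using 0(1)[of 0] unfolding monic_orth_def
    by (metis degree_0_id le_refl one_poly_eq_simps(1) pCons_one)
  moreover obtain c where "p = [:c:]" using 0(2) by (metis degree_0_id le_zero_eq)
  ultimately show ?case using ip_self_pos[OF w, of 1] ip_smult_left[of w c 1 1] by simp
next
  case (Suc n)
  have Sn: "monic_orth w (Suc n) (S (Suc n))" using Suc.prems by simp
  define c where "c = coeff p (Suc n)"
  define p' where "p' = p - smult c (S (Suc n))"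
  have "coeff p' k = 0" if "k > n" for k
  proof (cases "k = Suc n")
    case True
    have "coeff (S (Suc n)) (Suc n) = 1" using Sn by (metis monic_orth_def)
    then show ?thesis using True by (simp add: p'_def c_def)
  next
    case False
    then show ?thesis using that Sn Suc.prems(2) by (simp add: p'_def monic_orth_def coeff_eq_0)
  qed
  then have deg: "degree p' \<le> n" by (intro degree_le) auto
  have ne: "ip w (S k) (S k) > 0" if "k \<le> Suc n" for k
    using ip_self_pos[OF w] monic_orth_nonzero Suc.prems(1) that by blast
  have orth: "ip w (S (Suc n)) (S k) = 0" if "k \<le> n" for k
    using Sn Suc.prems(1)[of k] that by (subst ip_commute) (auto simp: monic_orth_def)
  have "ip w p' (S (Suc n)) = 0" using Sn deg by (auto simp: monic_orth_def)
  \<comment> \<open>The leading coefficient of \<open>p\<close> is also its Fourier coefficient,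
    since \<open>p'\<close> has too small a degree to see \<open>S (Suc n)\<close>.\<close>
  then have c: "c = ip w p (S (Suc n)) / ip w (S (Suc n)) (S (Suc n))"
    using ne[of "Suc n"] by (simp add: p'_def ip_diff_left[OF w] ip_smult_left)
  have "p' = (\<Sum>k\<le>n. smult (ip w p' (S k) / ip w (S k) (S k)) (S k))"
    using Suc.IH[OF _ deg] Suc.prems(1) by simp
  also have "\<dots> = (\<Sum>k\<le>n. smult (ip w p (S k) / ip w (S k) (S k)) (S k))"
    by (intro sum.cong) (auto simp: p'_def ip_diff_left[OF w] ip_smult_left orth)
  finally show ?case using c by (simp add: p'_def algebra_simps)
qed

text \<open>Gram-Schmidt applied to the monomials.\<close>

lemma monic_orth_exists:
  assumes w: "weight w"
  shows "\<exists>p. monic_orth w n p"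
proof (induction n rule: less_induct)
  case (less n)
  then have "\<forall>k. \<exists>p. k < n \<longrightarrow> monic_orth w k p" by blast
  then obtain S where S: "\<And>k. k < n \<Longrightarrow> monic_orth w k (S k)" by metis
  define p where "p = monom 1 n - (\<Sum>k<n. smult (ip w (monom 1 n) (S k) / ip w (S k) (S k)) (S k))"
    (is "_ = _ - ?T")
  have T0: "coeff ?T j = 0" if "j \<ge> n" for j
    unfolding coeff_sum using S that by (intro sum.neutral) (auto simp: monic_orth_def coeff_eq_0)
  have cn: "coeff p n = 1" using T0[of n] by (simp add: p_def)
  have "degree p \<le> n" by (rule degree_le) (use T0 in \<open>simp add: p_def\<close>)
  then have deg: "degree p = n" using cn by (metis le_antisym le_degree zero_neq_one)
  have Sk: "ip w p (S k) = 0" if "k < n" for k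
  proof -
    have ne: "ip w (S k) (S k) > 0" using ip_self_pos[OF w] monic_orth_nonzero S that by blast
    have z: "ip w (S j) (S k) = 0" if "j < n" "j \<noteq> k" for j
      using S[OF that(1)] S[OF \<open>k < n\<close>] that(2) ip_commute[of w "S j" "S k"] by (cases "j < k") (auto simp: monic_orth_def)
    have "ip w ?T (S k) = (\<Sum>j<n. ip w (monom 1 n) (S j) / ip w (S j) (S j) * ip w (S j) (S k))"
      by (simp add: ip_sum_left[OF w] ip_smult_left)
    also have "\<dots> = (\<Sum>j\<in>{k}. ip w (monom 1 n) (S j) / ip w (S j) (S j) * ip w (S j) (S k))"
      using z that by (intro sum.mono_neutral_right) auto
    finally show ?thesis using ne by (simp add: p_def ip_diff_left[OF w])
  qed
  have "ip w q p = 0" if dq: "degree q < n" for q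
  proof -
    obtain m where m: "n = Suc m" using dq by (cases n) auto
    have "q = (\<Sum>k\<le>m. smult (ip w q (S k) / ip w (S k) (S k)) (S k))"
      using S dq m by (intro monic_orth_expand[OF w]) auto
    then have "ip w q p = (\<Sum>k\<le>m. ip w q (S k) / ip w (S k) (S k) * ip w (S k) p)"
      by (metis (mono_tags, lifting) finite_atMost ip_smult_left ip_sum_left[OF w] sum.cong)
    also have "\<dots> = 0" using Sk m by (intro sum.neutral) (auto simp: ip_commute)
    finally show ?thesis .
  qed
  then show ?case using deg cn by (auto simp: monic_orth_def)
qed

text \<open>A quadratic factor without real roots, or a root \<open>r \<le> c\<close>, would make \<open>p h\<close> of one sign
  on the support for the cofactor \<open>h\<close>, contradicting \<open>p \<perpendicular> h\<close>.\<close>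

lemma monic_orth_roots:
  assumes w: "weight w" and p: "monic_orth w n p" and c: "supp M \<subseteq> {c..}"
  obtains xs where "length xs = n" "p = (\<Prod>x\<leftarrow>xs. [:-x, 1:])" "\<And>x. x \<in> set xs \<Longrightarrow> c < x"
proof -
  have contr: False if "p = f * h" "degree f > 0" "\<And>x. x \<in> supp M \<Longrightarrow> poly f x \<ge> 0" for f h
  proof -
    have "h \<noteq> 0" "f \<noteq> 0" using that monic_orth_nonzero[OF p] by auto
    then have "degree h < n" using that p by (auto simp: monic_orth_def degree_mult_eq)
    then have "ip w h p = 0" using p by (auto simp: monic_orth_def)
    moreover have "ip w (f * h) h > 0"
      by (rule ip_pos) (use w \<open>h \<noteq> 0\<close> that poly_roots_finite[OF \<open>f \<noteq> 0\<close>] in auto)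
    ultimately show False using that(1) by (simp add: ip_commute)
  qed
  have "\<not> [:a\<^sup>2 + b\<^sup>2, - 2 * a, 1:] dvd p" for a b :: real
  proof
    assume "[:a\<^sup>2 + b\<^sup>2, - 2 * a, 1:] dvd p"
    then obtain h where h: "p = [:a\<^sup>2 + b\<^sup>2, - 2 * a, 1:] * h" by (elim dvdE)
    have "poly [:a\<^sup>2 + b\<^sup>2, - 2 * a, 1:] x = (x - a)\<^sup>2 + b\<^sup>2" for x
      by (simp add: power2_eq_square algebra_simps)
    then show False using contr[OF h] by (metis One_nat_def degree_pCons_eq_if not_gr_zero nat.distinct(1)
      one_neq_zero pCons_eq_0_iff add_nonneg_nonneg zero_le_power2)
  qed
  then obtain xs where xs: "length xs = n" "p = (\<Prod>x\<leftarrow>xs. [:-x, 1:])"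
    using real_poly_splits[of p] p by (auto simp: monic_orth_def)
  have "c < x" if x: "x \<in> set xs" for x
  proof (rule ccontr)
    assume "\<not> c < x"
    have "[:-x, 1:] dvd p" unfolding xs(2) using x by (intro prod_list_dvd) auto
    then obtain h where "p = [:-x, 1:] * h" by (elim dvdE)
    then show False by (rule contr) (use c \<open>\<not> c < x\<close> in auto)
  qed
  with xs that show ?thesis by blast
qed

end

section \<open>Powers of the resolvent and positivity for exponential weights\<close>

definition resolvent_weight :: "real \<Rightarrow> nat \<Rightarrow> real \<Rightarrow> real" where
  "resolvent_weight s m x = 1 / (x + s) ^ m"

lemma weight_resolvent: "s > 0 \<Longrightarrow> weight (resolvent_weight s m)"
  unfolding weight_def
proof (intro conjI exI allI impI)
  show "resolvent_weight s m \<in> borel_measurable borel"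
    unfolding resolvent_weight_def[abs_def] by measurable
  fix x :: real assume "s > 0" "x \<ge> 0"
  then show "resolvent_weight s m x \<le> 1 / s ^ m"
    unfolding resolvent_weight_def by (intro divide_left_mono power_mono) auto
qed (auto simp: resolvent_weight_def)

lemma weight_one: "weight (\<lambda>_. 1)"
  by (auto simp: weight_def)

context half_line_measure
begin

text \<open>All roots are positive, so each of the \<open>n\<close> linear factors is negative at
  \<open>- s\<close>.\<close>

lemma monic_orth_sign:
  assumes "weight w" "monic_orth w n p" "s > 0"
  shows "(-1) ^ n * poly p (- s) > 0"
proof -
  obtain xs where xs: "length xs = n" "p = (\<Prod>x\<leftarrow>xs. [:-x, 1:])" "\<And>x. x \<in> set xs \<Longrightarrow> 0 < x"
    using monic_orth_roots[OF assms(1,2) supp_nonneg] by blast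
  have "(\<And>x. x \<in> set ys \<Longrightarrow> 0 < x) \<Longrightarrow> (-1) ^ length ys * poly (\<Prod>x\<leftarrow>ys. [:-x, 1:]) (- s) > 0" for ys
  proof (induction ys)
    case (Cons y ys)
    have "(-1) ^ length (y # ys) * poly (\<Prod>x\<leftarrow>y # ys. [:-x, 1:]) (- s) =
        (s + y) * ((-1) ^ length ys * poly (\<Prod>x\<leftarrow>ys. [:-x, 1:]) (- s))"
      by (simp add: algebra_simps)
    also have "\<dots> > 0" using Cons.IH Cons.prems assms(3)
      by (intro mult_pos_pos[OF add_pos_pos]) (metis list.set_intros)+
    finally show ?case .
  qed simp
  then show ?thesis using xs by metis
qed

lemma monic_orth_orthogonal:
  assumes "monic_orth w i p" "monic_orth w j q" "i \<noteq> j"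
  shows "ip w p q = 0"
proof (cases "i < j")
  case True
  then show ?thesis using assms by (auto simp: monic_orth_def)
next
  case False
  then have "ip w q p = 0" using assms by (auto simp: monic_orth_def)
  then show ?thesis by (simp add: ip_commute)
qed

lemma ip_resolvent_Suc:
  assumes "s > 0"
  shows "ip (resolvent_weight s (Suc m)) ([:s, 1:] * p) q = ip (resolvent_weight s m) p q"
  unfolding ip_def
proof (rule integral_cong_AE)
  show "AE x in M. poly ([:s, 1:] * p) x * poly q x * resolvent_weight s (Suc m) x =
      poly p x * poly q x * resolvent_weight s m x"
    using AE_nonneg
  proof eventually_elim
    case (elim x)
    then have "x + s \<noteq> 0" using assms by simp
    then show ?case by (simp add: resolvent_weight_def divide_simps) (simp add: algebra_simps)
  qed
qed (auto simp: resolvent_weight_def[abs_def] simp del: mult_pCons_left)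

text \<open>\<open>q\<close> minus its value at \<open>- s\<close> is divisible by
  \<open>x + s\<close>. The quotient has degree below \<open>n\<close> and meets \<open>P\<close>
  under the weight with one power less, where \<open>P\<close> is orthogonal to it; only the
  constant survives.\<close>

lemma ip_eval_split:
  assumes "s > 0" and P: "monic_orth (resolvent_weight s m) n P" and "degree q \<le> n"
  shows "ip (resolvent_weight s (Suc m)) P q = poly q (- s) * ip (resolvent_weight s (Suc m)) P 1"
proof -
  let ?w = "resolvent_weight s"
  note w = weight_resolvent[OF assms(1)]
  have "[:s, 1:] dvd q - [:poly q (- s):]"
    by (subst minus_minus[of s, symmetric], subst poly_eq_0_iff_dvd[symmetric]) simp
  then obtain g where g: "q - [:poly q (- s):] = [:s, 1:] * g" by (elim dvdE)
  have "ip (?w m) g P = 0"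
  proof (cases "g = 0")
    case True then show ?thesis by (simp add: ip_def)
  next
    case False
    then have "Suc (degree g) = degree ([:s, 1:] * g)" by (simp add: degree_mult_eq del: mult_pCons_left)
    also have "\<dots> \<le> degree q" unfolding g[symmetric] by (metis degree_diff_le degree_pCons_0 le0 order_refl)
    finally show ?thesis using P assms(3) by (auto simp: monic_orth_def)
  qed
  then have "ip (?w (Suc m)) (q - smult (poly q (- s)) 1) P = 0"
    using ip_resolvent_Suc[OF assms(1), of m g P] g by simp
  then show ?thesis
    unfolding ip_diff_left[OF w] ip_smult_left ip_commute[of _ P] by simp
qed

text \<open>Induction on \<open>n\<close>, simultaneously for all weights \<open>(x + s)\<^sup>-\<^sup>m\<close>: with alternating signs the
  orthogonal polynomials for one weight are nonnegative combinations of those for the next.\<close>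

lemma resolvent_power_nonneg:
  assumes s: "s > 0" and S: "\<And>m k. monic_orth (resolvent_weight s m) k (S m k)"
  shows "(-1) ^ (i + j) * ip (resolvent_weight s (m + n)) (S m i) (S m j) \<ge> 0"
proof (induction n arbitrary: m i j)
  case 0
  note w = weight_resolvent[OF s, of m]
  show ?case
  proof (cases "i = j")
    case True
    have "ip (resolvent_weight s m) (S m i) (S m i) > 0"
      using S[of m i] by (intro ip_self_pos[OF w] monic_orth_nonzero)
    moreover have "(-1) ^ (i + j) = (1 :: real)" using True by simp
    ultimately show ?thesis unfolding True by (simp only: add_0_right mult_1)
  next
    case False
    then show ?thesis using monic_orth_orthogonal[OF S S] by simp
  qed
next
  case (Suc n)
  let ?w = "resolvent_weight s"
  note w = weight_resolvent[OF s]
  define c where "c i k = ip (?w (Suc m)) (S m i) (S (Suc m) k) / ip (?w (Suc m)) (S (Suc m) k) (S (Suc m) k)"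
    for i k
  have exp: "S m i = (\<Sum>k\<le>i. smult (c i k) (S (Suc m) k))" for i
    unfolding c_def by (rule monic_orth_expand[OF w]) (use S[of m i] in \<open>simp_all add: S monic_orth_def[of _ i]\<close>)
  have c: "(-1) ^ (i + k) * c i k \<ge> 0" if "k \<le> i" for i k
  proof -
    have h: "ip (?w (Suc m)) (S (Suc m) k) (S (Suc m) k) > 0" for k
      using S[of "Suc m" k] by (intro ip_self_pos[OF w] monic_orth_nonzero)
    have deg: "degree (S (Suc m) k) = k" for k using S[of "Suc m" k] by (simp add: monic_orth_def)
    \<comment> \<open>By \<open>ip_eval_split\<close> every connection coefficient
      \<open>c i k\<close> is \<open>A\<close> times the value of \<open>S (Suc m) k\<close> at
      \<open>- s\<close>, divided by a squared norm. Comparing leading coefficients gives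
      \<open>c i i = 1\<close>, which fixes the sign of \<open>A\<close> and with it all the
      signs.\<close>
    define A where "A = ip (?w (Suc m)) (S m i) 1"
    have A: "ip (?w (Suc m)) (S m i) (S (Suc m) k) = poly (S (Suc m) k) (- s) * A" if "k \<le> i" for k
      unfolding A_def by (rule ip_eval_split[OF s S[of m i]]) (simp add: deg that)
    have "coeff (S m i) i = c i i"
    proof -
      have "coeff (S m i) i = (\<Sum>k\<le>i. c i k * coeff (S (Suc m) k) i)"
        by (subst exp) (simp add: coeff_sum)
      also have "\<dots> = (\<Sum>k\<in>{i}. c i k * coeff (S (Suc m) k) i)"
        by (intro sum.mono_neutral_right) (auto simp: coeff_eq_0 deg)
      finally have "coeff (S m i) i = c i i * coeff (S (Suc m) i) i" by simp
      moreover have "coeff (S (Suc m) i) i = 1" using S[of "Suc m" i] by (metis monic_orth_def)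
      ultimately show ?thesis by simp
    qed
    moreover have "coeff (S m i) i = 1" using S[of m i] unfolding monic_orth_def by metis
    ultimately have "poly (S (Suc m) i) (- s) * A > 0"
      using A[of i] h[of i] by (simp add: c_def field_simps)
    moreover have "((-1) ^ i * poly (S (Suc m) i) (- s)) * ((-1) ^ i * A) = poly (S (Suc m) i) (- s) * A"
      by (cases "even i") auto
    ultimately have "((-1) ^ i * poly (S (Suc m) i) (- s)) * ((-1) ^ i * A) > 0"
      by (simp only:)
    then have "(-1) ^ i * A > 0"
      using monic_orth_sign[OF w S[of "Suc m" i] s] zero_less_mult_pos by blast
    moreover have "(-1) ^ k * poly (S (Suc m) k) (- s) > 0" by (rule monic_orth_sign[OF w S s])
    ultimately have "((-1) ^ k * poly (S (Suc m) k) (- s)) * ((-1) ^ i * A) > 0"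
      by (rule mult_pos_pos[rotated])
    moreover have "((-1) ^ k * poly (S (Suc m) k) (- s)) * ((-1) ^ i * A) =
        (-1) ^ (i + k) * (poly (S (Suc m) k) (- s) * A)"
      unfolding power_add by (simp only: mult_ac)
    ultimately have "(-1) ^ (i + k) * (poly (S (Suc m) k) (- s) * A) / ip (?w (Suc m)) (S (Suc m) k) (S (Suc m) k) \<ge> 0"
      using h[of k] by (intro divide_nonneg_pos) (simp_all only: less_imp_le)
    then show ?thesis unfolding c_def A[OF that] by simp
  qed
  have "(-1) ^ (i + j) * ip (?w (m + Suc n)) (S m i) (S m j) =
      (\<Sum>k\<le>i. \<Sum>l\<le>j. ((-1) ^ (i + k) * c i k) * ((-1) ^ (j + l) * c j l) *
         ((-1) ^ (k + l) * ip (?w (Suc m + n)) (S (Suc m) k) (S (Suc m) l)))"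
  proof -
    have "ip (?w (m + Suc n)) (S m i) (S m j) =
        (\<Sum>k\<le>i. \<Sum>l\<le>j. c i k * (c j l * ip (?w (Suc m + n)) (S (Suc m) k) (S (Suc m) l)))"
    proof -
      have "ip (?w (m + Suc n)) q (S m j) = (\<Sum>l\<le>j. c j l * ip (?w (Suc m + n)) q (S (Suc m) l))" for q
        unfolding exp[of j] ip_sum_right[OF w finite_atMost] ip_smult_right by simp
      then show ?thesis
        unfolding exp[of i] ip_sum_left[OF w finite_atMost] ip_smult_left by (simp add: sum_distrib_left)
    qed
    then have "(-1) ^ (i + j) * ip (?w (m + Suc n)) (S m i) (S m j) =
        (\<Sum>k\<le>i. \<Sum>l\<le>j. (-1) ^ (i + j) * (c i k * (c j l * ip (?w (Suc m + n)) (S (Suc m) k) (S (Suc m) l))))"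
      by (simp only: sum_distrib_left)
    also have "\<dots> = (\<Sum>k\<le>i. \<Sum>l\<le>j. ((-1) ^ (i + k) * c i k) * ((-1) ^ (j + l) * c j l) *
         ((-1) ^ (k + l) * ip (?w (Suc m + n)) (S (Suc m) k) (S (Suc m) l)))"
    proof (intro sum.cong refl)
      fix k l
      have *: "(-1) ^ (i + j) = ((-1) ^ (i + k) * (-1) ^ (j + l) * (-1) ^ (k + l) :: real)"
        by (cases "even k"; cases "even l") (auto simp: power_add)
      show "(-1) ^ (i + j) * (c i k * (c j l * ip (?w (Suc m + n)) (S (Suc m) k) (S (Suc m) l))) =
          ((-1) ^ (i + k) * c i k) * ((-1) ^ (j + l) * c j l) *
            ((-1) ^ (k + l) * ip (?w (Suc m + n)) (S (Suc m) k) (S (Suc m) l))"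
        unfolding * by (simp only: mult_ac)
    qed
    finally show ?thesis .
  qed
  also have "\<dots> \<ge> 0"
    by (intro sum_nonneg mult_nonneg_nonneg[OF mult_nonneg_nonneg[OF c c] Suc.IH]) auto
  finally show ?case .
qed

lemma exp_weight_nonneg:
  assumes t: "t \<ge> 0" and P: "\<And>k. monic_orth (\<lambda>_. 1) k (P k)"
  shows "(-1) ^ (i + j) * ip (\<lambda>x. exp (- x * t)) (P i) (P j) \<ge> 0"
proof -
  \<comment> \<open>These functions tend to \<open>exp (- x * t)\<close>. The value \<open>0\<close>
    on the negative axis gives \<open>0 \<le> W n x \<le> 1\<close> everywhere; for
    \<open>t > 0\<close> and \<open>s = real (Suc n) / t\<close> they are \<open>s ^ Suc n\<close>
    times a resolvent weight on \<open>{0..}\<close>.\<close>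
  define W where "W n x = (if x \<ge> 0 then 1 / (1 + x * t / real (Suc n)) ^ Suc n else 0)" for n x
  have nn: "(-1) ^ (i + j) * ip (W n) (P i) (P j) \<ge> 0" if t: "t > 0" for n
  proof -
    define s where "s = real (Suc n) / t"
    have s: "s > 0" using t by (simp add: s_def)
    have one: "resolvent_weight s 0 = (\<lambda>_. 1)" by (auto simp: resolvent_weight_def)
    have "\<forall>m. \<exists>p. \<forall>k. monic_orth (resolvent_weight s m) k (p k)"
      using monic_orth_exists[OF weight_resolvent[OF s]] by metis
    then obtain S' where S': "\<And>m k. monic_orth (resolvent_weight s m) k (S' m k)" by metis
    \<comment> \<open>The exponent \<open>0\<close> belongs to the constant weight \<open>1\<close>,
      so the given \<open>P\<close> may serve as the zeroth family.\<close>
    define S where "S m = (if m = 0 then P else S' m)" for m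
    have "(-1) ^ (i + j) * ip (resolvent_weight s (0 + Suc n)) (S 0 i) (S 0 j) \<ge> 0"
      by (rule resolvent_power_nonneg[OF s]) (simp add: S_def P S' one)
    moreover have "ip (W n) (P i) (P j) = s ^ Suc n * ip (resolvent_weight s (Suc n)) (P i) (P j)"
      unfolding ip_def integral_mult_right_zero[symmetric]
    proof (rule integral_cong_AE)
      show "AE x in M. poly (P i) x * poly (P j) x * W n x =
          s ^ Suc n * (poly (P i) x * poly (P j) x * resolvent_weight s (Suc n) x)"
        using AE_nonneg
      proof eventually_elim
        case (elim x)
        have "1 + x * t / N = (x + N / t) / (N / t)" if "N > 0" for N
          using t that by (simp add: field_simps)
        from this[of "real (Suc n)"] have "1 + x * t / real (Suc n) = (x + s) / s"
          unfolding s_def by simp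
        then have "W n x = s ^ Suc n * resolvent_weight s (Suc n) x"
          using elim s unfolding W_def resolvent_weight_def by (simp only: power_divide) simp
        then show ?case by simp
      qed
    qed (auto simp: W_def[abs_def] resolvent_weight_def[abs_def])
    ultimately show ?thesis using s by (simp add: S_def mult.left_commute zero_le_mult_iff)
  qed
  have lim: "(\<lambda>n. ip (W n) (P i) (P j)) \<longlonglongrightarrow> ip (\<lambda>x. exp (- x * t)) (P i) (P j)"
    unfolding ip_def
  proof (rule integral_dominated_convergence[where w="\<lambda>x. \<bar>poly (P i * P j) x\<bar>"])
    show "integrable M (\<lambda>x. \<bar>poly (P i * P j) x\<bar>)" by (rule integrable_abs) (rule integrable_poly)
    show "AE x in M. (\<lambda>n. poly (P i) x * poly (P j) x * W n x) \<longlonglongrightarrow> poly (P i) x * poly (P j) x * exp (- x * t)"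
      using AE_nonneg
    proof eventually_elim
      case (elim x)
      have "(\<lambda>n. (1 + x * t / real n) ^ n) \<longlonglongrightarrow> exp (x * t)" by (rule tendsto_exp_limit_sequentially)
      then have "(\<lambda>n. (1 + x * t / real (Suc n)) ^ Suc n) \<longlonglongrightarrow> exp (x * t)" by (rule LIMSEQ_Suc)
      then have "(\<lambda>n. 1 / (1 + x * t / real (Suc n)) ^ Suc n) \<longlonglongrightarrow> 1 / exp (x * t)"
        by (intro tendsto_divide tendsto_const) auto
      then have "(\<lambda>n. W n x) \<longlonglongrightarrow> exp (- x * t)"
        using elim by (simp add: W_def exp_minus inverse_eq_divide del: power_Suc)
      then show ?case by (intro tendsto_intros)
    qed
    show "AE x in M. norm (poly (P i) x * poly (P j) x * W n x) \<le> \<bar>poly (P i * P j) x\<bar>" for n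
    proof (rule AE_I2)
      fix x
      have "W n x \<le> 1" "W n x \<ge> 0"
      proof -
        have "1 \<le> (1 + x * t / real (Suc n)) ^ Suc n" if "x \<ge> 0"
          by (rule one_le_power) (use t that in auto)
        then show "W n x \<le> 1" "W n x \<ge> 0"
          by (auto simp: W_def simp del: power_Suc)
      qed
      then show "norm (poly (P i) x * poly (P j) x * W n x) \<le> \<bar>poly (P i * P j) x\<bar>"
        by (simp add: abs_mult mult_left_le)
    qed
  qed (auto simp: W_def[abs_def])
  show ?thesis
  proof (cases "t = 0")
    case True
    then show ?thesis using monic_orth_orthogonal[OF P P] ip_self_pos[OF weight_one monic_orth_nonzero[OF P], of i]
      by (cases "i = j") auto
  next
    case False
    then show ?thesis using t nn
      by (intro tendsto_lowerbound[OF tendsto_mult[OF tendsto_const lim]]) auto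
  qed
qed

end

section \<open>Dual rate sets\<close>

text \<open>The Karlin-McGregor normalization. It removes all signs and products from the
  representation: the transition functions become \<open>pi_coeff l m j\<close> times the integral
  of \<open>exp (- x * t) * bd_q l m i x * bd_q l m j x\<close>.\<close>

definition bd_q :: "(nat \<Rightarrow> real) \<Rightarrow> (nat \<Rightarrow> real) \<Rightarrow> nat \<Rightarrow> real \<Rightarrow> real" where
  "bd_q l m n x = (-1) ^ n / (\<Prod>k<n. l k) * poly (bd_poly l m n) x"

lemma rate_setD:
  assumes "rate_set l m"
  shows "l n > 0" "m (Suc n) > 0" "m n \<ge> 0"
proof -
  show "l n > 0" "m (Suc n) > 0" using assms by (auto simp: rate_set_def)
  show "m n \<ge> 0" using assms by (cases n) (auto simp: rate_set_def intro: less_imp_le)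
qed

lemma degree_bd_poly: "degree (bd_poly l m n) = n" and lead_coeff_bd_poly: "coeff (bd_poly l m n) n = 1"
proof -
  have "degree (bd_poly l m n) = n \<and> coeff (bd_poly l m n) n = 1"
  proof (induction l m n rule: bd_poly.induct)
    case (3 l m n)
    let ?p = "bd_poly l m (Suc (Suc n))"
    have z: "coeff (bd_poly l m (Suc n)) k = 0" if "k > Suc n" for k
      using that 3(1) by (simp add: coeff_eq_0)
    have z': "coeff (bd_poly l m n) k = 0" if "k > n" for k
      using that 3(2) by (simp add: coeff_eq_0)
    have c: "coeff ?p (Suc (Suc n)) = 1" using 3(1) by (simp add: z z')
    moreover have "degree ?p \<le> Suc (Suc n)"
      by (rule degree_le) (auto simp: z z' coeff_pCons split: nat.splits)
    ultimately show ?case by (metis le_antisym le_degree zero_neq_one)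
  qed auto
  then show "degree (bd_poly l m n) = n" "coeff (bd_poly l m n) n = 1" by auto
qed

lemma pi_coeff_0 [simp]: "pi_coeff l m 0 = 1"
  by (simp add: pi_coeff_def)

lemma pi_coeff_pos: "rate_set l m \<Longrightarrow> pi_coeff l m n > 0"
  unfolding pi_coeff_def
proof (intro divide_pos_pos prod_pos ballI)
  fix k assume r: "rate_set l m"
  show "l k > 0" by (rule rate_setD(1)[OF r])
  show "m k > 0" if "k \<in> {1..n}" using that rate_setD(2)[OF r] by (cases k) auto
qed

lemma pi_coeff_Suc: "rate_set l m \<Longrightarrow> m (Suc n) * pi_coeff l m (Suc n) = l n * pi_coeff l m n"
  using rate_setD(2)[of l m n] by (simp add: pi_coeff_def)

lemma bd_q_0 [simp]: "bd_q l m 0 x = 1"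
  by (simp add: bd_q_def)

lemma bd_q_1: "rate_set l m \<Longrightarrow> l 0 * bd_q l m (Suc 0) x = l 0 + m 0 - x"
  using rate_setD(1)[of l m 0] by (simp add: bd_q_def field_simps)

lemma bd_q_rec:
  assumes "rate_set l m"
  shows "l (Suc n) * bd_q l m (Suc (Suc n)) x =
    (l (Suc n) + m (Suc n) - x) * bd_q l m (Suc n) x - m (Suc n) * bd_q l m n x"
proof -
  define L where "L = (\<Prod>k<n. l k)"
  have "L > 0" "l n > 0" "l (Suc n) > 0" unfolding L_def using rate_setD(1)[OF assms] by (auto intro: prod_pos)
  then show ?thesis
    unfolding bd_q_def bd_poly.simps
    by (simp add: L_def[symmetric] field_simps)
qed

text \<open>Multiplied by \<open>pi_coeff\<close>, the three-term recurrence becomes a difference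
  equation in divergence form, by the detailed balance \<open>pi_coeff_Suc\<close>; it is summed
  here.\<close>

lemma bd_q_diff:
  assumes "rate_set l m"
  shows "l n * pi_coeff l m n * (bd_q l m (Suc n) x - bd_q l m n x) =
    m 0 - x * (\<Sum>k\<le>n. pi_coeff l m k * bd_q l m k x)"
proof (induction n)
  case 0
  then show ?case using bd_q_1[OF assms, of x] by (simp add: algebra_simps)
next
  case (Suc n)
  let ?p = "pi_coeff l m" and ?q = "\<lambda>n. bd_q l m n x"
  have "l (Suc n) * ?p (Suc n) * (?q (Suc (Suc n)) - ?q (Suc n)) =
      ?p (Suc n) * (l (Suc n) * ?q (Suc (Suc n)) - l (Suc n) * ?q (Suc n))"
    by (simp add: algebra_simps)
  also have "\<dots> = (m (Suc n) * ?p (Suc n)) * (?q (Suc n) - ?q n) - x * (?p (Suc n) * ?q (Suc n))"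
    unfolding bd_q_rec[OF assms] by (simp add: algebra_simps)
  also have "\<dots> = l n * ?p n * (?q (Suc n) - ?q n) - x * (?p (Suc n) * ?q (Suc n))"
    unfolding pi_coeff_Suc[OF assms] ..
  also have "\<dots> = m 0 - x * (\<Sum>k\<le>Suc n. ?p k * ?q k)"
    unfolding Suc.IH by (simp add: algebra_simps)
  finally show ?case .
qed

text \<open>For \<open>x \<le> 0\<close> the right-hand side of \<open>bd_q_diff\<close> is
  nonnegative as long as the earlier values are, so the sequence increases from
  \<open>1\<close>.\<close>

lemma bd_q_ge_1:
  assumes r: "rate_set l m" and x: "x \<le> 0"
  shows "bd_q l m n x \<ge> 1"
proof (induction n rule: less_induct)
  case (less n)
  show ?case
  proof (cases n)
    case (Suc k)
    have "(\<Sum>j\<le>k. pi_coeff l m j * bd_q l m j x) \<ge> 0"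
      using less Suc pi_coeff_pos[OF r] by (intro sum_nonneg mult_nonneg_nonneg) (auto intro: less_imp_le order_trans[of 0 1])
    then have "m 0 - x * (\<Sum>j\<le>k. pi_coeff l m j * bd_q l m j x) \<ge> 0"
      using x rate_setD(3)[OF r, of 0] by (simp add: mult_nonpos_nonneg order_trans[of _ 0])
    then have "0 \<le> (l k * pi_coeff l m k) * (bd_q l m (Suc k) x - bd_q l m k x)"
      unfolding bd_q_diff[OF r] .
    moreover have "l k * pi_coeff l m k > 0" using rate_setD(1)[OF r] pi_coeff_pos[OF r] by simp
    ultimately have "bd_q l m k x \<le> bd_q l m (Suc k) x" by (simp add: zero_le_mult_iff)
    then show ?thesis using less[of k] Suc by simp
  qed simp
qed

lemma corresponding_constant:
  assumes "rate_set l m"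
  shows "(-1) ^ (i + j) / ((\<Prod>k<i. l k) * (\<Prod>k=1..j. m k)) * (poly (bd_poly l m i) x * poly (bd_poly l m j) x) =
    pi_coeff l m j * (bd_q l m i x * bd_q l m j x)"
proof -
  have "(\<Prod>k<j. l k) > 0" using rate_setD(1)[OF assms] by (auto intro: prod_pos)
  moreover have "(-1) ^ (i + j) / (B * C) * (p * r) = A / C * ((-1) ^ i / B * p * ((-1) ^ j / A * r))"
    if "A > 0" for A B C p r :: real
    using that by (simp add: power_add mult_ac)
  ultimately show ?thesis
    unfolding bd_q_def pi_coeff_def by blast
qed

section \<open>Weights and polynomials of the dual rates\<close>

locale dual_rates =
  fixes lt mt :: "nat \<Rightarrow> real"
  assumes rates: "rate_set lt mt" and mt0: "mt 0 = 0"
begin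

abbreviation "l \<equiv> (\<lambda>n. mt (Suc n))"
abbreviation "m \<equiv> lt"
abbreviation "pt \<equiv> pi_coeff lt mt"
abbreviation "qt \<equiv> bd_q lt mt"

lemma rates': "rate_set l m"
  using rates by (auto simp: rate_set_def intro: less_imp_le)

text \<open>This identifies the terms \<open>1 / (lt n * pt n)\<close> of the divergent series with
  the weights of \<open>l, m\<close>.\<close>

lemma pi_dual: "pi_coeff l m n = lt 0 / (lt n * pt n)"
proof (induction n)
  case 0
  then show ?case using rate_setD(1)[OF rates, of 0] by simp
next
  case (Suc n)
  have "lt (Suc n) > 0" "lt n > 0" "mt (Suc n) > 0" "pt n > 0" "pt (Suc n) > 0"
    using rate_setD[OF rates] pi_coeff_pos[OF rates] by auto
  moreover have "lt (Suc n) * pi_coeff l m (Suc n) = mt (Suc n) * pi_coeff l m n"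
    using pi_coeff_Suc[OF rates', of n] by simp
  moreover have "mt (Suc n) * (lt 0 / (lt n * pt n)) = lt 0 / pt (Suc n)"
    unfolding pi_coeff_Suc[OF rates, symmetric] using calculation(3) by simp
  ultimately have "lt (Suc n) * pi_coeff l m (Suc n) = lt 0 / pt (Suc n)"
    unfolding Suc by simp
  then show ?case using \<open>lt (Suc n) > 0\<close> \<open>pt (Suc n) > 0\<close> by (simp add: field_simps)
qed

lemma x_sum_qt: "x * (\<Sum>k\<le>n. pt k * qt k x) = lt n * pt n * (qt n x - qt (Suc n) x)"
  using bd_q_diff[OF rates, of n x] mt0 by (simp add: algebra_simps)

text \<open>As \<open>mt 0 = 0\<close> makes every \<open>qt k\<close> equal to \<open>1\<close> at
  \<open>0\<close>, the sum is the reproducing kernel of \<open>phit\<close> with one argument at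
  \<open>0\<close>. Such kernel polynomials are orthogonal for \<open>x phit(dx)\<close>. The proof
  only checks the recurrence.\<close>

lemma q_dual: "bd_q l m n x = (\<Sum>k\<le>n. pt k * qt k x)"
proof -
  define S where "S n = (\<Sum>k\<le>n. pt k * qt k x)" for n
  have SS: "S (Suc n) = S n + pt (Suc n) * qt (Suc n) x" for n by (simp add: S_def)
  have diff: "mt (Suc n) * (S (Suc n) - S n) = lt n * pt n * qt n x - x * S n" for n
  proof -
    have "mt (Suc n) * (S (Suc n) - S n) = (mt (Suc n) * pt (Suc n)) * qt (Suc n) x"
      by (simp add: SS)
    also have "\<dots> = lt n * pt n * qt (Suc n) x" unfolding pi_coeff_Suc[OF rates] ..
    finally show ?thesis
      using x_sum_qt[of x n] unfolding S_def right_diff_distrib by linarith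
  qed
  have "bd_q l m n x = S n \<and> bd_q l m (Suc n) x = S (Suc n)"
  proof (induction n)
    case 0
    have "mt 1 * bd_q l m (Suc 0) x = mt 1 * S (Suc 0)"
      using bd_q_1[OF rates', of x] diff[of 0] by (simp add: S_def algebra_simps)
    then show ?case using rate_setD(2)[OF rates, of 0] by (simp add: S_def)
  next
    case (Suc n)
    have "l (Suc n) * bd_q l m (Suc (Suc n)) x = l (Suc n) * S (Suc (Suc n))"
      unfolding bd_q_rec[OF rates'] using Suc diff[of "Suc n"] SS[of n] by (simp add: algebra_simps)
    then show ?case using rate_setD(2)[OF rates, of "Suc n"] Suc by simp
  qed
  then show ?thesis by (simp add: S_def)
qed

end

section \<open>Uniqueness of birth-death processes\<close>

definition laplace :: "(real \<Rightarrow> real) \<Rightarrow> real \<Rightarrow> real" where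
  "laplace f s = (LINT t:{0..}|lborel. exp (- (s * t)) * f t)"

lemma exp_integral:
  assumes "s > 0"
  shows "set_integrable lborel {0..} (\<lambda>t::real. exp (- (s * t)))"
    and "(LINT t:{0..}|lborel. exp (- (s * t))) = 1 / s"
proof -
  have "(\<integral>\<^sup>+x. ennreal (exp (- (s * x))) * indicator {0 ..} x \<partial>lborel) = ennreal (0 - (- exp (- (s * 0)) / s))"
  proof (rule nn_integral_FTC_atLeast)
    show "((\<lambda>x. - exp (- (s * x)) / s) has_real_derivative exp (- (s * x))) (at x)" for x
      using assms by (auto intro!: derivative_eq_intros)
    have "((\<lambda>x. exp (- (s * x))) \<longlongrightarrow> 0) at_top"
      using assms by (intro filterlim_compose[OF exp_at_bot])
        (simp add: filterlim_uminus_at_bot filterlim_tendsto_pos_mult_at_top[OF tendsto_const] filterlim_ident)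
    from tendsto_divide[OF tendsto_minus[OF this] tendsto_const[of s]] assms
    show "((\<lambda>x. - exp (- (s * x)) / s) \<longlongrightarrow> 0) at_top" by simp
  qed auto
  then have "(\<integral>\<^sup>+x. ennreal (indicator {0 ..} x *\<^sub>R exp (- (s * x))) \<partial>lborel) = ennreal (1 / s)"
    by (simp add: mult.commute ennreal_mult'' ennreal_indicator)
  then have "has_bochner_integral lborel (\<lambda>x. indicator {0 ..} x *\<^sub>R exp (- (s * x))) (1 / s)"
    by (intro has_bochner_integral_nn_integral) (use assms in auto)
  then show "set_integrable lborel {0..} (\<lambda>t::real. exp (- (s * t)))"
    "(LINT t:{0..}|lborel. exp (- (s * t))) = 1 / s"
    unfolding set_integrable_def set_lebesgue_integral_def by (auto simp: has_bochner_integral_iff)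
qed

lemma laplace_integrable:
  fixes f :: "real \<Rightarrow> real"
  assumes "s > 0" "continuous_on {0..} f" "\<And>t. t \<ge> 0 \<Longrightarrow> \<bar>f t\<bar> \<le> B"
  shows "set_integrable lborel {0..} (\<lambda>t. exp (- (s * t)) * f t)"
proof (rule set_integrable_bound)
  show "set_integrable lborel {0..} (\<lambda>t. B * exp (- (s * t)))"
    using exp_integral(1)[OF assms(1)] by (rule set_integrable_mult_right[rotated])
  show "set_borel_measurable lborel {0..} (\<lambda>t. exp (- (s * t)) * f t)"
    unfolding set_borel_measurable_def measurable_lborel2
    by (rule borel_measurable_continuous_on_indicator) (auto intro!: continuous_intros assms)
  show "AE t in lborel. t \<in> {0..} \<longrightarrow> norm (exp (- (s * t)) * f t) \<le> norm (B * exp (- (s * t)))"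
    using assms(3) by (auto simp: abs_mult intro!: AE_I2 mult_right_mono) (metis abs_ge_self order_trans)
qed

lemma laplace_const: "s > 0 \<Longrightarrow> laplace (\<lambda>_. c) s = c / s"
  using exp_integral(2)[of s] by (simp add: laplace_def set_integral_mult_left)

lemma laplace_add:
  assumes "s > 0" "continuous_on {0..} f" "\<And>t. t \<ge> 0 \<Longrightarrow> \<bar>f t\<bar> \<le> B"
    and "continuous_on {0..} g" "\<And>t. t \<ge> 0 \<Longrightarrow> \<bar>g t\<bar> \<le> C"
  shows "laplace (\<lambda>t. f t + g t) s = laplace f s + laplace g s"
  unfolding laplace_def
  by (subst set_integral_add(2)[symmetric])
     (auto intro: laplace_integrable[OF assms(1-3)] laplace_integrable[OF assms(1,4,5)] simp: ring_distribs)

lemma laplace_cmult: "laplace (\<lambda>t. c * f t) s = c * laplace f s"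
  unfolding laplace_def by (simp add: mult.left_commute[of _ c] set_integral_mult_right)

lemma laplace_sum:
  assumes s: "s > 0" and "finite A"
    and f: "\<And>j. continuous_on {0..} (f j)" "\<And>j t. t \<ge> 0 \<Longrightarrow> \<bar>f j t\<bar> \<le> B"
  shows "laplace (\<lambda>t. \<Sum>j\<in>A. f j t) s = (\<Sum>j\<in>A. laplace (f j) s)"
  using assms(2)
proof (induction A rule: finite_induct)
  case empty
  then show ?case by (simp add: laplace_def)
next
  case (insert a A)
  have bd: "\<bar>\<Sum>j\<in>A. f j t\<bar> \<le> (\<Sum>j\<in>A. B)" if "t \<ge> 0" for t
    using f(2)[OF that] by (intro order_trans[OF sum_abs] sum_mono)
  have "continuous_on {0..} (\<lambda>t. \<Sum>j\<in>A. f j t)" by (intro continuous_intros f)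
  from laplace_add[OF s f(1) f(2) this bd] insert show ?case by simp
qed

lemma laplace_bound:
  assumes "s > 0" "continuous_on {0..} f" "\<And>t. t \<ge> 0 \<Longrightarrow> \<bar>f t\<bar> \<le> B"
  shows "\<bar>laplace f s\<bar> \<le> B / s"
proof -
  have "\<bar>laplace f s\<bar> \<le> (LINT t:{0..}|lborel. norm (exp (- (s * t)) * f t))"
    unfolding laplace_def using set_integral_norm_bound[OF laplace_integrable[OF assms]] by simp
  also have "\<dots> \<le> (LINT t:{0..}|lborel. exp (- (s * t)) * B)"
    using assms(3)
    by (intro set_integral_mono set_integrable_norm laplace_integrable[OF assms] laplace_integrable[OF assms(1), where B="\<bar>B\<bar>"])
       (auto simp: abs_mult)
  also have "\<dots> = B / s" using laplace_const[OF assms(1), of B] by (simp add: laplace_def)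
  finally show ?thesis .
qed

lemma laplace_derivative:
  assumes "s > 0" and der: "\<And>t. t \<ge> 0 \<Longrightarrow> (w has_real_derivative w' t) (at t within {0..})"
    and w: "\<And>t. t \<ge> 0 \<Longrightarrow> \<bar>w t\<bar> \<le> B"
    and w': "continuous_on {0..} w'" "\<And>t. t \<ge> 0 \<Longrightarrow> \<bar>w' t\<bar> \<le> B'"
  shows "s * laplace w s = w 0 + laplace w' s"
proof -
  have cw: "continuous_on {0..} w"
    using der by (auto intro: DERIV_continuous simp: continuous_on_eq_continuous_within)
  \<comment> \<open>This is the derivative of \<open>- exp (- (s * t)) * w t\<close>, so the
    fundamental theorem handles both transforms in one integral. The form
    \<open>+ - 1 * w' t\<close> suits \<open>laplace_add\<close> and
    \<open>laplace_cmult\<close>.\<close>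
  let ?h = "\<lambda>t. exp (- (s * t)) * (s * w t + - 1 * w' t)"
  have bd: "\<bar>s * w t + - 1 * w' t\<bar> \<le> s * B + B'" if "t \<ge> 0" for t
  proof -
    have "\<bar>s * w t\<bar> \<le> s * B" using w[OF that] assms(1) by (simp add: abs_mult)
    then show ?thesis using w'(2)[OF that] by linarith
  qed
  have int: "set_integrable lborel {0..} ?h"
    by (rule laplace_integrable[OF assms(1) _ bd]) (auto intro!: continuous_intros cw w')
  have "(LINT t:{0..b}|lborel. ?h t) = w 0 - exp (- (s * b)) * w b" if "b \<ge> 0" for b
  proof -
    have "(LINT t:{0..b}|lborel. ?h t) = - (exp (- (s * b)) * w b) - - (exp (- (s * 0)) * w 0)"
      unfolding set_lebesgue_integral_def
    proof (rule integral_FTC_atLeastAtMost[OF that])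
      fix x assume x: "0 \<le> x" "x \<le> b"
      have "(w has_real_derivative w' x) (at x within {0..b})"
        by (rule DERIV_subset[OF der[OF x(1)]]) auto
      then have "((\<lambda>t. - (exp (- (s * t)) * w t)) has_real_derivative ?h x) (at x within {0..b})"
        by (auto intro!: derivative_eq_intros simp: algebra_simps)
      then show "((\<lambda>t. - (exp (- (s * t)) * w t)) has_vector_derivative ?h x) (at x within {0..b})"
        by (simp add: has_real_derivative_iff_has_vector_derivative)
    qed (auto intro!: continuous_intros continuous_on_subset[OF cw] continuous_on_subset[OF w'(1)])
    then show ?thesis by simp
  qed
  then have "\<forall>\<^sub>F b in at_top. (LINT t:{0..b}|lborel. ?h t) = w 0 - exp (- (s * b)) * w b"
    using eventually_ge_at_top[of 0] by (rule eventually_mono[rotated])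
  moreover have "((\<lambda>b. LINT t:{0..b}|lborel. ?h t) \<longlongrightarrow> (LINT t:{0..}|lborel. ?h t)) at_top"
    by (rule tendsto_set_lebesgue_integral_at_top[OF _ int]) simp
  ultimately have l1: "((\<lambda>b. w 0 - exp (- (s * b)) * w b) \<longlongrightarrow> (LINT t:{0..}|lborel. ?h t)) at_top"
    using tendsto_cong by fastforce
  have e0: "((\<lambda>x. exp (- (s * x)) * B) \<longlongrightarrow> 0) at_top"
  proof -
    have "((\<lambda>x. exp (- (s * x))) \<longlongrightarrow> 0) at_top"
      using assms by (intro filterlim_compose[OF exp_at_bot])
        (simp add: filterlim_uminus_at_bot filterlim_tendsto_pos_mult_at_top[OF tendsto_const] filterlim_ident)
    from tendsto_mult[OF this tendsto_const[of B]] show ?thesis by simp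
  qed
  have "((\<lambda>b. exp (- (s * b)) * w b) \<longlongrightarrow> 0) at_top"
    by (rule Lim_null_comparison[OF _ e0])
       (use w in \<open>auto intro!: eventually_mono[OF eventually_ge_at_top[of 0]] simp: abs_mult\<close>)
  then have "((\<lambda>b. w 0 - exp (- (s * b)) * w b) \<longlongrightarrow> w 0 - 0) at_top"
    by (intro tendsto_intros)
  then have "w 0 = (LINT t:{0..}|lborel. ?h t)"
    using tendsto_unique[OF _ l1] by simp
  also have "\<dots> = laplace (\<lambda>t. s * w t + - 1 * w' t) s" by (simp add: laplace_def)
  also have "\<dots> = s * laplace w s + - 1 * laplace w' s"
  proof (subst laplace_add[where B="s * B" and C=B', OF assms(1)])
    show "continuous_on {0..} (\<lambda>t. s * w t)" "continuous_on {0..} (\<lambda>t. - 1 * w' t)"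
      by (auto intro!: continuous_intros cw w')
  qed (use assms w w' in \<open>auto simp: abs_mult laplace_cmult[of _ w s] laplace_cmult[of "-1" w' s, simplified]\<close>)
  finally show ?thesis by simp
qed

text \<open>Adding \<open>1\<close> to both functions makes \<open>exp (- t) f(t)\<close> and \<open>exp (- t) g(t)\<close> densities of
  nonzero finite measures.\<close>

lemma laplace_unique:
  assumes f: "continuous_on {0..} f" "\<And>t. t \<ge> 0 \<Longrightarrow> 0 \<le> f t" "\<And>t. t \<ge> 0 \<Longrightarrow> f t \<le> B"
    and g: "continuous_on {0..} g" "\<And>t. t \<ge> 0 \<Longrightarrow> 0 \<le> g t" "\<And>t. t \<ge> 0 \<Longrightarrow> g t \<le> B"
    and eq: "\<And>s. s > 0 \<Longrightarrow> laplace f s = laplace g s" and "t \<ge> 0"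
  shows "f t = g t"
proof -
  \<comment> \<open>The total mass of \<open>exp (- t) * (f t + 1)\<close> on \<open>{0..}\<close>;
    by \<open>eq\<close> at \<open>s = 1\<close> it is also that for \<open>g\<close>.\<close>
  define c where "c = laplace f 1 + 1"
  define d where "d h t = indicator {0..} t *\<^sub>R (exp (- t) * (h t + 1) / c)" for h :: "real \<Rightarrow> real" and t
  have fb: "\<bar>f t\<bar> \<le> B" "\<bar>g t\<bar> \<le> B" if "t \<ge> 0" for t
    using f(2,3)[OF that] g(2,3)[OF that] by auto
  have "laplace f 1 \<ge> 0"
    unfolding laplace_def set_lebesgue_integral_def using f(2)
    by (intro integral_nonneg_AE) (auto intro!: AE_I2 simp: indicator_def)
  then have c: "c > 0" by (simp add: c_def)
  have lap1: "laplace (\<lambda>t. h t + 1) s = laplace h s + 1 / s" if "h = f \<or> h = g" "s > 0" for h s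
    using that f g fb laplace_const[of s 1]
    by (subst laplace_add[where B=B and C=1]) auto
  have meas [measurable]: "d h \<in> borel_measurable borel" if "h = f \<or> h = g" for h
    unfolding d_def[abs_def] using that f g c
    by (intro borel_measurable_continuous_on_indicator) (auto intro!: continuous_intros)
  have nn: "d h t \<ge> 0" if "h = f \<or> h = g" for h t
    unfolding d_def using that c f(2)[of t] g(2)[of t] by (auto simp: indicator_def)
  have int: "has_bochner_integral lborel (\<lambda>t. d h t * exp (- (s * t))) (laplace (\<lambda>t. h t + 1) (s + 1) / c)"
    if h: "h = f \<or> h = g" and "s \<ge> 0" for h s
  proof -
    have "set_integrable lborel {0..} (\<lambda>t. exp (- ((s + 1) * t)) * (h t + 1))"
      by (rule laplace_integrable[where B="B+1"])
         (use that f(1) g(1) fb in \<open>auto intro!: continuous_intros abs_triangle_ineq[THEN order_trans]\<close>)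
    then have "has_bochner_integral lborel (\<lambda>t. indicator {0..} t *\<^sub>R (exp (- ((s + 1) * t)) * (h t + 1)))
        (laplace (\<lambda>t. h t + 1) (s + 1))"
      unfolding set_integrable_def laplace_def set_lebesgue_integral_def by (rule has_bochner_integral_integrable)
    from has_bochner_integral_divide_zero[OF this, of c] show ?thesis
      by (rule has_bochner_integral_cong[THEN iffD1, rotated -1])
         (auto simp: d_def ring_distribs exp_add[symmetric] exp_diff exp_minus field_simps indicator_def)
  qed
  have prob: "prob_space (density lborel (d h))" if h: "h = f \<or> h = g" for h
  proof
    have "has_bochner_integral lborel (d h) 1"
      using int[OF h, of 0] lap1[OF h, of 1] h c eq[of 1] by (auto simp: c_def)
    then have "(\<integral>\<^sup>+t. ennreal (d h t) \<partial>lborel) = 1"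
      using nn[OF h] by (subst nn_integral_eq_integral) (auto simp: has_bochner_integral_iff)
    then show "emeasure (density lborel (d h)) (space (density lborel (d h))) = 1"
      using meas[OF h] by (simp add: emeasure_density cong: nn_integral_cong)
  qed
  have ae_pos: "AE x in density lborel (d h). 0 \<le> x" if h: "h = f \<or> h = g" for h
  proof -
    have "AE x in lborel. 0 < ennreal (d h x) \<longrightarrow> 0 \<le> x"
      by (intro AE_I2) (auto simp: d_def indicator_def)
    then show ?thesis using meas[OF h] by (subst AE_density) auto
  qed
  have "density lborel (d f) = density lborel (d g)"
  proof (rule laplace_transform_unique)
    show "prob_space (density lborel (d f))" "prob_space (density lborel (d g))"
      by (simp_all add: prob)
    show "AE x in density lborel (d f). 0 \<le> x" "AE x in density lborel (d g). 0 \<le> x"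
      by (auto intro: ae_pos)
    fix n :: nat
    have "(LINT x|density lborel (d h). exp (- (real n * x))) = laplace (\<lambda>t. h t + 1) (real n + 1) / c"
      if h: "h = f \<or> h = g" for h
      using int[OF h, of "real n"] meas[OF h] nn[OF h]
      by (subst integral_density) (auto simp: has_bochner_integral_iff)
    then show "(LINT x|density lborel (d f). exp (- (real n * x))) = (LINT x|density lborel (d g). exp (- (real n * x)))"
      using eq[of "real n + 1"] by (simp add: lap1)
  qed auto
  then have "AE x in lborel. ennreal (d f x) = ennreal (d g x)"
    using meas[of f] meas[of g] by (subst (asm) sigma_finite_measure.density_unique_iff[OF sigma_finite_lborel]) auto
  then have ae: "AE x in lborel. x \<ge> 0 \<longrightarrow> f x = g x"
    by eventually_elim (use nn c in \<open>auto simp: d_def\<close>)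
  show "f t = g t"
  proof (rule ccontr)
    assume ne: "f t \<noteq> g t"
    have "continuous_on {0..} (\<lambda>x. f x - g x)" by (intro continuous_intros f g)
    then have "((\<lambda>x. f x - g x) \<longlongrightarrow> f t - g t) (at t within {0..})"
      using \<open>t \<ge> 0\<close> by (auto simp: continuous_on_def)
    then have "\<forall>\<^sub>F x in at t within {0..}. f x - g x \<noteq> 0"
      by (rule tendsto_imp_eventually_ne) (use ne in simp)
    then obtain e where e: "e > 0" "\<And>x. x \<ge> 0 \<Longrightarrow> x \<noteq> t \<Longrightarrow> dist x t < e \<Longrightarrow> f x \<noteq> g x"
      unfolding eventually_at by auto
    \<comment> \<open>The interval to the right of \<open>t\<close> stays inside
      \<open>{0..}\<close> even for \<open>t = 0\<close>.\<close>
    have "AE x in lborel. x \<notin> {t<..<t + e}"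
      using ae by eventually_elim (use e \<open>t \<ge> 0\<close> in \<open>auto simp: dist_real_def\<close>)
    then have "emeasure lborel {x. \<not> x \<notin> {t<..<t + e}} = 0"
      by (subst (asm) AE_iff_measurable[OF _ refl]) auto
    moreover have "{x. \<not> x \<notin> {t<..<t + e}} = {t<..<t + e}" by auto
    ultimately have "emeasure lborel {t<..<t + e} = 0" by (simp only:)
    then show False using e(1) by (simp add: emeasure_lborel_Ioo)
  qed
qed

section \<open>Kolmogorov equations and the homogeneous resolvent equation\<close>

lemma mprod_Q_left:
  "mprod (Q_matrix l m) A i j =
    (if i = 0 then 0 else m i * A (i - 1) j) - (l i + m i) * A i j + l i * A (Suc i) j"
proof -
  \<comment> \<open>For \<open>i = 0\<close> the truncated \<open>i - 1\<close> merely repeats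
    \<open>0\<close> in the index set.\<close>
  have "mprod (Q_matrix l m) A i j = (\<Sum>k\<in>{i - 1, i, Suc i}. Q_matrix l m i k * A k j)"
    unfolding mprod_def by (rule suminf_finite) (auto simp: Q_matrix_def)
  then show ?thesis
    by (cases i) (auto simp: Q_matrix_def algebra_simps)
qed

lemma mprod_Q_right:
  "mprod A (Q_matrix l m) i j =
    (if j = 0 then 0 else A i (j - 1) * l (j - 1)) - (l j + m j) * A i j + A i (Suc j) * m (Suc j)"
proof -
  have "mprod A (Q_matrix l m) i j = (\<Sum>k\<in>{j - 1, j, Suc j}. A i k * Q_matrix l m k j)"
    unfolding mprod_def by (rule suminf_finite) (auto simp: Q_matrix_def)
  then show ?thesis
    by (cases j) (auto simp: Q_matrix_def algebra_simps)
qed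

text \<open>Since \<open>l i > 0\<close>, the equation determines \<open>r (Suc i)\<close> from
  earlier values, so the solution space is one-dimensional.\<close>

lemma bd_recurrence_solution:
  assumes r: "rate_set l m"
    and rec: "\<And>i. s * r i = (if i = 0 then 0 else m i * r (i - 1)) - (l i + m i) * r i + l i * r (Suc i)"
  shows "r i = r 0 * bd_q l m i (- s)"
proof -
  have "r i = r 0 * bd_q l m i (- s) \<and> r (Suc i) = r 0 * bd_q l m (Suc i) (- s)"
  proof (induction i)
    case 0
    have "l 0 * r (Suc 0) = r 0 * (l 0 * bd_q l m (Suc 0) (- s))"
      using rec[of 0] unfolding bd_q_1[OF r] by (simp add: algebra_simps)
    then show ?case using rate_setD(1)[OF r, of 0] by simp
  next
    case (Suc i)
    have "l (Suc i) * r (Suc (Suc i)) = (l (Suc i) + m (Suc i) + s) * r (Suc i) - m (Suc i) * r i"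
      using rec[of "Suc i"] by (simp add: algebra_simps)
    also have "\<dots> = r 0 * ((l (Suc i) + m (Suc i) - - s) * bd_q l m (Suc i) (- s) - m (Suc i) * bd_q l m i (- s))"
      using Suc by (simp add: algebra_simps)
    also have "\<dots> = l (Suc i) * (r 0 * bd_q l m (Suc (Suc i)) (- s))"
      unfolding bd_q_rec[OF r, symmetric] by simp
    finally show ?case using rate_setD(1)[OF r, of "Suc i"] Suc by simp
  qed
  then show ?thesis by simp
qed

text \<open>With zero initial value, the transform of a solution of the backward system solves the
  homogeneous resolvent equation. The bounds \<open>B i\<close> may depend on \<open>i\<close>, as
  needed for the forward system after division by the weights.\<close>

lemma bd_system_laplace:
  assumes r: "rate_set l m" and s: "s > 0"
    and der: "\<And>i t. t \<ge> 0 \<Longrightarrow> ((\<lambda>t. u t i) has_real_derivative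
       (if i = 0 then 0 else m i * u t (i - 1)) - (l i + m i) * u t i + l i * u t (Suc i)) (at t within {0..})"
    and bd: "\<And>i t. t \<ge> 0 \<Longrightarrow> \<bar>u t i\<bar> \<le> B i" and u0: "\<And>i. u 0 i = 0"
  shows "laplace (\<lambda>t. u t i) s = laplace (\<lambda>t. u t 0) s * bd_q l m i (- s)"
proof (rule bd_recurrence_solution[OF r])
  fix i
  have cont: "continuous_on {0..} (\<lambda>t. u t i)" for i
    using der by (auto intro: DERIV_continuous simp: continuous_on_eq_continuous_within)
  let ?v = "\<lambda>t. (if i = 0 then 0 else m i) * u t (i - 1) + (- (l i + m i) * u t i + l i * u t (Suc i))"
  have B: "\<bar>c * u t i\<bar> \<le> \<bar>c\<bar> * B i" if "t \<ge> 0" for c t i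
    using bd[OF that] by (simp add: abs_mult mult_left_mono)
  have c: "continuous_on {0..} (\<lambda>t. c * u t i)" for c i by (intro continuous_intros cont)
  have B2: "\<bar>- (l i + m i) * u t i + l i * u t (Suc i)\<bar> \<le> \<bar>- (l i + m i)\<bar> * B i + \<bar>l i\<bar> * B (Suc i)"
    if "t \<ge> 0" for t
    using B[OF that, of "- (l i + m i)" i] B[OF that, of "l i" "Suc i"] by linarith
  have c2: "continuous_on {0..} (\<lambda>t. - (l i + m i) * u t i + l i * u t (Suc i))"
    by (intro continuous_intros cont)
  have "s * laplace (\<lambda>t. u t i) s = u 0 i + laplace ?v s"
  proof (rule laplace_derivative[OF s])
    show "((\<lambda>t. u t i) has_real_derivative ?v t) (at t within {0..})" if "t \<ge> 0" for t
      by (rule DERIV_cong[OF der[OF that]]) (auto simp: algebra_simps)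
    show "continuous_on {0..} ?v" by (intro continuous_intros cont)
    show "\<bar>?v t\<bar> \<le> \<bar>if i = 0 then 0 else m i\<bar> * B (i - 1) + (\<bar>- (l i + m i)\<bar> * B i + \<bar>l i\<bar> * B (Suc i))"
      if "t \<ge> 0" for t
      using B[OF that, of "if i = 0 then 0 else m i" "i - 1"] B2[OF that] by linarith
  qed (rule bd)
  also have "laplace ?v s = laplace (\<lambda>t. (if i = 0 then 0 else m i) * u t (i - 1)) s +
      laplace (\<lambda>t. - (l i + m i) * u t i + l i * u t (Suc i)) s"
    by (rule laplace_add[OF s c B c2 B2])
  also have "laplace (\<lambda>t. - (l i + m i) * u t i + l i * u t (Suc i)) s =
      laplace (\<lambda>t. - (l i + m i) * u t i) s + laplace (\<lambda>t. l i * u t (Suc i)) s"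
    by (rule laplace_add[OF s c B c B])
  also note laplace_cmult[of "if i = 0 then 0 else m i" "\<lambda>t. u t (i - 1)" s]
  also note laplace_cmult[of "- (l i + m i)" "\<lambda>t. u t i" s]
  also note laplace_cmult[of "l i" "\<lambda>t. u t (Suc i)" s]
  finally show "s * laplace (\<lambda>t. u t i) s = (if i = 0 then 0 else m i * laplace (\<lambda>t. u t (i - 1)) s) -
      (l i + m i) * laplace (\<lambda>t. u t i) s + l i * laplace (\<lambda>t. u t (Suc i)) s"
    by (cases "i = 0") (simp_all add: u0 algebra_simps)
qed

text \<open>The term \<open>k = 0\<close> alone makes the sum in \<open>bd_q_diff\<close> at least
  \<open>1\<close>, so each increment is at least \<open>s / (l n * pi_coeff l m n)\<close>.\<close>

lemma bd_q_unbounded: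
  assumes r: "rate_set l m" and s: "s > 0" and "\<not> summable (\<lambda>n. 1 / (l n * pi_coeff l m n))"
  obtains n where "bd_q l m n (- s) > C"
proof -
  let ?a = "\<lambda>n. 1 / (l n * pi_coeff l m n)"
  have lp: "l n * pi_coeff l m n > 0" for n using rate_setD(1)[OF r] pi_coeff_pos[OF r] by simp
  have step: "bd_q l m (Suc n) (- s) - bd_q l m n (- s) \<ge> s * ?a n" for n
  proof -
    have "(\<Sum>k\<in>{0}. pi_coeff l m k * bd_q l m k (- s)) \<le> (\<Sum>k\<le>n. pi_coeff l m k * bd_q l m k (- s))"
      using bd_q_ge_1[OF r, of "- s"] s pi_coeff_pos[OF r]
      by (intro sum_mono2) (auto intro!: mult_nonneg_nonneg intro: less_imp_le order_trans[of 0 1])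
    then have "s \<le> s * (\<Sum>k\<le>n. pi_coeff l m k * bd_q l m k (- s))" using s by simp
    then have "s \<le> l n * pi_coeff l m n * (bd_q l m (Suc n) (- s) - bd_q l m n (- s))"
      unfolding bd_q_diff[OF r] using rate_setD(3)[OF r, of 0] by simp
    then have "s / (l n * pi_coeff l m n) \<le> bd_q l m (Suc n) (- s) - bd_q l m n (- s)"
      using lp[of n] by (simp only: pos_divide_le_eq mult.commute)
    then show ?thesis by simp
  qed
  have le: "s * (\<Sum>k<n. ?a k) \<le> bd_q l m n (- s)" for n
  proof (induction n)
    case (Suc n)
    then show ?case using step[of n] unfolding sum.lessThan_Suc distrib_left by linarith
  qed simp
  have "\<exists>n. (\<Sum>k<n. ?a k) > C / s"
  proof (rule ccontr)
    assume "\<nexists>n. (\<Sum>k<n. ?a k) > C / s"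
    then have "summable ?a"
      using lp by (intro summableI_nonneg_bounded[of ?a "C / s"]) (auto simp: not_less less_imp_le simp del: divide_const_simps)
    then show False using assms(3) by simp
  qed
  then obtain n where "(\<Sum>k<n. ?a k) > C / s" by blast
  then have "C < s * (\<Sum>k<n. ?a k)" using s by (simp add: field_simps)
  then have "C < bd_q l m n (- s)" using le[of n] by linarith
  then show ?thesis by (rule that)
qed

lemma bd_process_derivative:
  assumes "bd_process l m P" "t \<ge> 0"
  shows "((\<lambda>u. P u i j) has_real_derivative mprod (Q_matrix l m) (P t) i j) (at t within {0..})"
    and "((\<lambda>u. P u i j) has_real_derivative mprod (P t) (Q_matrix l m) i j) (at t within {0..})"
  using assms unfolding bd_process_def by blast+

lemma bd_process_continuous: "bd_process l m P \<Longrightarrow> continuous_on {0..} (\<lambda>t. P t i j)"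
  unfolding continuous_on_eq_continuous_within
  using DERIV_continuous[OF bd_process_derivative(1)] by (metis atLeast_iff)

text \<open>The transform of the difference of two processes is a multiple of
  \<open>bd_q l m i (- s)\<close> in the first index, and of
  \<open>pi_coeff l m j * bd_q l m j (- s)\<close> in the second. If
  \<open>1 / (l n * pi_coeff l m n)\<close> is not summable, the first contradicts boundedness; if
  \<open>pi_coeff l m\<close> is not summable, the second contradicts the bound on row sums.\<close>

lemma bd_process_unique:
  assumes P: "bd_process l m P" and P': "bd_process l m P'"
    and div: "\<not> summable (\<lambda>n. pi_coeff l m n + 1 / (l n * pi_coeff l m n))" and "t \<ge> 0"
  shows "P t = P' t"
proof -
  have r: "rate_set l m" using P by (simp add: bd_process_def)
  have nn: "K t i j \<ge> 0" and smb: "summable (K t i)" and le1: "(\<Sum>j. K t i j) \<le> 1"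
    if "K = P \<or> K = P'" "t \<ge> 0" for K t i j
    using that P P' by (auto simp: bd_process_def)
  have part: "(\<Sum>j\<in>A. K t i j) \<le> 1" if "K = P \<or> K = P'" "t \<ge> 0" "finite A" for K t i A
  proof -
    have "(\<Sum>j\<in>A. K t i j) \<le> (\<Sum>j. K t i j)"
      by (rule sum_le_suminf[OF smb[OF that(1,2)] that(3)]) (rule nn[OF that(1,2)])
    then show ?thesis using le1[OF that(1,2), of i] by linarith
  qed
  have b1: "K t i j \<le> 1" if "K = P \<or> K = P'" "t \<ge> 0" for K t i j
    using part[OF that, of "{j}"] by simp
  have cont: "continuous_on {0..} (\<lambda>t. K t i j)" if "K = P \<or> K = P'" for K i j
    using that bd_process_continuous[OF P] bd_process_continuous[OF P'] by blast
  define w where "w t i j = P t i j - P' t i j" for t i j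
  have w0: "w 0 i j = 0" for i j using P P' by (simp add: w_def bd_process_def)
  have wb: "\<bar>w t i j\<bar> \<le> 1" if "t \<ge> 0" for t i j
    using nn[of P t i j] nn[of P' t i j] b1[of P t i j] b1[of P' t i j] that by (simp add: w_def)
  have PB: "\<bar>P' t i j\<bar> \<le> 1" if "t \<ge> 0" for t i j
    using nn[of P' t i j] b1[of P' t i j] that by simp
  have wc: "continuous_on {0..} (\<lambda>t. w t i j)" for i j
    unfolding w_def by (intro continuous_intros cont) auto
  have bwd: "((\<lambda>t. w t i j) has_real_derivative
      (if i = 0 then 0 else m i * w t (i - 1) j) - (l i + m i) * w t i j + l i * w t (Suc i) j) (at t within {0..})"
    if "t \<ge> 0" for t i j
  proof -
    have "((\<lambda>t. w t i j) has_real_derivative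
        mprod (Q_matrix l m) (P t) i j - mprod (Q_matrix l m) (P' t) i j) (at t within {0..})"
      unfolding w_def
      by (rule DERIV_diff[OF bd_process_derivative(1)[OF P that] bd_process_derivative(1)[OF P' that]])
    then show ?thesis
      by (rule DERIV_cong) (simp add: mprod_Q_left w_def algebra_simps)
  qed
  \<comment> \<open>Detailed balance: divided by \<open>pi_coeff l m j\<close>, the forward
    equations take the shape of the backward ones.\<close>
  have forw: "((\<lambda>t. w t i j / pi_coeff l m j) has_real_derivative
      (if j = 0 then 0 else m j * (w t i (j - 1) / pi_coeff l m (j - 1))) - (l j + m j) * (w t i j / pi_coeff l m j)
        + l j * (w t i (Suc j) / pi_coeff l m (Suc j))) (at t within {0..})"
    if "t \<ge> 0" for t i j
  proof -
    have pp: "pi_coeff l m j > 0" for j by (rule pi_coeff_pos[OF r])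
    have up: "m (Suc j) / pi_coeff l m j = l j / pi_coeff l m (Suc j)" for j
      using pp[of j] pp[of "Suc j"] pi_coeff_Suc[OF r, of j] by (simp add: field_simps)
    have dn: "l (j - 1) / pi_coeff l m j = m j / pi_coeff l m (j - 1)" if "j > 0"
      using up[of "j - 1"] that by simp
    have "((\<lambda>t. w t i j) has_real_derivative
        mprod (P t) (Q_matrix l m) i j - mprod (P' t) (Q_matrix l m) i j) (at t within {0..})"
      unfolding w_def
      by (rule DERIV_diff[OF bd_process_derivative(2)[OF P that] bd_process_derivative(2)[OF P' that]])
    from DERIV_cdivide[OF this, of "pi_coeff l m j"] show ?thesis
    proof (rule DERIV_cong)
      have "(mprod (P t) (Q_matrix l m) i j - mprod (P' t) (Q_matrix l m) i j) / pi_coeff l m j =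
          (if j = 0 then 0 else w t i (j - 1) * (l (j - 1) / pi_coeff l m j)) - (l j + m j) * (w t i j / pi_coeff l m j)
          + w t i (Suc j) * (m (Suc j) / pi_coeff l m j)"
        by (simp add: mprod_Q_right w_def diff_divide_distrib add_divide_distrib algebra_simps)
      also have "\<dots> = (if j = 0 then 0 else m j * (w t i (j - 1) / pi_coeff l m (j - 1))) -
          (l j + m j) * (w t i j / pi_coeff l m j) + l j * (w t i (Suc j) / pi_coeff l m (Suc j))"
        unfolding up using dn by (auto simp: mult.commute)
      finally show "(mprod (P t) (Q_matrix l m) i j - mprod (P' t) (Q_matrix l m) i j) / pi_coeff l m j = \<dots>" .
    qed
  qed
  have lap0: "laplace (\<lambda>t. w t i j) s = 0" if s: "s > 0" for i j s
  proof -
    have q1: "bd_q l m n (- s) \<ge> 1" for n using bd_q_ge_1[OF r] s by simp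
    consider "\<not> summable (\<lambda>n. 1 / (l n * pi_coeff l m n))" | "\<not> summable (pi_coeff l m)"
      using div summable_add[of "pi_coeff l m" "\<lambda>n. 1 / (l n * pi_coeff l m n)"] by blast
    then show ?thesis
    proof cases
      case 1
      have R: "laplace (\<lambda>t. w t i j) s = laplace (\<lambda>t. w t 0 j) s * bd_q l m i (- s)" for i
        by (rule bd_system_laplace[OF r s, where u="\<lambda>t i. w t i j" and B="\<lambda>_. 1", OF bwd wb w0])
      have "laplace (\<lambda>t. w t 0 j) s = 0"
      proof (rule ccontr)
        define c where "c = \<bar>laplace (\<lambda>t. w t 0 j) s\<bar>"
        assume "laplace (\<lambda>t. w t 0 j) s \<noteq> 0"
        then have "c > 0" by (simp add: c_def)
        obtain n where n: "bd_q l m n (- s) > (1 / s) / c" using bd_q_unbounded[OF r s 1] by blast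
        have "c * bd_q l m n (- s) \<le> 1 / s"
          using laplace_bound[OF s wc wb, of n j] R[of n] q1[of n] by (simp add: c_def abs_mult)
        then show False
          using n[unfolded pos_divide_less_eq[OF \<open>c > 0\<close>]] by (simp only: mult.commute not_less[symmetric])
      qed
      then show ?thesis using R[of i] by simp
    next
      case 2
      have pp: "pi_coeff l m j > 0" for j by (rule pi_coeff_pos[OF r])
      have "laplace (\<lambda>t. w t i j / pi_coeff l m j) s = laplace (\<lambda>t. w t i 0 / pi_coeff l m 0) s * bd_q l m j (- s)" for j
        by (rule bd_system_laplace[OF r s, where u="\<lambda>t j. w t i j / pi_coeff l m j" and B="\<lambda>j. 1 / pi_coeff l m j"])
           (use forw w0 wb pp in \<open>simp_all add: divide_right_mono less_imp_le\<close>)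
      then have R: "laplace (\<lambda>t. w t i j) s = laplace (\<lambda>t. w t i 0) s * (pi_coeff l m j * bd_q l m j (- s))" for j
        using laplace_cmult[of "1 / pi_coeff l m j" "\<lambda>t. w t i j" s] pp[of j] by (simp add: field_simps)
      \<comment> \<open>All transforms in row \<open>i\<close> have the sign of the one at
        \<open>j = 0\<close>, so the factor \<open>sgn\<close> turns the sum into one of absolute
        values. The row sums of \<open>P\<close> and \<open>P'\<close> contribute
        \<open>1 / s\<close> each.\<close>
      have fin: "\<bar>\<Sum>j<n. sgn (laplace (\<lambda>t. w t i 0) s) * laplace (\<lambda>t. w t i j) s\<bar> \<le> 2 / s" for n
      proof -
        have K: "\<bar>\<Sum>j<n. laplace (\<lambda>t. K t i j) s\<bar> \<le> 1 / s" if "K = P \<or> K = P'" for K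
        proof -
          have KB: "\<bar>K t i j\<bar> \<le> 1" if t: "t \<ge> 0" for t j
            using nn[OF \<open>K = P \<or> K = P'\<close> t, of i j] b1[OF \<open>K = P \<or> K = P'\<close> t, of i j] by simp
          have "(\<Sum>j<n. laplace (\<lambda>t. K t i j) s) = laplace (\<lambda>t. \<Sum>j<n. K t i j) s"
            by (rule laplace_sum[symmetric, OF s finite_lessThan cont[OF that] KB])
          moreover have "\<bar>laplace (\<lambda>t. \<Sum>j<n. K t i j) s\<bar> \<le> 1 / s"
          proof (rule laplace_bound[OF s])
            show "continuous_on {0..} (\<lambda>t. \<Sum>j<n. K t i j)" by (intro continuous_on_sum cont[OF that])
            show "\<bar>\<Sum>j<n. K t i j\<bar> \<le> 1" if t: "t \<ge> 0" for t
            proof -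
              have "(\<Sum>j<n. K t i j) \<ge> 0" by (rule sum_nonneg) (rule nn[OF \<open>K = P \<or> K = P'\<close> t])
              then show ?thesis using part[OF \<open>K = P \<or> K = P'\<close> t, of "{..<n}" i] by simp
            qed
          qed
          ultimately show ?thesis by simp
        qed
        have Pj: "laplace (\<lambda>t. w t i j) s = laplace (\<lambda>t. P t i j) s - laplace (\<lambda>t. P' t i j) s" for j
        proof -
          have "laplace (\<lambda>t. P t i j) s = laplace (\<lambda>t. P' t i j + w t i j) s" by (simp add: w_def)
          also have "\<dots> = laplace (\<lambda>t. P' t i j) s + laplace (\<lambda>t. w t i j) s"
            by (rule laplace_add[OF s cont[of P'] PB wc wb]) simp_all
          finally show ?thesis by simp
        qed
        have "\<bar>\<Sum>j<n. laplace (\<lambda>t. w t i j) s\<bar> \<le> 2 / s"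
          unfolding Pj sum_subtractf using K[of P] K[of P'] by (simp add: abs_le_iff)
        then show ?thesis using s
          unfolding sum_distrib_left[symmetric] abs_mult by (simp add: sgn_if)
      qed
      have "laplace (\<lambda>t. w t i 0) s = 0"
      proof (rule ccontr)
        define c where "c = \<bar>laplace (\<lambda>t. w t i 0) s\<bar>"
        assume "laplace (\<lambda>t. w t i 0) s \<noteq> 0"
        then have "c > 0" by (simp add: c_def)
        have "(\<Sum>j<n. pi_coeff l m j) \<le> 2 / s / c" for n
        proof -
          have "c * (\<Sum>j<n. pi_coeff l m j) \<le> (\<Sum>j<n. c * (pi_coeff l m j * bd_q l m j (- s)))"
            unfolding sum_distrib_left using q1 pp \<open>c > 0\<close> by (intro sum_mono mult_left_mono) (auto simp: less_imp_le)
          also have "\<dots> = (\<Sum>j<n. sgn (laplace (\<lambda>t. w t i 0) s) * laplace (\<lambda>t. w t i j) s)"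
            by (intro sum.cong refl, subst R) (simp add: c_def sgn_mult_self_eq abs_sgn mult_ac)
          also have "\<dots> \<le> 2 / s" using fin[of n] by linarith
          finally show ?thesis
            unfolding pos_le_divide_eq[OF \<open>c > 0\<close>] by (simp only: mult.commute)
        qed
        then have "summable (pi_coeff l m)"
          by (intro summableI_nonneg_bounded) (auto simp: pp less_imp_le)
        then show False using 2 by simp
      qed
      then show ?thesis using R[of j] by simp
    qed
  qed
  show ?thesis
  proof (intro ext)
    fix i j
    show "P t i j = P' t i j"
    proof (rule laplace_unique[where B=1 and t=t and f="\<lambda>t. P t i j" and g="\<lambda>t. P' t i j"])
      fix s :: real assume s: "s > 0"
      have "laplace (\<lambda>t. P t i j) s = laplace (\<lambda>t. P' t i j + w t i j) s" by (simp add: w_def)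
      also have "\<dots> = laplace (\<lambda>t. P' t i j) s + laplace (\<lambda>t. w t i j) s"
        by (rule laplace_add[OF s cont[of P'] PB wc wb]) simp_all
      finally show "laplace (\<lambda>t. P t i j) s = laplace (\<lambda>t. P' t i j) s" using lap0[OF s] by simp
    next
      show "continuous_on {0..} (\<lambda>t. P t i j)" "continuous_on {0..} (\<lambda>t. P' t i j)"
        using cont[of P i j] cont[of P' i j] by simp_all
    next
      fix t :: real assume t: "t \<ge> 0"
      show "0 \<le> P t i j" "P t i j \<le> 1" "0 \<le> P' t i j" "P' t i j \<le> 1"
        using nn[of P t i j] b1[of P t i j] nn[of P' t i j] b1[of P' t i j] t by simp_all
    qed (rule \<open>t \<ge> 0\<close>)
  qed
qed

section \<open>The measure of the dual process\<close>

definition bd_qpoly :: "(nat \<Rightarrow> real) \<Rightarrow> (nat \<Rightarrow> real) \<Rightarrow> nat \<Rightarrow> real poly" where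
  "bd_qpoly l m n = smult ((-1) ^ n / (\<Prod>k<n. l k)) (bd_poly l m n)"

lemma poly_bd_qpoly [simp]: "poly (bd_qpoly l m n) = bd_q l m n"
  by (rule ext) (simp add: bd_qpoly_def bd_q_def)

lemma borel_measurable_bd_q [measurable]: "bd_q l m n \<in> borel_measurable borel"
  using borel_measurable_poly[of "bd_qpoly l m n"] by simp

text \<open>A nonzero limit would make \<open>a\<close> summable by comparison. This is how Bessel's
  inequality and a divergent series of weights force a limit to vanish.\<close>

lemma limit_zero_if_weighted_squares_bounded:
  fixes a f :: "nat \<Rightarrow> real"
  assumes a: "\<And>n. a n \<ge> 0" "\<not> summable a" and f: "f \<longlonglongrightarrow> c"
    and B: "\<And>n. (\<Sum>k<n. a k * (f k)\<^sup>2) \<le> B"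
  shows "c = 0"
proof (rule ccontr)
  assume "c \<noteq> 0"
  have "summable (\<lambda>k. a k * (f k)\<^sup>2)"
    by (rule summableI_nonneg_bounded[OF _ B]) (simp add: a)
  then have s: "summable (\<lambda>k. 4 / c\<^sup>2 * (a k * (f k)\<^sup>2))" by (rule summable_mult)
  have "(\<lambda>k. (f k)\<^sup>2) \<longlonglongrightarrow> c\<^sup>2" by (intro tendsto_intros f)
  then have "\<forall>\<^sub>F k in sequentially. (f k)\<^sup>2 > c\<^sup>2 / 4"
    by (rule order_tendstoD) (use \<open>c \<noteq> 0\<close> in simp)
  then have "\<forall>\<^sub>F k in sequentially. norm (a k) \<le> 4 / c\<^sup>2 * (a k * (f k)\<^sup>2)"
  proof eventually_elim
    case (elim k)
    have "a k * (c\<^sup>2 / 4) \<le> a k * (f k)\<^sup>2" using elim a(1)[of k] by (intro mult_left_mono) auto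
    then show ?case using a(1)[of k] \<open>c \<noteq> 0\<close> by (simp add: field_simps)
  qed
  then have "summable a" using s by (rule summable_comparison_test_ev)
  then show False using a(2) by simp
qed

context half_line_measure
begin

lemma integrable_ident: "integrable M (\<lambda>x. x)"
proof -
  have "integrable M (\<lambda>x. x ^ 1)" using moment_measure unfolding moment_measure_def by blast
  then show ?thesis by simp
qed

lemma integrable_exp_poly: "t \<ge> 0 \<Longrightarrow> integrable M (\<lambda>x. exp (- x * t) * poly p x)"
  using integrable_poly_mult[of "\<lambda>x. exp (- x * t)" 1 p] by (simp add: mult.commute)

lemma corresponding_measure_iff:
  assumes "rate_set l m"
  shows "corresponding_measure l m P M \<longleftrightarrow> (\<forall>i j. \<forall>t\<ge>0.
    P t i j = pi_coeff l m j * (LINT x|M. exp (- x * t) * (bd_q l m i x * bd_q l m j x)))"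
proof -
  have "(-1) ^ (i + j) / ((\<Prod>k<i. l k) * (\<Prod>k=1..j. m k)) *
        (LINT x:{0..}|M. exp (- x * t) * poly (bd_poly l m i) x * poly (bd_poly l m j) x) =
      pi_coeff l m j * (LINT x|M. exp (- x * t) * (bd_q l m i x * bd_q l m j x))" for i j t
  proof -
    have "(LINT x:{0..}|M. exp (- x * t) * poly (bd_poly l m i) x * poly (bd_poly l m j) x) =
        (LINT x|M. exp (- x * t) * poly (bd_poly l m i) x * poly (bd_poly l m j) x)"
      unfolding set_lebesgue_integral_def
    proof (rule integral_cong_AE)
      show "AE x in M. indicator {0..} x *\<^sub>R (exp (- x * t) * poly (bd_poly l m i) x * poly (bd_poly l m j) x) =
          exp (- x * t) * poly (bd_poly l m i) x * poly (bd_poly l m j) x"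
        using AE_nonneg by eventually_elim simp
    qed auto
    moreover have "(-1) ^ (i + j) / ((\<Prod>k<i. l k) * (\<Prod>k=1..j. m k)) *
        (exp (- x * t) * poly (bd_poly l m i) x * poly (bd_poly l m j) x) =
        pi_coeff l m j * (exp (- x * t) * (bd_q l m i x * bd_q l m j x))" for x
      using corresponding_constant[OF assms, of i j x] by (metis mult.assoc mult.left_commute)
    ultimately show ?thesis
      by (simp only: integral_mult_right_zero[symmetric])
  qed
  then show ?thesis
    unfolding corresponding_measure_def using moment_measure supp_nonneg by simp
qed

lemma monic_orth_if_orthogonal:
  assumes "\<And>n. degree (P n) = n" "\<And>n. lead_coeff (P n) = 1"
    and orth: "\<And>i j. i \<noteq> j \<Longrightarrow> ip (\<lambda>_. 1) (P i) (P j) = 0"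
  shows "monic_orth (\<lambda>_. 1) n (P n)"
proof (induction n rule: less_induct)
  case (less n)
  note w = weight_one
  have "ip (\<lambda>_. 1) q (P n) = 0" if dq: "degree q < n" for q
  proof -
    obtain k where k: "n = Suc k" using dq by (cases n) auto
    have "q = (\<Sum>i\<le>k. smult (ip (\<lambda>_. 1) q (P i) / ip (\<lambda>_. 1) (P i) (P i)) (P i))"
      using less dq k by (intro monic_orth_expand[OF w]) auto
    then have "ip (\<lambda>_. 1) q (P n) = ip (\<lambda>_. 1) (\<Sum>i\<le>k. smult (ip (\<lambda>_. 1) q (P i) / ip (\<lambda>_. 1) (P i) (P i)) (P i)) (P n)"
      by (rule arg_cong)
    also have "\<dots> = 0"
      unfolding ip_sum_left[OF w finite_atMost] ip_smult_left
      by (intro sum.neutral ballI) (use orth k in auto)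
    finally show ?thesis .
  qed
  then show ?case using assms(1,2) by (auto simp: monic_orth_def)
qed

text \<open>Expansion of the nonnegative integral of \<open>(g - S)\<^sup>2\<close>, with
  \<open>S\<close> the partial Fourier sum. The one-sided factor \<open>c j\<close> is the
  reciprocal squared norm of \<open>Q j\<close>; in this form orthogonality is just the initial
  condition of the transition functions.\<close>

lemma bessel:
  fixes Q :: "nat \<Rightarrow> real poly"
  assumes g [measurable]: "g \<in> borel_measurable borel" and g2: "integrable M (\<lambda>x. (g x)\<^sup>2)"
    and gp: "\<And>p. integrable M (\<lambda>x. g x * poly p x)"
    and orth: "\<And>i j. c j * (LINT x|M. poly (Q i) x * poly (Q j) x) = (if i = j then 1 else 0)"
  shows "(\<Sum>k<n. c k * (LINT x|M. g x * poly (Q k) x)\<^sup>2) \<le> (LINT x|M. (g x)\<^sup>2)"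
proof -
  define a where "a k = c k * (LINT x|M. g x * poly (Q k) x)" for k
  define S where "S = (\<Sum>k<n. smult (a k) (Q k))"
  have pS: "poly S x = (\<Sum>k<n. a k * poly (Q k) x)" for x by (simp add: S_def poly_sum)
  have SS: "(LINT x|M. poly S x * poly S x) = (\<Sum>k<n. a k * (LINT x|M. g x * poly (Q k) x))"
  proof -
    have "(LINT x|M. poly S x * poly S x) = (LINT x|M. (\<Sum>i<n. \<Sum>j<n. a i * a j * (poly (Q i) x * poly (Q j) x)))"
      unfolding pS by (simp add: sum_product mult_ac)
    also have "\<dots> = (\<Sum>i<n. \<Sum>j<n. a i * a j * (LINT x|M. poly (Q i) x * poly (Q j) x))"
      by (simp flip: poly_mult)
    also have "\<dots> = (\<Sum>i<n. \<Sum>j<n. a i * ((LINT x|M. g x * poly (Q j) x) * (c j * (LINT x|M. poly (Q i) x * poly (Q j) x))))"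
      by (simp add: a_def mult_ac)
    also have "\<dots> = (\<Sum>k<n. a k * (LINT x|M. g x * poly (Q k) x))"
    proof (intro sum.cong refl)
      fix i assume "i \<in> {..<n}"
      then show "(\<Sum>j<n. a i * ((LINT x|M. g x * poly (Q j) x) * (c j * (LINT x|M. poly (Q i) x * poly (Q j) x)))) =
          a i * (LINT x|M. g x * poly (Q i) x)"
        unfolding orth by (subst sum.remove[of _ i]) auto
    qed
    finally show ?thesis .
  qed
  have gS: "(LINT x|M. g x * poly S x) = (\<Sum>k<n. a k * (LINT x|M. g x * poly (Q k) x))"
  proof -
    have "(LINT x|M. g x * poly S x) = (LINT x|M. (\<Sum>k<n. a k * (g x * poly (Q k) x)))"
      unfolding pS by (simp add: sum_distrib_left mult_ac)
    then show ?thesis using gp by simp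
  qed
  have "0 \<le> (LINT x|M. (g x - poly S x)\<^sup>2)" by simp
  also have "\<dots> = (LINT x|M. (g x)\<^sup>2 - 2 * (g x * poly S x) + poly (S * S) x)"
    by (simp add: power2_eq_square algebra_simps)
  also have "\<dots> = (LINT x|M. (g x)\<^sup>2) - 2 * (LINT x|M. g x * poly S x) + (LINT x|M. poly (S * S) x)"
    using g2 gp[of S] integrable_poly[of "S * S"] by (simp del: poly_mult)
  finally show ?thesis
    using SS gS by (simp add: a_def power2_eq_square mult_ac)
qed

end

section \<open>The measure \<open>psi\<close> and the representation of \<open>P\<close>\<close>

locale dual_setup = dual_rates +
  fixes Pt :: "real \<Rightarrow> nat \<Rightarrow> nat \<Rightarrow> real" and phit :: "real measure"
  assumes process: "bd_process lt mt Pt"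
    and corr: "corresponding_measure lt mt Pt phit"
    and divergent: "\<not> summable (\<lambda>n. pi_coeff lt mt n + 1 / (lt n * pi_coeff lt mt n))"
begin

sublocale T: half_line_measure phit
  using corr by unfold_locales (auto simp: corresponding_measure_def)

abbreviation "pd \<equiv> pi_coeff l m"
abbreviation "q \<equiv> bd_q l m"

lemma lt_pos: "lt n > 0" and pt_pos: "pt n > 0" and pd_pos: "pd n > 0"
  using rate_setD[OF rates] pi_coeff_pos[OF rates] pi_coeff_pos[OF rates'] by auto

lemma Pt_eq: "t \<ge> 0 \<Longrightarrow> Pt t i j = pt j * (LINT x|phit. exp (- x * t) * (qt i x * qt j x))"
  using corr unfolding T.corresponding_measure_iff[OF rates] by blast

lemma Pt_0: "Pt 0 i j = (if i = j then 1 else 0)"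
  using process by (simp add: bd_process_def)

text \<open>\<open>qt 1 x = 1 - x / lt 0\<close> is orthogonal to \<open>qt 0 = 1\<close>. The mean
  is the normalization that makes \<open>psi\<close> a probability measure.\<close>

lemma mean_phit: "(LINT x|phit. x) = lt 0"
proof -
  have q1: "qt (Suc 0) x = 1 - x / lt 0" for x
    using bd_q_1[OF rates, of x] mt0 lt_pos[of 0] by (simp add: field_simps)
  have "pt (Suc 0) * (LINT x|phit. 1 - x / lt 0) = 0"
    using Pt_eq[of 0 0 "Suc 0"] Pt_0[of 0 "Suc 0"] by (simp add: q1)
  moreover note T.integrable_ident
  ultimately show ?thesis using pt_pos[of "Suc 0"] lt_pos[of 0] by (simp add: T.prob_space[unfolded T.space_M])
qed

definition psi :: "real measure" where
  "psi = density phit (\<lambda>x. ennreal (x / lt 0))"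

lemma sets_psi [simp, measurable_cong]: "sets psi = sets borel"
  by (simp add: psi_def)

lemma weight_nonneg: "AE x in phit. 0 \<le> x / lt 0"
  using T.AE_nonneg by eventually_elim (use lt_pos[of 0] in simp)

lemma integral_psi:
  fixes f :: "real \<Rightarrow> real"
  assumes [measurable]: "f \<in> borel_measurable borel"
  shows "(LINT x|psi. f x) = (LINT x|phit. x / lt 0 * f x)"
  unfolding psi_def by (subst integral_density) (auto simp: weight_nonneg)

lemma integrable_psi:
  fixes f :: "real \<Rightarrow> real"
  assumes [measurable]: "f \<in> borel_measurable borel"
  shows "integrable psi f \<longleftrightarrow> integrable phit (\<lambda>x. x / lt 0 * f x)"
  unfolding psi_def by (subst integrable_density) (auto simp: weight_nonneg)

lemma AE_psi_nonneg: "AE x in psi. x \<ge> 0"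
  unfolding psi_def by (subst AE_density) (use T.AE_nonneg in \<open>auto elim: eventually_mono\<close>)

lemma supp_psi: "supp phit - {0} \<subseteq> supp psi"
proof
  fix x assume x: "x \<in> supp phit - {0}"
  then have "x > 0" using T.supp_nonneg by force
  show "x \<in> supp psi"
    unfolding supp_def
  proof (intro CollectI allI impI)
    fix U assume U: "open U" "x \<in> U"
    \<comment> \<open>Away from \<open>0\<close> the density \<open>x / lt 0\<close> is positive, so
      null sets of \<open>psi\<close> in this part are null sets of \<open>phit\<close>.\<close>
    have "emeasure phit (U \<inter> {x/2<..}) > 0"
      using x U \<open>x > 0\<close> unfolding supp_def by (auto simp: open_Int)
    moreover have "emeasure psi (U \<inter> {x/2<..}) = 0 \<Longrightarrow> emeasure phit (U \<inter> {x/2<..}) = 0"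
    proof -
      assume z: "emeasure psi (U \<inter> {x/2<..}) = 0"
      have [measurable]: "U \<inter> {x/2<..} \<in> sets borel" using U by auto
      have "U \<inter> {x/2<..} \<in> null_sets psi" using z by (auto simp: null_sets_def)
      then have "AE y in phit. y \<in> U \<inter> {x/2<..} \<longrightarrow> ennreal (y / lt 0) = 0"
        unfolding psi_def by (subst (asm) null_sets_density_iff) auto
      then have "AE y in phit. y \<notin> U \<inter> {x/2<..}"
        by eventually_elim (use \<open>x > 0\<close> lt_pos[of 0] in \<open>auto simp: ennreal_eq_0_iff divide_le_0_iff\<close>)
      then show ?thesis
        by (subst (asm) AE_iff_null_sets[symmetric]) (auto simp: null_sets_def)
    qed
    ultimately have "emeasure psi (U \<inter> {x/2<..}) > 0" by (auto simp: zero_less_iff_neq_zero)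
    also have "emeasure psi (U \<inter> {x/2<..}) \<le> emeasure psi U" using U by (intro emeasure_mono) auto
    finally show "emeasure psi U > 0" .
  qed
qed

sublocale half_line_measure psi
proof
  note ix = T.integrable_ident
  have "prob_space psi"
  proof
    have "(\<integral>\<^sup>+x. ennreal (x / lt 0) \<partial>phit) = ennreal (LINT x|phit. x / lt 0)"
      using ix weight_nonneg by (intro nn_integral_eq_integral) auto
    also have "\<dots> = 1" using mean_phit lt_pos[of 0] by simp
    finally show "emeasure psi (space psi) = 1"
      unfolding psi_def by (subst emeasure_density) (auto cong: nn_integral_cong)
  qed
  moreover have "infinite (supp psi)"
    using supp_psi T.infinite_supp by (meson finite_Diff2 finite_subset finite.emptyI finite_insert)
  moreover have "integrable psi (\<lambda>x. x ^ n)" for n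
  proof -
    have "integrable phit (\<lambda>x. 1 / lt 0 * x ^ Suc n)"
      using T.moment_measure unfolding moment_measure_def by (intro integrable_mult_right) blast
    then show ?thesis by (subst integrable_psi) auto
  qed
  ultimately show "moment_measure psi" by (simp add: moment_measure_def)
  show "supp psi \<subseteq> {0..}"
    by (rule supp_subset_closed) (use AE_psi_nonneg in auto)
qed

definition P :: "real \<Rightarrow> nat \<Rightarrow> nat \<Rightarrow> real" where
  "P t i j = (\<Sum>k\<le>i. Pt t j k - Pt t (Suc j) k)"

lemma qt_diff: "qt j x - qt (Suc j) x = pd j * (x / lt 0 * q j x)"
  using x_sum_qt[of x j] lt_pos[of j] lt_pos[of 0] pt_pos[of j]
  by (simp add: q_dual pi_dual field_simps)

lemma sum_Pt_eq:
  assumes "t \<ge> 0"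
  shows "(\<Sum>k\<le>i. Pt t j k) = (LINT x|phit. exp (- x * t) * (q i x * qt j x))"
proof -
  have "(\<Sum>k\<le>i. Pt t j k) = (\<Sum>k\<le>i. pt k * (LINT x|phit. exp (- x * t) * (qt j x * qt k x)))"
    by (simp add: Pt_eq[OF assms])
  also have "\<dots> = (LINT x|phit. (\<Sum>k\<le>i. pt k * (exp (- x * t) * (qt j x * qt k x))))"
    using T.integrable_exp_poly[OF assms, of "bd_qpoly lt mt j * bd_qpoly lt mt _"] by simp
  also have "\<dots> = (LINT x|phit. exp (- x * t) * (q i x * qt j x))"
    unfolding q_dual by (simp add: sum_distrib_left sum_distrib_right mult_ac)
  finally show ?thesis .
qed

text \<open>Summation over \<open>k\<close> turns one \<open>qt\<close> into \<open>q\<close>; the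
  difference in \<open>j\<close> turns the other into \<open>q j\<close> and releases the factor
  \<open>x / lt 0\<close>, which changes \<open>phit\<close> into \<open>psi\<close>.\<close>

lemma P_eq:
  assumes t: "t \<ge> 0"
  shows "P t i j = pd j * (LINT x|psi. exp (- x * t) * (q i x * q j x))"
proof -
  have "P t i j = (LINT x|phit. exp (- x * t) * (q i x * qt j x)) - (LINT x|phit. exp (- x * t) * (q i x * qt (Suc j) x))"
    unfolding P_def sum_subtractf sum_Pt_eq[OF t] ..
  also have "\<dots> = (LINT x|phit. exp (- x * t) * (q i x * qt j x) - exp (- x * t) * (q i x * qt (Suc j) x))"
    using T.integrable_exp_poly[OF t, of "bd_qpoly l m i * bd_qpoly lt mt j"]
      T.integrable_exp_poly[OF t, of "bd_qpoly l m i * bd_qpoly lt mt (Suc j)"] by simp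
  also have "\<dots> = (LINT x|phit. pd j * (x / lt 0 * (exp (- x * t) * (q i x * q j x))))"
  proof (rule Bochner_Integration.integral_cong[OF refl])
    fix x
    have "exp (- x * t) * (q i x * qt j x) - exp (- x * t) * (q i x * qt (Suc j) x) =
        exp (- x * t) * (q i x * (qt j x - qt (Suc j) x))" by (simp add: algebra_simps)
    then show "exp (- x * t) * (q i x * qt j x) - exp (- x * t) * (q i x * qt (Suc j) x) =
        pd j * (x / lt 0 * (exp (- x * t) * (q i x * q j x)))"
      unfolding qt_diff by simp
  qed
  also have "\<dots> = pd j * (LINT x|psi. exp (- x * t) * (q i x * q j x))"
    by (simp add: integral_psi)
  finally show ?thesis .
qed

lemma corresponding_psi: "corresponding_measure l m P psi"
  unfolding corresponding_measure_iff[OF rates'] by (simp add: P_eq)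

end

section \<open>Transition functions of the dual process\<close>

context dual_setup
begin

lemma Pt_nonneg: "t \<ge> 0 \<Longrightarrow> Pt t i j \<ge> 0"
  and Pt_summable: "t \<ge> 0 \<Longrightarrow> summable (Pt t i)"
  and Pt_sum_le_1: "t \<ge> 0 \<Longrightarrow> (\<Sum>j. Pt t i j) \<le> 1"
  and Pt_semigroup: "s \<ge> 0 \<Longrightarrow> t \<ge> 0 \<Longrightarrow> Pt (s + t) = mprod (Pt s) (Pt t)"
proof -
  note p = process[unfolded bd_process_def, THEN conjunct2]
  show "t \<ge> 0 \<Longrightarrow> Pt t i j \<ge> 0"
    by (rule p[THEN conjunct1, rule_format])
  show "t \<ge> 0 \<Longrightarrow> summable (Pt t i)"
    by (rule p[THEN conjunct2, THEN conjunct1, rule_format, THEN conjunct1])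
  show "t \<ge> 0 \<Longrightarrow> (\<Sum>j. Pt t i j) \<le> 1"
    by (rule p[THEN conjunct2, THEN conjunct1, rule_format, THEN conjunct2])
  show "s \<ge> 0 \<Longrightarrow> t \<ge> 0 \<Longrightarrow> Pt (s + t) = mprod (Pt s) (Pt t)"
    by (rule p[THEN conjunct2, THEN conjunct2, THEN conjunct1, rule_format])
qed

lemma Pt_forward: "t \<ge> 0 \<Longrightarrow> ((\<lambda>t. Pt t i j) has_real_derivative
    (if j = 0 then 0 else Pt t i (j - 1) * lt (j - 1)) - (lt j + mt j) * Pt t i j + Pt t i (Suc j) * mt (Suc j))
    (at t within {0..})"
  using bd_process_derivative(2)[OF process, of t i j] unfolding mprod_Q_right .

lemma Pt_backward: "t \<ge> 0 \<Longrightarrow> ((\<lambda>t. Pt t i j) has_real_derivative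
    (if i = 0 then 0 else mt i * Pt t (i - 1) j) - (lt i + mt i) * Pt t i j + lt i * Pt t (Suc i) j)
    (at t within {0..})"
  using bd_process_derivative(1)[OF process, of t i j] unfolding mprod_Q_left .

text \<open>The indices are exchanged in the definition of \<open>P\<close>, so its backward
  equation comes from the forward equation of \<open>Pt\<close>.\<close>

lemma P_backward:
  assumes "t \<ge> 0"
  shows "((\<lambda>t. P t i j) has_real_derivative mprod (Q_matrix l m) (P t) i j) (at t within {0..})"
proof -
  define D where "D j k = (if k = 0 then 0 else Pt t j (k - 1) * lt (k - 1)) - (lt k + mt k) * Pt t j k
    + Pt t j (Suc k) * mt (Suc k)" for j k
  \<comment> \<open>The sum is the net flow of \<open>Pt\<close> between the states \<open>i\<close>
    and \<open>Suc i\<close>; nothing is lost at the bottom because \<open>mt 0 = 0\<close>.\<close>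
  have tel: "(\<Sum>k\<le>i. D j k) = - lt i * Pt t j i + mt (Suc i) * Pt t j (Suc i)" for i j
    by (induction i) (auto simp: D_def mt0 algebra_simps)
  have "((\<lambda>t. P t i j) has_real_derivative (\<Sum>k\<le>i. D j k - D (Suc j) k)) (at t within {0..})"
    unfolding P_def D_def
    by (rule DERIV_sum, rule DERIV_diff[OF Pt_forward[OF assms] Pt_forward[OF assms]])
  moreover have "(\<Sum>k\<le>i. D j k - D (Suc j) k) = mprod (Q_matrix l m) (P t) i j"
    unfolding sum_subtractf tel mprod_Q_left by (cases i) (auto simp: P_def algebra_simps)
  ultimately show ?thesis by simp
qed

lemma P_forward:
  assumes "t \<ge> 0"
  shows "((\<lambda>t. P t i j) has_real_derivative mprod (P t) (Q_matrix l m) i j) (at t within {0..})"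
proof -
  define D where "D j k = (if j = 0 then 0 else mt j * Pt t (j - 1) k) - (lt j + mt j) * Pt t j k
    + lt j * Pt t (Suc j) k" for j k
  have tel: "(\<Sum>k\<le>i. D j k) = (if j = 0 then 0 else mt j * P t i (j - 1)) - lt j * P t i j" for j
  proof (cases j)
    case 0
    then show ?thesis by (simp add: D_def P_def mt0 sum_distrib_left sum_subtractf sum.distrib algebra_simps)
  next
    case (Suc j')
    have "D j k = mt j * (Pt t j' k - Pt t (Suc j') k) - lt j * (Pt t j k - Pt t (Suc j) k)" for k
      by (simp add: D_def Suc algebra_simps)
    then show ?thesis by (simp add: P_def Suc sum_subtractf flip: sum_distrib_left)
  qed
  have "((\<lambda>t. P t i j) has_real_derivative (\<Sum>k\<le>i. D j k - D (Suc j) k)) (at t within {0..})"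
    unfolding P_def D_def
    by (rule DERIV_sum, rule DERIV_diff[OF Pt_backward[OF assms] Pt_backward[OF assms]])
  moreover have "(\<Sum>k\<le>i. D j k - D (Suc j) k) = mprod (P t) (Q_matrix l m) i j"
    unfolding sum_subtractf tel mprod_Q_right by (cases j) (auto simp: algebra_simps)
  ultimately show ?thesis by simp
qed

lemma P_0: "P 0 i j = (if i = j then 1 else 0)"
  unfolding P_def Pt_0 sum_subtractf by auto

lemma monic_orth_bd_poly: "monic_orth (\<lambda>_. 1) n (bd_poly l m n)"
proof (rule monic_orth_if_orthogonal)
  show "lead_coeff (bd_poly l m n) = 1" for n by (simp add: degree_bd_poly lead_coeff_bd_poly)
  fix i j :: nat assume "i \<noteq> j"
  define A where "A = (-1) ^ i / (\<Prod>k<i. mt (Suc k)) * ((-1) ^ j / (\<Prod>k<j. mt (Suc k)))"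
  have "(\<Prod>k<n. mt (Suc k)) > 0" for n
    using rate_setD(2)[OF rates] by (intro prod_pos) simp
  then have A: "A \<noteq> 0" unfolding A_def by (metis divide_eq_0_iff less_irrefl mult_eq_0_iff power_eq_0_iff zero_neq_neg_one)
  have "(LINT x|psi. q i x * q j x) = 0"
    using P_eq[of 0 i j] P_0[of i j] \<open>i \<noteq> j\<close> pd_pos[of j] by simp
  moreover have "q i x * q j x = A * (poly (bd_poly l m i) x * poly (bd_poly l m j) x)" for x
    by (simp add: bd_q_def A_def)
  ultimately have "A * ip (\<lambda>_. 1) (bd_poly l m i) (bd_poly l m j) = 0"
    unfolding ip_def by (simp only: integral_mult_right_zero mult_1_right)
  then show "ip (\<lambda>_. 1) (bd_poly l m i) (bd_poly l m j) = 0"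
    using A by (metis mult_eq_0_iff)
qed (simp add: degree_bd_poly)

text \<open>The signs built into \<open>q i\<close> and \<open>q j\<close> are exactly those in
  \<open>exp_weight_nonneg\<close>.\<close>

lemma P_nonneg:
  assumes "t \<ge> 0"
  shows "P t i j \<ge> 0"
proof -
  define C where "C n = (\<Prod>k<n. mt (Suc k))" for n
  have C: "C n > 0" for n unfolding C_def using rate_setD(2)[OF rates] by (auto intro: prod_pos)
  have "(LINT x|psi. exp (- x * t) * (q i x * q j x)) =
      (LINT x|psi. ((-1) ^ (i + j) / (C i * C j)) * (poly (bd_poly l m i) x * poly (bd_poly l m j) x * exp (- x * t)))"
    by (simp add: bd_q_def C_def power_add mult_ac)
  also have "\<dots> = ((-1) ^ (i + j) * ip (\<lambda>x. exp (- x * t)) (bd_poly l m i) (bd_poly l m j)) / (C i * C j)"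
    unfolding integral_mult_right_zero by (simp add: ip_def)
  also have "\<dots> \<ge> 0"
    using exp_weight_nonneg[OF assms monic_orth_bd_poly, of i j] C[of i] C[of j] by (intro divide_nonneg_pos mult_pos_pos)
  finally show ?thesis unfolding P_eq[OF assms] using pd_pos[of j] by simp
qed

lemma P_sum_telescope: "(\<Sum>j<n. P t i j) = (\<Sum>k\<le>i. Pt t 0 k) - (\<Sum>k\<le>i. Pt t n k)"
  by (induction n) (simp_all add: P_def sum_subtractf)

lemma sum_Pt_le_1:
  assumes "t \<ge> 0"
  shows "(\<Sum>k\<le>i. Pt t j k) \<le> 1"
proof -
  have "(\<Sum>k\<le>i. Pt t j k) \<le> (\<Sum>k. Pt t j k)"
    by (rule sum_le_suminf[OF Pt_summable[OF assms]]) (auto simp: Pt_nonneg[OF assms])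
  then show ?thesis using Pt_sum_le_1[OF assms, of j] by linarith
qed

text \<open>By telescoping, a partial row sum of \<open>P\<close> is a difference of two partial row
  sums of \<open>Pt\<close>, each between \<open>0\<close> and \<open>1\<close>.\<close>

lemma P_row:
  assumes "t \<ge> 0"
  shows "summable (P t i) \<and> (\<Sum>j. P t i j) \<le> 1"
proof -
  have le: "(\<Sum>j<n. P t i j) \<le> 1" for n
    unfolding P_sum_telescope using sum_Pt_le_1[OF assms, of 0 i]
      sum_nonneg[of "{..i}" "Pt t n"] Pt_nonneg[OF assms] by fastforce
  have "summable (P t i)" by (rule summableI_nonneg_bounded[OF _ le]) (rule P_nonneg[OF assms])
  then show ?thesis using suminf_le_const[OF _ le] by blast
qed

lemma divergent_cases:
  obtains "\<not> summable pt" | "\<not> summable pd"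
proof (cases "summable pd")
  case False
  then show ?thesis by (rule that(2))
next
  case True
  then have "summable (\<lambda>n. 1 / (lt n * pt n))"
    using summable_mult[OF True, of "1 / lt 0"] lt_pos[of 0] by (simp add: pi_dual)
  then have "\<not> summable pt" using divergent summable_add[of pt "\<lambda>n. 1 / (lt n * pt n)"] by blast
  then show ?thesis by (rule that(1))
qed

text \<open>Abel summation reduces the semigroup property of \<open>P\<close> to that of \<open>Pt\<close>, up to the boundary
  term \<open>C n * G (Suc n)\<close>.  By Bessel's inequality one of its factors is square summable against the
  divergent one of the weights \<open>pd\<close> and \<open>pt\<close>, and both factors converge.\<close>

lemma P_semigroup:
  assumes s: "s \<ge> 0" and t: "t \<ge> 0"
  shows "P (s + t) = mprod (P s) (P t)"
proof (intro ext)
  fix i j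
  define G where "G n = (\<Sum>k\<le>i. Pt s n k)" for n
  define c where "c n = Pt t j n - Pt t (Suc j) n" for n
  define C where "C n = (\<Sum>k\<le>n. c k)" for n
  have Pi: "P s i n = G n - G (Suc n)" for n by (simp add: P_def G_def sum_subtractf)
  have Pj: "P t n j = C n" for n by (simp add: P_def C_def c_def)
  have abel: "(\<Sum>n\<le>N. c n * G n) = (\<Sum>n\<le>N. P s i n * P t n j) + C N * G (Suc N)" for N
  proof (induction N)
    case 0
    then show ?case by (simp add: Pi Pj C_def algebra_simps)
  next
    case (Suc N)
    have "C (Suc N) = C N + c (Suc N)" by (simp add: C_def)
    then show ?case using Suc by (simp add: Pi Pj algebra_simps)
  qed
  have sc: "summable c" unfolding c_def by (intro summable_diff Pt_summable t)
  \<comment> \<open>The product for \<open>Pt\<close> is taken in the order \<open>t\<close>, then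
    \<open>s\<close>, so that \<open>c\<close> carries the time \<open>t\<close> and
    \<open>G\<close> the time \<open>s\<close>.\<close>
  have Pst: "P (s + t) i j = (\<Sum>n. c n * G n)" and sG: "summable (\<lambda>n. c n * G n)"
  proof -
    have sp: "summable (\<lambda>n. Pt t j' n * Pt s n k)" for j' k
    proof (rule summable_comparison_test'[OF Pt_summable[OF t, of j']])
      fix n
      have "Pt s n k \<le> (\<Sum>k\<le>k. Pt s n k)" by (rule member_le_sum) (auto simp: Pt_nonneg[OF s])
      then have "Pt s n k \<le> 1" using sum_Pt_le_1[OF s, of n k] by linarith
      then show "norm (Pt t j' n * Pt s n k) \<le> Pt t j' n"
        using Pt_nonneg[OF t, of j' n] Pt_nonneg[OF s, of n k] by (simp add: abs_mult mult_left_le)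
    qed
    have e: "Pt (s + t) j' k = (\<Sum>n. Pt t j' n * Pt s n k)" for j' k
      using Pt_semigroup[OF t s] by (simp add: add.commute mprod_def)
    have cG: "c n * G n = (\<Sum>k\<le>i. Pt t j n * Pt s n k - Pt t (Suc j) n * Pt s n k)" for n
      unfolding c_def G_def sum_distrib_left by (simp add: left_diff_distrib)
    have sm: "summable (\<lambda>n. Pt t j n * Pt s n k - Pt t (Suc j) n * Pt s n k)" for k
      by (intro summable_diff sp)
    show "summable (\<lambda>n. c n * G n)" unfolding cG by (intro summable_sum sm)
    have "P (s + t) i j = (\<Sum>k\<le>i. (\<Sum>n. Pt t j n * Pt s n k - Pt t (Suc j) n * Pt s n k))"
      unfolding P_def e by (intro sum.cong refl suminf_diff sp)
    also have "\<dots> = (\<Sum>n. \<Sum>k\<le>i. Pt t j n * Pt s n k - Pt t (Suc j) n * Pt s n k)"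
      by (rule suminf_sum[symmetric]) (rule sm)
    finally show "P (s + t) i j = (\<Sum>n. c n * G n)" unfolding cG .
  qed
  have G0: "G n \<ge> 0" for n unfolding G_def by (intro sum_nonneg) (rule Pt_nonneg[OF s])
  \<comment> \<open>Positivity of \<open>P\<close> enters here: it makes \<open>G\<close> monotone,
    hence convergent.\<close>
  have "G (Suc n) \<le> G n" for n using Pi[of n] P_nonneg[OF s, of i n] by simp
  then have "decseq G" by (rule decseq_SucI)
  then obtain g where g: "G \<longlonglongrightarrow> g" using decseq_convergent[of G 0] G0 by blast
  define c' where "c' = suminf c"
  have c': "C \<longlonglongrightarrow> c'" unfolding C_def c'_def using summable_LIMSEQ'[OF sc] .
  have cg: "c' * g = 0"
  proof (cases rule: divergent_cases)
    case 1
    \<comment> \<open>\<open>G k\<close> is the Fourier coefficient of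
      \<open>exp (- x * s) * q i x\<close> with respect to \<open>qt k\<close> in
      \<open>phit\<close>.\<close>
    have "g = 0"
    proof (rule limit_zero_if_weighted_squares_bounded[OF _ 1 g])
      fix n
      show "pt n \<ge> 0" using pt_pos[of n] by simp
      let ?g = "\<lambda>x. exp (- x * s) * q i x"
      have "(\<Sum>k<n. pt k * (LINT x|phit. ?g x * poly (bd_qpoly lt mt k) x)\<^sup>2) \<le> (LINT x|phit. (?g x)\<^sup>2)"
      proof (rule T.bessel)
        have sq: "exp (- x * s) * q i x * (exp (- x * s) * q i x) = exp (- x * (2 * s)) * poly (bd_qpoly l m i * bd_qpoly l m i) x" for x
        proof -
          have "exp (- x * (2 * s)) = exp (- x * s) * exp (- x * s)" by (simp flip: exp_add)
          then show ?thesis by (simp add: mult_ac)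
        qed
        show "integrable phit (\<lambda>x. (?g x)\<^sup>2)"
          unfolding power2_eq_square sq by (rule T.integrable_exp_poly) (use s in simp)
        show "integrable phit (\<lambda>x. ?g x * poly p x)" for p
          using T.integrable_exp_poly[OF s, of "bd_qpoly l m i * p"] by (simp add: mult.assoc)
        show "pt j * (LINT x|phit. poly (bd_qpoly lt mt i) x * poly (bd_qpoly lt mt j) x) = (if i = j then 1 else 0)" for i j
          using Pt_eq[of 0 i j] Pt_0[of i j] by simp
      qed measurable
      then show "(\<Sum>k<n. pt k * (G k)\<^sup>2) \<le> (LINT x|phit. (?g x)\<^sup>2)"
        by (simp add: G_def sum_Pt_eq[OF s] mult.assoc)
    qed
    then show ?thesis by simp
  next
    case 2
    \<comment> \<open>\<open>C k / pd j\<close> is the Fourier coefficient of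
      \<open>exp (- x * t) * q j x\<close> with respect to \<open>q k\<close> in
      \<open>psi\<close>.\<close>
    have "c' / pd j = 0"
    proof (rule limit_zero_if_weighted_squares_bounded[OF _ 2])
      show "(\<lambda>n. C n / pd j) \<longlonglongrightarrow> c' / pd j" by (intro tendsto_intros c') (use pd_pos[of j] in simp)
      fix n
      show "pd n \<ge> 0" using pd_pos[of n] by simp
      let ?g = "\<lambda>x. exp (- x * t) * q j x"
      have "(\<Sum>k<n. pd k * (LINT x|psi. ?g x * poly (bd_qpoly l m k) x)\<^sup>2) \<le> (LINT x|psi. (?g x)\<^sup>2)"
      proof (rule bessel)
        have sq: "exp (- x * t) * q j x * (exp (- x * t) * q j x) = exp (- x * (2 * t)) * poly (bd_qpoly l m j * bd_qpoly l m j) x" for x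
        proof -
          have "exp (- x * (2 * t)) = exp (- x * t) * exp (- x * t)" by (simp flip: exp_add)
          then show ?thesis by (simp add: mult_ac)
        qed
        show "integrable psi (\<lambda>x. (?g x)\<^sup>2)"
          unfolding power2_eq_square sq by (rule integrable_exp_poly) (use t in simp)
        show "integrable psi (\<lambda>x. ?g x * poly p x)" for p
          using integrable_exp_poly[OF t, of "bd_qpoly l m j * p"] by (simp add: mult.assoc)
        show "pd j * (LINT x|psi. poly (bd_qpoly l m i) x * poly (bd_qpoly l m j) x) = (if i = j then 1 else 0)" for i j
          using P_eq[of 0 i j] P_0[of i j] by simp
      qed measurable
      moreover have "C k / pd j = (LINT x|psi. ?g x * poly (bd_qpoly l m k) x)" for k
        using P_eq[OF t, of k j] pd_pos[of j] by (simp add: Pj mult_ac)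
      ultimately show "(\<Sum>k<n. pd k * (C k / pd j)\<^sup>2) \<le> (LINT x|psi. (?g x)\<^sup>2)"
        by simp
    qed
    then show ?thesis using pd_pos[of j] by simp
  qed
  have "(\<lambda>N. C N * G (Suc N)) \<longlonglongrightarrow> 0"
    using tendsto_mult[OF c' LIMSEQ_Suc[OF g]] unfolding cg .
  moreover have "(\<lambda>N. \<Sum>n\<le>N. c n * G n) \<longlonglongrightarrow> P (s + t) i j"
    unfolding Pst using summable_LIMSEQ'[OF sG] .
  ultimately have "(\<lambda>N. (\<Sum>n\<le>N. c n * G n) - C N * G (Suc N)) \<longlonglongrightarrow> P (s + t) i j - 0"
    by (intro tendsto_diff)
  then have "(\<lambda>n. P s i n * P t n j) sums P (s + t) i j"
    unfolding abel sums_def_le by simp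
  then show "P (s + t) i j = mprod (P s) (P t) i j"
    unfolding mprod_def by (rule sums_unique)
qed

lemma bd_process_P: "bd_process l m P"
  unfolding bd_process_def
  by (intro conjI allI impI)
     (assumption | rule rates' P_nonneg P_row[THEN conjunct1] P_row[THEN conjunct2] P_semigroup P_0 P_backward P_forward)+

lemma uniquely_determined_Pt: "uniquely_determined lt mt Pt"
  unfolding uniquely_determined_def
  using process bd_process_unique[OF _ process divergent] by blast

lemma uniquely_determined_P: "uniquely_determined l m P"
proof -
  have "\<not> summable (\<lambda>n. pd n + 1 / (l n * pd n))"
  proof
    assume s: "summable (\<lambda>n. pd n + 1 / (l n * pd n))"
    \<comment> \<open>Thus the series for \<open>l, m\<close> has the terms
      \<open>pd n + pt (Suc n) / lt 0\<close>, and its convergence would make both weights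
      summable.\<close>
    have lp: "l n * pd n = lt 0 / pt (Suc n)" for n
      using pi_coeff_Suc[OF rates', of n] lt_pos[of "Suc n"] by (simp add: pi_dual)
    have "norm (pd n) \<le> pd n + 1 / (l n * pd n)" for n
      using pd_pos[of n] rate_setD(2)[OF rates, of n] by simp
    with s have "summable pd" by (rule summable_comparison_test'[where N=0])
    moreover have "summable pt"
    proof -
      have "summable (\<lambda>n. lt 0 * (pd n + 1 / (l n * pd n)))" using s by (rule summable_mult)
      moreover have "norm (pt (Suc n)) \<le> lt 0 * (pd n + 1 / (l n * pd n))" for n
      proof -
        have "lt 0 * (pd n + 1 / (l n * pd n)) = lt 0 * pd n + pt (Suc n)"
          unfolding lp distrib_left using lt_pos[of 0] by simp
        moreover have "lt 0 * pd n > 0" using lt_pos[of 0] pd_pos[of n] by simp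
        ultimately show ?thesis using pt_pos[of "Suc n"] by simp
      qed
      ultimately have "summable (\<lambda>n. pt (Suc n))"
        by (rule summable_comparison_test'[where N=0])
      then show ?thesis by (rule summable_Suc_iff[THEN iffD1])
    qed
    ultimately show False using divergent_cases by blast
  qed
  from bd_process_unique[OF _ bd_process_P this] show ?thesis
    unfolding uniquely_determined_def using bd_process_P by blast
qed

end

section \<open>Natural solutions\<close>

context half_line_measure
begin

section \<open>Inversion of Stieltjes transforms\<close>

lemma laplace_continuous: "continuous_on {0..} (\<lambda>t. LINT y|M. exp (- (t * y)))"
  unfolding continuous_on_sequentially
proof (intro allI ballI impI, elim conjE)
  fix x :: "nat \<Rightarrow> real" and a
  assume "a \<in> {0..}" and x: "\<forall>n. x n \<in> {0..}" "x \<longlonglongrightarrow> a"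
  show "((\<lambda>t. LINT y|M. exp (- (t * y))) \<circ> x) \<longlonglongrightarrow> (LINT y|M. exp (- (a * y)))"
    unfolding comp_def
  proof (rule integral_dominated_convergence[where w="\<lambda>_. 1"])
    show "AE y in M. (\<lambda>n. exp (- (x n * y))) \<longlonglongrightarrow> exp (- (a * y))"
      by (intro AE_I2 tendsto_intros x)
    show "AE y in M. norm (exp (- (x n * y))) \<le> 1" for n
      using AE_nonneg by eventually_elim (use x(1) in simp)
  qed auto
qed

lemma laplace_range:
  assumes "t \<ge> 0"
  shows "0 \<le> (LINT y|M. exp (- (t * y)))" "(LINT y|M. exp (- (t * y))) \<le> 1"
proof -
  show "0 \<le> (LINT y|M. exp (- (t * y)))" by (rule integral_nonneg_AE) simp
  have *: "AE y in M. norm (exp (- (t * y))) \<le> 1"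
    using AE_nonneg by eventually_elim (use assms in simp)
  then have "(LINT y|M. exp (- (t * y))) \<le> (LINT y|M. 1)"
    by (intro integral_mono_AE integrable_const_bound[where B=1]) auto
  then show "(LINT y|M. exp (- (t * y))) \<le> 1" by (simp add: prob_space[unfolded space_M])
qed

lemma laplace_laplace:
  assumes s: "s > 0"
  shows "laplace (\<lambda>t. LINT y|M. exp (- (t * y))) s = (LINT y|M. 1 / (y + s))"
proof -
  interpret pair_sigma_finite lborel M
    by unfold_locales
  \<comment> \<open>The indicator in \<open>y\<close> makes the bound \<open>f_le\<close> hold
    everywhere and not only almost everywhere.\<close>
  define f where "f t y = indicator {0..} t * exp (- (s * t)) * (indicator {0..} y * exp (- (t * y)))" for t y :: real
  have f_le: "\<bar>f t y\<bar> \<le> indicator {0..} t * exp (- (s * t))" for t y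
    by (auto simp: f_def indicator_def)
  have fm [measurable]: "(\<lambda>(t, y). f t y) \<in> borel_measurable (lborel \<Otimes>\<^sub>M M)"
    unfolding f_def by measurable
  have ie: "integrable lborel (\<lambda>t. indicator {0..} t * exp (- (s * t)))"
    using exp_integral(1)[OF s] unfolding set_integrable_def by simp
  have ft: "integrable M (f t)" for t
    by (rule integrable_const_bound[where B="indicator {0..} t * exp (- (s * t))"])
       (use f_le in \<open>auto simp: f_def[abs_def]\<close>)
  have int: "integrable (lborel \<Otimes>\<^sub>M M) (\<lambda>(t, y). f t y)"
  proof (rule Fubini_integrable)
    show "integrable lborel (\<lambda>t. LINT y|M. norm (case (t, y) of (t, y) \<Rightarrow> f t y))"
    proof (rule Bochner_Integration.integrable_bound[OF ie])
      show "AE t in lborel. norm (LINT y|M. norm (case (t, y) of (t, y) \<Rightarrow> f t y)) \<le> norm (indicator {0..} t * exp (- (s * t)) :: real)"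
      proof (rule AE_I2)
        fix t
        have "(LINT y|M. \<bar>f t y\<bar>) \<le> (LINT y|M. indicator {0..} t * exp (- (s * t)))"
          using f_le ft[of t] by (intro integral_mono) auto
        then show "norm (LINT y|M. norm (case (t, y) of (t, y) \<Rightarrow> f t y)) \<le> norm (indicator {0..} t * exp (- (s * t)) :: real)"
          by (simp add: prob_space[unfolded space_M])
      qed
    qed measurable
  qed (use ft in auto)
  have "laplace (\<lambda>t. LINT y|M. exp (- (t * y))) s = (LINT t|lborel. LINT y|M. f t y)"
    unfolding laplace_def set_lebesgue_integral_def
  proof (rule Bochner_Integration.integral_cong[OF refl])
    fix t :: real
    have "(LINT y|M. exp (- (t * y))) = (LINT y|M. indicator {0..} y * exp (- (t * y)))"
      by (rule integral_cong_AE) (use AE_nonneg in \<open>auto elim: eventually_mono\<close>)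
    then show "indicator {0..} t *\<^sub>R (exp (- (s * t)) * (LINT y|M. exp (- (t * y)))) = (LINT y|M. f t y)"
      by (simp add: f_def)
  qed
  also have "\<dots> = (LINT y|M. LINT t|lborel. f t y)"
    by (rule Fubini_integral[OF int, symmetric])
  also have "\<dots> = (LINT y|M. 1 / (y + s))"
  proof (rule integral_cong_AE)
    show "AE y in M. (LINT t|lborel. f t y) = 1 / (y + s)"
      using AE_nonneg
    proof eventually_elim
      case (elim y)
      have "(LINT t|lborel. f t y) = (LINT t:{0..}|lborel. exp (- ((y + s) * t)))"
        unfolding set_lebesgue_integral_def using elim
        by (intro Bochner_Integration.integral_cong) (auto simp: f_def ring_distribs mult.commute simp flip: exp_add)
      then show ?case using exp_integral(2)[of "y + s"] elim s by simp
    qed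
  qed measurable
  finally show ?thesis .
qed

end

text \<open>The Stieltjes transform is a Laplace transform applied twice.
  \<open>laplace_unique\<close> undoes the outer one, \<open>laplace_transform_unique\<close> the
  inner one.\<close>

lemma stieltjes_transform_unique:
  assumes M: "half_line_measure M" and N: "half_line_measure N"
    and eq: "\<And>s. s > 0 \<Longrightarrow> (LINT y|M. 1 / (y + s)) = (LINT y|N. 1 / (y + s))"
  shows "M = N"
proof -
  interpret M: half_line_measure M by fact
  interpret N: half_line_measure N by fact
  have *: "(LINT y|M. exp (- (t * y))) = (LINT y|N. exp (- (t * y)))" if "t \<ge> 0" for t
    by (rule laplace_unique[where f="\<lambda>t. LINT y|M. exp (- (t * y))" and g="\<lambda>t. LINT y|N. exp (- (t * y))" and B=1 and t=t])
       (simp_all add: M.laplace_continuous N.laplace_continuous M.laplace_range N.laplace_range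
         M.laplace_laplace N.laplace_laplace eq that)
  show ?thesis
    by (rule laplace_transform_unique)
       (simp_all add: M.prob_space_axioms N.prob_space_axioms M.AE_nonneg N.AE_nonneg *)
qed

lemma same_moments_poly:
  assumes M: "half_line_measure M" and N: "half_line_measure N" and eq: "same_moments M N"
  shows "(LINT x|M. poly p x) = (LINT x|N. poly p x)"
proof -
  interpret M: half_line_measure M by fact
  interpret N: half_line_measure N by fact
  have "integrable K (\<lambda>x. x ^ n)" if "K = M \<or> K = N" for K n
    using M.moment_measure N.moment_measure that unfolding moment_measure_def by blast
  then have "(LINT x|K. poly p x) = (\<Sum>i\<le>degree p. coeff p i * (LINT x|K. x ^ i))" if "K = M \<or> K = N" for K
    using that by (simp add: poly_altdef)
  then show ?thesis using eq by (simp add: same_moments_def)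
qed

section \<open>Estimates for products over roots\<close>

lemma prod_list_mono_real:
  fixes f g :: "real \<Rightarrow> real"
  assumes "\<And>x. x \<in> set xs \<Longrightarrow> 0 \<le> f x" "\<And>x. x \<in> set xs \<Longrightarrow> f x \<le> g x"
  shows "0 \<le> (\<Prod>x\<leftarrow>xs. f x) \<and> (\<Prod>x\<leftarrow>xs. f x) \<le> (\<Prod>x\<leftarrow>xs. g x)"
  using assms
proof (induction xs)
  case (Cons a xs)
  have "f a \<ge> 0" "f a \<le> g a" using Cons.prems by auto
  moreover have "0 \<le> (\<Prod>x\<leftarrow>xs. f x) \<and> (\<Prod>x\<leftarrow>xs. f x) \<le> (\<Prod>x\<leftarrow>xs. g x)"
    using Cons.prems by (intro Cons.IH) auto
  ultimately show ?case by (auto intro!: mult_mono)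
qed simp

lemma prod_list_power_real: "(\<Prod>x\<leftarrow>xs. f x ^ k) = (\<Prod>x\<leftarrow>xs. f x :: real) ^ k"
  by (induction xs) (simp_all add: power_mult_distrib)

lemma prod_list_le_factor:
  fixes f :: "real \<Rightarrow> real"
  assumes "\<And>x. x \<in> set xs \<Longrightarrow> 0 \<le> f x \<and> f x \<le> 1" "z \<in> set xs"
  shows "(\<Prod>x\<leftarrow>xs. f x) \<le> f z"
  using assms
proof (induction xs)
  case (Cons a xs)
  have b: "0 \<le> (\<Prod>x\<leftarrow>xs. f x) \<and> (\<Prod>x\<leftarrow>xs. f x) \<le> (\<Prod>x\<leftarrow>xs. 1)"
    using Cons.prems(1) by (intro prod_list_mono_real) auto
  have a: "0 \<le> f a" "f a \<le> 1" using Cons.prems(1)[of a] by auto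
  show ?case
  proof (cases "z = a")
    case True
    then show ?thesis using a b by (simp add: mult_left_le prod_list_replicate[of _ 1, simplified] map_replicate_const)
  next
    case False
    then have "(\<Prod>x\<leftarrow>xs. f x) \<le> f z" using Cons by simp
    moreover have "f a * (\<Prod>x\<leftarrow>xs. f x) \<le> (\<Prod>x\<leftarrow>xs. f x)"
      using a b by (intro mult_left_le_one_le) auto
    ultimately show ?thesis by simp
  qed
qed simp

text \<open>Used with \<open>a = x - xi\<close> and \<open>b = xi + s\<close> for a root
  \<open>x\<close>: moving the argument of the factor from \<open>xi\<close> to
  \<open>xi + d\<close> costs at most a fixed power, with the same \<open>k\<close> for all roots at
  distance at least \<open>2 * d\<close>. With \<open>r = d / a \<le> 1 / 2\<close>, Bernoulli gives
  \<open>(1 + b / a) ^ k \<ge> 1 + 2 * r\<close>, and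
  \<open>(1 - r) * (1 + 2 * r) \<ge> 1\<close>.\<close>

lemma shifted_factor_bound:
  fixes a b d :: real
  assumes "d > 0" "b > 0" "a \<ge> 2 * d" "real k * b \<ge> 2 * d"
  shows "(a / (a + b)) ^ Suc k \<le> (a - d) / (a + b)"
proof -
  have a: "a > 0" using assms by simp
  have "2 * d / a \<le> real k * (b / a)" using assms(4) a by (simp add: divide_right_mono)
  also have "1 + real k * (b / a) \<le> (1 + b / a) ^ k"
    by (rule Bernoulli_inequality) (use a assms in \<open>simp add: order_trans[of _ 0]\<close>)
  finally have le: "1 + 2 * d / a \<le> (1 + b / a) ^ k" by simp
  have "1 \<le> (1 - d / a) * (1 + 2 * d / a)"
  proof -
    define r where "r = d / a"
    have "0 \<le> r" "r \<le> 1 / 2" using assms a by (auto simp: r_def field_simps)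
    then have "0 \<le> r * (1 - 2 * r)" by (intro mult_nonneg_nonneg) auto
    then have "1 \<le> (1 - r) * (1 + 2 * r)" by (simp add: algebra_simps)
    then show ?thesis by (simp add: r_def)
  qed
  also have "\<dots> \<le> (1 - d / a) * (1 + b / a) ^ k"
    using le assms a by (intro mult_left_mono) (auto simp: field_simps)
  finally have 1: "1 \<le> (1 - d / a) * (1 + b / a) ^ k" .
  have "1 + b / a = (a + b) / a" using a by (simp add: add_divide_distrib)
  then have ab: "a / (a + b) * (1 + b / a) = 1" using a assms by simp
  have "(a / (a + b)) ^ k * 1 \<le> (a / (a + b)) ^ k * ((1 - d / a) * (1 + b / a) ^ k)"
    using 1 a assms by (intro mult_left_mono) auto
  also have "\<dots> = (1 - d / a) * (a / (a + b) * (1 + b / a)) ^ k"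
    by (simp only: power_mult_distrib mult_ac)
  also have "\<dots> = 1 - d / a" unfolding ab by simp
  finally have "(a / (a + b)) ^ k \<le> 1 - d / a" by simp
  then have "a / (a + b) * (a / (a + b)) ^ k \<le> a / (a + b) * (1 - d / a)"
    using a assms by (intro mult_left_mono) auto
  also have "1 - d / a = (a - d) / a" using a by (simp add: diff_divide_distrib)
  also have "a / (a + b) * ((a - d) / a) = (a - d) / (a + b)" using a by simp
  finally show ?thesis by simp
qed

definition normalized_at :: "real \<Rightarrow> real poly \<Rightarrow> real poly" where
  "normalized_at x p = smult (1 / poly p x) p"

lemma poly_normalized_at: "poly (normalized_at x p) y = poly p y / poly p x"
  by (simp add: normalized_at_def)

context half_line_measure
begin

text \<open>For the constant weight the inner product of polynomials depends on the moments
  only.\<close>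

lemma monic_orth_transfer:
  assumes "half_line_measure N" "same_moments M N" "monic_orth (\<lambda>_. 1) n p"
  shows "half_line_measure.monic_orth N (\<lambda>_. 1) n p"
proof -
  interpret N: half_line_measure N by fact
  have "N.ip (\<lambda>_. 1) = ip (\<lambda>_. 1)"
    using same_moments_poly[OF half_line_measure_axioms assms(1,2), of "_ * _"]
    by (intro ext) (simp add: N.ip_def ip_def)
  then have "N.monic_orth (\<lambda>_. 1) n p = monic_orth (\<lambda>_. 1) n p"
    unfolding N.monic_orth_def monic_orth_def by (rule ssubst) (rule refl)
  then show ?thesis using assms(3) by simp
qed

text \<open>\<open>(1 - E\<^sup>2) / (y + s)\<close> is a polynomial when \<open>E(- s) = 1\<close>.\<close>

lemma stieltjes_difference:
  assumes N: "half_line_measure N" and "same_moments M N" and s: "s > 0" and E: "poly E (- s) = 1"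
  shows "(LINT y|N. 1 / (y + s)) - (LINT y|M. 1 / (y + s)) =
    half_line_measure.ip N (resolvent_weight s 1) E E - ip (resolvent_weight s 1) E E"
proof -
  interpret N: half_line_measure N by fact
  have "[:s, 1:] dvd 1 - E * E"
    using E by (subst minus_minus[of s, symmetric], subst poly_eq_0_iff_dvd[symmetric]) simp
  then obtain R where R: "1 - E * E = [:s, 1:] * R" by (elim dvdE)
  have key: "(LINT y|K. 1 / (y + s)) - half_line_measure.ip K (resolvent_weight s 1) E E = (LINT y|K. poly R y)"
    if "half_line_measure K" for K
  proof -
    interpret K: half_line_measure K by fact
    note w = weight_resolvent[OF s, of 1]
    have "(LINT y|K. 1 / (y + s)) - K.ip (resolvent_weight s 1) E E =
        (LINT y|K. poly 1 y * resolvent_weight s 1 y - poly E y * poly E y * resolvent_weight s 1 y)"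
      using K.weight_integrable[OF w, of 1] K.ip_integrable[OF w, of E E]
      by (simp add: K.ip_def resolvent_weight_def)
    also have "\<dots> = (LINT y|K. poly R y)"
    proof (rule integral_cong_AE)
      show "AE y in K. poly 1 y * resolvent_weight s 1 y - poly E y * poly E y * resolvent_weight s 1 y = poly R y"
        using K.AE_nonneg
      proof eventually_elim
        case (elim y)
        have "1 - poly E y * poly E y = (y + s) * poly R y"
          using arg_cong[OF R, of "\<lambda>p. poly p y"] by (simp add: algebra_simps)
        then show ?case using elim s by (simp add: resolvent_weight_def field_simps)
      qed
    qed (auto simp: resolvent_weight_def[abs_def])
    finally show ?thesis .
  qed
  show ?thesis
    using key[OF N] key[OF half_line_measure_axioms]
      same_moments_poly[OF half_line_measure_axioms N assms(2), of R] by linarith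
qed

text \<open>In this form each factor lies between \<open>0\<close> and \<open>1\<close> and
  decreases in \<open>y\<close>, as long as \<open>y\<close> runs from \<open>xi\<close> to the
  least root.\<close>

lemma monic_orth_normalized_factors:
  assumes s: "s > 0" and p: "monic_orth (\<lambda>_. 1) n p" and xi: "xi \<ge> 0" "supp M \<subseteq> {xi..}"
  obtains xs where "length xs = n" "\<And>x. x \<in> set xs \<Longrightarrow> xi < x"
    "\<And>y. poly (normalized_at (- s) p) y = (\<Prod>x\<leftarrow>xs. (x - y) / (x + s))"
proof -
  obtain xs where xs: "length xs = n" "p = (\<Prod>x\<leftarrow>xs. [:-x, 1:])" "\<And>x. x \<in> set xs \<Longrightarrow> xi < x"
    using monic_orth_roots[OF weight_one p xi(2)] by blast
  have "poly (\<Prod>x\<leftarrow>ys. [:-x, 1:]) y / poly (\<Prod>x\<leftarrow>ys. [:-x, 1:]) (- s) = (\<Prod>x\<leftarrow>ys. (x - y) / (x + s))"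
    for ys and y :: real
  proof (induction ys)
    case (Cons a ys)
    have "poly (\<Prod>x\<leftarrow>a # ys. [:-x, 1:]) y / poly (\<Prod>x\<leftarrow>a # ys. [:-x, 1:]) (- s) =
        ((y - a) / (- s - a)) * (poly (\<Prod>x\<leftarrow>ys. [:-x, 1:]) y / poly (\<Prod>x\<leftarrow>ys. [:-x, 1:]) (- s))"
      unfolding times_divide_times_eq by (simp add: algebra_simps)
    also have "(y - a) / (- s - a) = (a - y) / (a + s)"
      using minus_divide_divide[of "y - a" "- s - a"] by (simp add: add.commute)
    finally show ?case unfolding Cons.IH by simp
  qed simp
  then show ?thesis using that[of xs] xs by (simp add: poly_normalized_at)
qed

text \<open>With \<open>E\<close> the normalized orthogonal polynomial and \<open>z\<close> its least root, the integral of
  \<open>E\<^sup>2 / (y - z)\<close> vanishes; subtracting it from that of \<open>E\<^sup>2 / (y + s)\<close> leaves an integrand that is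
  positive only on \<open>[xi, z)\<close>.\<close>

lemma ip_normalized_le:
  assumes s: "s > 0" and p: "monic_orth (\<lambda>_. 1) n p" and xi: "xi \<ge> 0" "supp M \<subseteq> {xi..}"
    and z: "z \<in> set xs" and xs: "\<And>x. x \<in> set xs \<Longrightarrow> xi < x \<and> z \<le> x"
    and E: "\<And>y. poly (normalized_at (- s) p) y = (\<Prod>x\<leftarrow>xs. (x - y) / (x + s))"
  shows "ip (resolvent_weight s 1) (normalized_at (- s) p) (normalized_at (- s) p)
      \<le> poly (normalized_at (- s) p) xi / s"
proof -
  define E where "E = normalized_at (- s) p"
  note EE = E[folded E_def]
  let ?w = "resolvent_weight s 1"
  have ps: "poly p (- s) \<noteq> 0" using monic_orth_sign[OF weight_one p s] by auto
  have E0: "E \<noteq> 0" and dE: "degree E = n"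
    using ps p monic_orth_nonzero[OF p] by (auto simp: E_def normalized_at_def monic_orth_def)
  have "poly E z = 0"
    unfolding EE using z by (auto simp: prod_list_zero_iff)
  then obtain H where H: "E = [:-z, 1:] * H" by (metis poly_eq_0_iff_dvd dvdE)
  have "H \<noteq> 0" using E0 H by auto
  then have "degree H < n" using dE H by (simp add: degree_mult_eq del: mult_pCons_left)
  then have "ip (\<lambda>_. 1) H p = 0" using p by (auto simp: monic_orth_def)
  then have HE: "ip (\<lambda>_. 1) H E = 0"
    by (simp add: E_def normalized_at_def ip_smult_right)
  have z0: "z > 0" "xi < z" using xs[OF z] xi by auto
  have Exi: "poly E xi \<ge> 0"
    unfolding EE using prod_list_mono_real[of xs "\<lambda>x. (x - xi) / (x + s)"] xs s xi by fastforce
  have "ip ?w E E = ip ?w E E - ip (\<lambda>_. 1) H E" using HE by simp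
  also have "\<dots> = (LINT y|M. poly E y * poly E y * ?w y - poly H y * poly E y * 1)"
    unfolding ip_def
    by (intro Bochner_Integration.integral_diff[symmetric] ip_integrable weight_resolvent s weight_one)
  also have "\<dots> \<le> (LINT y|M. poly E xi / s)"
  proof (rule integral_mono_AE)
    show "integrable M (\<lambda>y. poly E y * poly E y * ?w y - poly H y * poly E y * 1)"
      by (intro Bochner_Integration.integrable_diff ip_integrable weight_resolvent s weight_one)
    show "AE y in M. poly E y * poly E y * ?w y - poly H y * poly E y * 1 \<le> poly E xi / s"
      using AE_in_supp[OF sets_M]
    proof eventually_elim
      case (elim y)
      then have y: "xi \<le> y" using xi by auto
      then have ys: "y + s > 0" using xi s by simp
      have Ey: "poly E y = (y - z) * poly H y" unfolding H by (simp add: algebra_simps)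
      have e: "poly E y * poly E y * ?w y - poly H y * poly E y * 1 = - (poly E y * poly H y * (z + s)) / (y + s)"
      proof -
        have "poly E y * poly E y = poly E y * poly H y * (y - z)" unfolding Ey by (simp only: mult_ac)
        then have "poly E y * poly E y * ?w y = poly E y * poly H y * ((y - z) / (y + s))"
          by (simp only: resolvent_weight_def power_one_right times_divide_eq_right mult_1_right)
        then have "poly E y * poly E y * ?w y - poly H y * poly E y * 1 =
            poly E y * poly H y * ((y - z) / (y + s) - 1)"
          by (simp only: right_diff_distrib mult_1_right mult.commute[of "poly H y"])
        also have "(y - z) / (y + s) - 1 = (y - z) / (y + s) - (y + s) / (y + s)"
          using ys by simp
        also have "\<dots> = ((y - z) - (y + s)) / (y + s)" by (rule diff_divide_distrib[symmetric])
        also have "(y - z) - (y + s) = - (z + s)" by simp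
        finally show ?thesis by (simp only: times_divide_eq_right mult_minus_right)
      qed
      show ?case
      proof (cases "y < z")
        case False
        have "poly E y * poly H y = (y - z) * (poly H y * poly H y)" unfolding Ey by (simp only: mult_ac)
        moreover have "(y - z) * (poly H y * poly H y) \<ge> 0" using False by simp
        ultimately have "poly E y * poly H y \<ge> 0" by (simp only:)
        then have "- (poly E y * poly H y * (z + s)) / (y + s) \<le> 0"
          using ys z0 s by (intro divide_nonpos_pos) auto
        also have "0 \<le> poly E xi / s" using Exi s by simp
        finally show ?thesis unfolding e .
      next
        case True
        have fac: "0 \<le> (x - y) / (x + s)" "(x - y) / (x + s) \<le> (x - xi) / (x + s)" "(x - y) / (x + s) \<le> 1"
          if "x \<in> set xs" for x
          using xs[OF that] True y xi s by (auto intro!: divide_right_mono simp: divide_le_eq_1)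
        have 1: "0 \<le> poly E y" "poly E y \<le> poly E xi"
          unfolding EE using prod_list_mono_real[of xs "\<lambda>x. (x - y) / (x + s)" "\<lambda>x. (x - xi) / (x + s)"] fac by auto
        \<comment> \<open>All factors but the one at \<open>z\<close> are dropped. Since
          \<open>poly E y = (z - y) * (- poly H y)\<close>, this bounds
          \<open>- poly H y * (z + s)\<close> by \<open>1\<close>, which is the remaining factor of
          the integrand.\<close>
        have "poly E y \<le> (z - y) / (z + s)"
          unfolding EE by (rule prod_list_le_factor[OF _ z]) (use fac in auto)
        then have 2: "poly E y * (z + s) \<le> z - y" using z0 s by (simp add: field_simps)
        have "poly E y = (z - y) * (- poly H y)" unfolding Ey by (simp add: algebra_simps)
        then have "- poly H y = poly E y / (z - y)" using True by simp
        then have "- poly H y * (z + s) \<le> 1" using 2 True by (simp add: divide_le_eq)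
        then have "poly E y * (- poly H y * (z + s)) \<le> poly E y * 1" by (intro mult_left_mono 1)
        then have "- (poly E y * poly H y * (z + s)) / (y + s) \<le> poly E y / (y + s)"
          using ys by (intro divide_right_mono) auto
        also have "\<dots> \<le> poly E xi / s" using 1 y xi s by (intro frac_le) auto
        finally show ?thesis unfolding e .
      qed
    qed
  qed simp
  also have "\<dots> = poly E xi / s" by (simp add: prob_space[unfolded space_M])
  finally show ?thesis by (simp only: E_def)
qed

text \<open>The polynomials \<open>E n\<close> are the same for \<open>M\<close> and
  \<open>N\<close>, and the integrals \<open>DN n\<close> and \<open>D n\<close> differ by the
  constant \<delta>. Smallness of \<open>E n\<close> under \<open>M\<close> is played off against a
  lower bound at \<open>xi\<close> that comes from \<open>N\<close>.\<close>

lemma stieltjes_transform_eq: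
  assumes N: "half_line_measure N" and same: "same_moments M N" and s: "s > 0"
    and suppN: "supp N \<subseteq> {Inf (supp M)..}" and P: "\<And>n. monic_orth (\<lambda>_. 1) n (P n)"
    and lim: "(\<lambda>n. ip (resolvent_weight s 1) (normalized_at (- s) (P n)) (normalized_at (- s) (P n))) \<longlonglongrightarrow> 0"
  shows "(LINT y|M. 1 / (y + s)) = (LINT y|N. 1 / (y + s))"
proof -
  interpret N: half_line_measure N by fact
  define xi where "xi = Inf (supp M)"
  define E where "E n = normalized_at (- s) (P n)" for n
  let ?w = "resolvent_weight s 1"
  define D where "D n = ip ?w (E n) (E n)" for n
  define DN where "DN n = N.ip ?w (E n) (E n)" for n
  define \<delta> where "\<delta> = (LINT y|N. 1 / (y + s)) - (LINT y|M. 1 / (y + s))"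
  have ne: "supp M \<noteq> {}" and bdd: "bdd_below (supp M)"
    using infinite_supp supp_nonneg by (auto intro: bdd_below_mono[of "{0..}"])
  have xi0: "xi \<ge> 0" unfolding xi_def using supp_nonneg by (intro cInf_greatest ne) auto
  have sM: "supp M \<subseteq> {xi..}" unfolding xi_def using bdd by (auto intro: cInf_lower)
  have sN: "supp N \<subseteq> {xi..}" using suppN by (simp add: xi_def)
  have PN: "N.monic_orth (\<lambda>_. 1) n (P n)" for n by (rule monic_orth_transfer[OF N same P])
  have E1: "poly (E n) (- s) = 1" for n
    using monic_orth_sign[OF weight_one P s, of n] by (auto simp: E_def poly_normalized_at)
  have D0: "D \<longlonglongrightarrow> 0" unfolding D_def E_def by (rule lim)
  have DN: "DN n = \<delta> + D n" for n
    using stieltjes_difference[OF N same s E1, of n] by (simp add: D_def DN_def \<delta>_def)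
  have E_ne: "E n \<noteq> 0" for n using E1[of n] by auto
  have Dpos: "D n > 0" and DNpos: "DN n > 0" for n
    unfolding D_def DN_def
    by (rule ip_self_pos[OF weight_resolvent[OF s] E_ne] N.ip_self_pos[OF weight_resolvent[OF s] E_ne])+
  have "(\<lambda>n. \<delta> + D n) \<longlonglongrightarrow> \<delta> + 0" by (intro tendsto_intros D0)
  then have l: "DN \<longlonglongrightarrow> \<delta>" by (simp add: DN[abs_def])
  have "\<delta> \<ge> 0"
    by (rule LIMSEQ_le_const[OF l]) (use DNpos in \<open>auto intro: less_imp_le\<close>)
  moreover have False if \<delta>: "\<delta> > 0"
  proof -
    \<comment> \<open>\<open>c\<close> will bound \<open>poly (E n) xi\<close> from below, and
      \<open>2 * d = c * s\<close> will bound the distance from \<open>xi\<close> to the least root;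
      \<open>k\<close> is the exponent required by \<open>shifted_factor_bound\<close>.\<close>
    define c where "c = \<delta> * s"
    define d where "d = c * s / 2"
    have c: "c > 0" using \<delta> s by (simp add: c_def)
    have d: "d > 0" using c s by (simp add: d_def)
    obtain k where k: "real k > 2 * d / (xi + s)" using reals_Archimedean2 by blast
    have k': "real k * (xi + s) \<ge> 2 * d" using k xi0 s by (simp add: field_simps)
    have low: "c ^ Suc k \<le> poly (E n) y" if n: "n > 0" and y: "xi \<le> y" "y \<le> xi + d" for n y
    proof -
      obtain xs where xs: "length xs = n" "\<And>x. x \<in> set xs \<Longrightarrow> xi < x"
        "\<And>y. poly (E n) y = (\<Prod>x\<leftarrow>xs. (x - y) / (x + s))"
        using monic_orth_normalized_factors[OF s P xi0 sM] unfolding E_def by metis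
      define z where "z = Min (set xs)"
      have "xs \<noteq> []" using xs(1) n by auto
      then have z: "z \<in> set xs" and zmin: "\<And>x. x \<in> set xs \<Longrightarrow> z \<le> x" unfolding z_def by auto
      \<comment> \<open>The estimate is applied to \<open>N\<close> although the roots were located
        through \<open>M\<close>: only the inclusion of the support of \<open>N\<close> in
        \<open>{xi..}\<close> is asked for, which allows \<open>N\<close> to start later. The case
        \<open>n = 0\<close> is excluded so that a least root exists.\<close>
      have "DN n \<le> poly (E n) xi / s"
        unfolding DN_def E_def
        by (rule N.ip_normalized_le[OF s PN xi0 sN z]) (use xs(2,3) zmin in \<open>auto simp: E_def\<close>)
      then have "\<delta> \<le> poly (E n) xi / s" using DN[of n] Dpos[of n] by linarith
      then have cE: "c \<le> poly (E n) xi" using s by (simp add: c_def field_simps)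
      have "poly (E n) xi \<le> (z - xi) / (z + s)"
        unfolding xs(3) by (rule prod_list_le_factor[OF _ z])
          (use xs(2) xi0 s in \<open>fastforce simp: divide_le_eq_1\<close>)
      with cE have "c \<le> (z - xi) / (z + s)" by (rule order_trans)
      moreover have "z + s > 0" using xs(2)[OF z] xi0 s by simp
      ultimately have "c * (z + s) \<le> z - xi" by (simp only: pos_le_divide_eq)
      moreover have "c * s \<le> c * (z + s)" using c xs(2)[OF z] xi0 by simp
      ultimately have gap: "z - xi \<ge> 2 * d" by (simp add: d_def)
      have "c ^ Suc k \<le> poly (E n) xi ^ Suc k" using cE c by (intro power_mono) auto
      also have "\<dots> = (\<Prod>x\<leftarrow>xs. ((x - xi) / (x + s)) ^ Suc k)"
        unfolding xs(3) prod_list_power_real ..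
      also have "\<dots> \<le> (\<Prod>x\<leftarrow>xs. (x - y) / (x + s))"
      proof (rule prod_list_mono_real[THEN conjunct2])
        fix x assume x: "x \<in> set xs"
        have pos: "x - xi > 0" "x + s > 0" using xs(2)[OF x] xi0 s by auto
        then show "0 \<le> ((x - xi) / (x + s)) ^ Suc k" by (intro zero_le_power divide_nonneg_pos) auto
        have "((x - xi) / ((x - xi) + (xi + s))) ^ Suc k \<le> ((x - xi) - d) / ((x - xi) + (xi + s))"
          by (rule shifted_factor_bound) (use d xi0 s gap zmin[OF x] k' in auto)
        then have "((x - xi) / (x + s)) ^ Suc k \<le> (x - xi - d) / (x + s)" by (simp add: algebra_simps)
        also have "\<dots> \<le> (x - y) / (x + s)" using pos y by (intro divide_right_mono) auto
        finally show "((x - xi) / (x + s)) ^ Suc k \<le> (x - y) / (x + s)" .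
      qed
      finally show ?thesis unfolding xs(3) .
    qed
    define m0 where "m0 = measure M {..<xi + d}"
    have "emeasure M {..<xi + d} > 0"
      unfolding xi_def by (rule emeasure_near_Inf_supp[OF sets_M ne bdd d])
    then have m0: "m0 > 0" unfolding m0_def by (simp add: measure_def enn2real_positive_iff less_top[symmetric])
    \<comment> \<open>On \<open>{..<xi + d}\<close>, which has mass \<open>m0\<close>, the integrand
      of \<open>D n\<close> is at least the first factor; this contradicts
      \<open>D0\<close>.\<close>
    define e where "e = (c ^ Suc k)\<^sup>2 / (xi + d + s) * m0"
    have e: "e > 0" unfolding e_def using c d xi0 s m0 by (intro mult_pos_pos divide_pos_pos) auto
    have e_le: "e \<le> D n" if n: "n > 0" for n
    proof -
      have "e = (LINT y|M. (c ^ Suc k)\<^sup>2 / (xi + d + s) * indicator {..<xi + d} y)"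
        by (simp add: e_def m0_def)
      also have "\<dots> \<le> D n"
        unfolding D_def ip_def
      proof (rule integral_mono_AE)
        show "integrable M (\<lambda>y. (c ^ Suc k)\<^sup>2 / (xi + d + s) * indicator {..<xi + d} y)"
          by (rule integrable_mult_right, rule integrable_real_indicator) (auto simp: less_top[symmetric])
        show "integrable M (\<lambda>y. poly (E n) y * poly (E n) y * ?w y)"
          by (rule ip_integrable[OF weight_resolvent[OF s]])
        show "AE y in M. (c ^ Suc k)\<^sup>2 / (xi + d + s) * indicator {..<xi + d} y \<le> poly (E n) y * poly (E n) y * ?w y"
          using AE_in_supp[OF sets_M]
        proof eventually_elim
          case (elim y)
          then have y: "xi \<le> y" using sM by auto
          then have ys: "y + s > 0" using xi0 s by simp
          show ?case
          proof (cases "y < xi + d")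
            case True
            have "c ^ Suc k \<le> poly (E n) y" by (rule low[OF n y]) (use True in simp)
            then have "(c ^ Suc k)\<^sup>2 \<le> (poly (E n) y)\<^sup>2" using c by (intro power_mono) auto
            then have "(c ^ Suc k)\<^sup>2 / (xi + d + s) \<le> (poly (E n) y)\<^sup>2 / (y + s)"
              using True ys by (intro frac_le) auto
            then show ?thesis using True by (simp add: resolvent_weight_def power2_eq_square)
          next
            case False
            then show ?thesis using ys by (simp add: resolvent_weight_def)
          qed
        qed
      qed
      finally show ?thesis .
    qed
    have "\<forall>\<^sub>F n in sequentially. D n < e" by (rule order_tendstoD(2)[OF D0 e])
    then obtain n0 where "\<And>n. n \<ge> n0 \<Longrightarrow> D n < e" unfolding eventually_sequentially by blast
    then have "D (Suc n0) < e" by simp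
    with e_le[of "Suc n0"] show False by simp
  qed
  ultimately have "\<delta> = 0" by fastforce
  then show ?thesis by (simp add: \<delta>_def)
qed

text \<open>A competitor starting no earlier than \<open>M\<close> would have the Stieltjes
  transform of \<open>M\<close> and so coincide with it. If the moment problem is determined on the
  line, \<open>natural_measure\<close> holds by its second alternative.\<close>

lemma natural_measureI:
  assumes P: "\<And>n. monic_orth (\<lambda>_. 1) n (P n)"
    and lim: "\<And>s. s > 0 \<Longrightarrow>
      (\<lambda>n. ip (resolvent_weight s 1) (normalized_at (- s) (P n)) (normalized_at (- s) (P n))) \<longlonglongrightarrow> 0"
  shows "natural_measure M"
proof -
  have ne: "supp M \<noteq> {}" and bdd: "bdd_below (supp M)"
    using infinite_supp supp_nonneg by (auto intro: bdd_below_mono[of "{0..}"])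
  have xi0: "Inf (supp M) \<ge> 0" using supp_nonneg by (intro cInf_greatest ne) auto
  have "Inf (supp N) < Inf (supp M)"
    if N: "moment_measure N" "same_moments M N" "bdd_below (supp N)" "N \<noteq> M" for N
  proof (rule ccontr)
    assume "\<not> Inf (supp N) < Inf (supp M)"
    then have le: "Inf (supp M) \<le> Inf (supp N)" by simp
    have sN: "supp N \<subseteq> {Inf (supp M)..}"
    proof
      fix x assume "x \<in> supp N"
      then have "Inf (supp N) \<le> x" using N(3) by (rule cInf_lower)
      with le show "x \<in> {Inf (supp M)..}" by simp
    qed
    have "{Inf (supp M)..} \<subseteq> {0..}" using xi0 by simp
    with sN have "supp N \<subseteq> {0..}" by (rule order_trans)
    with N(1) have hN: "half_line_measure N" by (rule half_line_measure.intro)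
    have "M = N"
      by (rule stieltjes_transform_unique[OF half_line_measure_axioms hN])
         (rule stieltjes_transform_eq[where P=P, OF hN N(2) _ sN P lim])
    then show False using N(4) by simp
  qed
  then have "natural_solution M" if "indet_H M"
    unfolding natural_solution_def using that bdd by blast
  then show ?thesis
    unfolding natural_measure_def indet_H_def using moment_measure by blast
qed

end

section \<open>The natural measure of the dual process\<close>

context dual_setup
begin

lemma monic_orth_bd_resolvent: "monic_orth (resolvent_weight s 0) n (bd_poly l m n)"
  using monic_orth_bd_poly by (simp add: resolvent_weight_def[abs_def])

lemma normalized_bd_poly: "poly (normalized_at (- s) (bd_poly l m n)) y = q n y / q n (- s)"
proof -
  define c where "c = (-1) ^ n / (\<Prod>k<n. mt (Suc k))"
  have "(\<Prod>k<n. mt (Suc k)) > 0" using rate_setD(2)[OF rates] by (intro prod_pos) simp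
  then have "c \<noteq> 0" unfolding c_def by (metis divide_eq_0_iff less_irrefl power_eq_0_iff zero_neq_neg_one)
  then show ?thesis unfolding poly_normalized_at bd_q_def c_def[symmetric] by simp
qed

lemma q_neg: "s > 0 \<Longrightarrow> q n (- s) \<ge> 1"
  by (rule bd_q_ge_1[OF rates']) simp

text \<open>The least value of the integral of \<open>E\<^sup>2 / (y + s)\<close> over polynomials
  \<open>E\<close> of degree at most \<open>n\<close> with value \<open>1\<close> at
  \<open>- s\<close>; the orthogonal polynomial so normalized attains it.\<close>

definition resolvent_defect :: "real \<Rightarrow> nat \<Rightarrow> real" where
  "resolvent_defect s n = ip (resolvent_weight s 1) (normalized_at (- s) (bd_poly l m n)) (normalized_at (- s) (bd_poly l m n))"

lemma resolvent_defect_nonneg: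
  assumes "s > 0"
  shows "resolvent_defect s n \<ge> 0"
proof -
  have "normalized_at (- s) (bd_poly l m n) \<noteq> 0"
    using normalized_bd_poly[of s n "- s"] q_neg[OF assms, of n] by auto
  from ip_self_pos[OF weight_resolvent[OF assms] this] show ?thesis
    unfolding resolvent_defect_def by (rule less_imp_le)
qed

text \<open>By \<open>ip_eval_split\<close>, the inner product with a polynomial of degree at most
  \<open>n\<close> sees only its value at \<open>- s\<close>, which is \<open>1\<close> for
  both.\<close>

lemma resolvent_cross:
  assumes s: "s > 0" and "k \<le> n"
  shows "ip (resolvent_weight s 1) (normalized_at (- s) (bd_poly l m n)) (normalized_at (- s) (bd_poly l m k)) =
    ip (resolvent_weight s 1) (normalized_at (- s) (bd_poly l m n)) 1"
proof -
  define c where "c = 1 / poly (bd_poly l m n) (- s)"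
  have E: "poly (normalized_at (- s) (bd_poly l m k)) (- s) = 1"
    using normalized_bd_poly[of s k "- s"] q_neg[OF s, of k] by simp
  have "degree (normalized_at (- s) (bd_poly l m k)) \<le> n"
    using assms(2) degree_smult_le[of _ "bd_poly l m k"] unfolding normalized_at_def
    by (metis degree_bd_poly order_trans)
  from ip_eval_split[OF s monic_orth_bd_resolvent this]
  have "ip (resolvent_weight s 1) (bd_poly l m n) (normalized_at (- s) (bd_poly l m k)) =
      ip (resolvent_weight s 1) (bd_poly l m n) 1"
    unfolding E One_nat_def by simp
  then show ?thesis
    unfolding normalized_at_def[of "- s" "bd_poly l m n"] ip_smult_left by simp
qed

lemma resolvent_defect_eq:
  "s > 0 \<Longrightarrow> resolvent_defect s n = ip (resolvent_weight s 1) (normalized_at (- s) (bd_poly l m n)) 1"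
  unfolding resolvent_defect_def by (rule resolvent_cross) simp_all

lemma resolvent_defect_decseq:
  assumes s: "s > 0"
  shows "decseq (resolvent_defect s)"
proof (rule decseq_SucI)
  fix n
  define E where "E k = normalized_at (- s) (bd_poly l m k)" for k
  define w where "w = resolvent_weight s 1"
  have w: "weight w" unfolding w_def by (rule weight_resolvent[OF s])
  have "0 \<le> ip w (E n - E (Suc n)) (E n - E (Suc n))"
    using ip_self_pos[OF w, of "E n - E (Suc n)"] by (cases "E n - E (Suc n) = 0") (auto simp: ip_def)
  also have "\<dots> = ip w (E n) (E n) - 2 * ip w (E (Suc n)) (E n) + ip w (E (Suc n)) (E (Suc n))"
  proof -
    have "ip w p (E n - E (Suc n)) = ip w p (E n) - ip w p (E (Suc n))" for p
      using ip_diff_left[OF w, of "E n" "E (Suc n)" p] by (simp only: ip_commute[of w p])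
    then show ?thesis
      using ip_diff_left[OF w, of "E n" "E (Suc n)" "E n - E (Suc n)"] ip_commute[of w "E n" "E (Suc n)"] by simp
  qed
  \<comment> \<open>So \<open>E (Suc n)\<close> is orthogonal to \<open>E n - E (Suc n)\<close>, and
    Pythagoras gives the decrease.\<close>
  also have "ip w (E (Suc n)) (E n) = ip w (E (Suc n)) (E (Suc n))"
    unfolding w_def E_def using resolvent_cross[OF s, of n "Suc n"] resolvent_cross[OF s, of "Suc n" "Suc n"] by simp
  finally show "resolvent_defect s (Suc n) \<le> resolvent_defect s n"
    unfolding resolvent_defect_def w_def E_def by simp
qed

lemma resolvent_defect_tendsto_0:
  assumes s: "s > 0"
  shows "resolvent_defect s \<longlonglongrightarrow> 0"
proof -
  obtain D where D: "resolvent_defect s \<longlonglongrightarrow> D"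
    using decseq_convergent[OF resolvent_defect_decseq[OF s], of 0] resolvent_defect_nonneg[OF s] by blast
  have "D = 0"
  proof (cases rule: divergent_cases)
    case 1
    define S where "S n = (\<Sum>k\<le>n. pt k)" for n
    have qtge: "qt k (- s) \<ge> 1" for k by (rule bd_q_ge_1[OF rates]) (use s in simp)
    have qS: "S n \<le> q n (- s)" for n
      unfolding S_def q_dual using qtge pt_pos by (intro sum_mono) (simp add: less_imp_le)
    have Spos: "S n > 0" for n unfolding S_def by (intro sum_pos) (auto simp: pt_pos)
    have int: "integrable phit (\<lambda>x. q n x * f x)" if "f = poly g" for n f g
    proof -
      have "poly (bd_qpoly l m n * g) = (\<lambda>x. q n x * f x)" using that by (simp add: fun_eq_iff)
      then show ?thesis using T.integrable_poly[of "bd_qpoly l m n * g"] by (simp only:)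
    qed
    have q2: "(LINT x|phit. q n x * q n x) = S n" for n
    proof -
      \<comment> \<open>At time \<open>0\<close> the partial row sum in \<open>sum_Pt_eq\<close>
        equals \<open>1\<close> once it includes the state \<open>j\<close>.\<close>
      have orth: "(LINT x|phit. q n x * qt j x) = 1" if "j \<le> n" for j
        using sum_Pt_eq[of 0 j n] that by (simp add: Pt_0)
      have "(LINT x|phit. q n x * q n x) = (LINT x|phit. (\<Sum>j\<le>n. pt j * (q n x * qt j x)))"
        by (subst (2) q_dual) (simp add: sum_distrib_left mult_ac)
      also have "\<dots> = (\<Sum>j\<le>n. pt j * (LINT x|phit. q n x * qt j x))"
        using int[OF poly_bd_qpoly[symmetric]] by simp
      also have "\<dots> = S n" unfolding S_def by (intro sum.cong) (simp_all add: orth)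
      finally show ?thesis .
    qed
    have le: "resolvent_defect s n \<le> 1 / lt 0 * inverse (S n)" for n
    proof -
      have "resolvent_defect s n = (LINT y|phit. y / lt 0 * ((q n y / q n (- s)) * (q n y / q n (- s)) * resolvent_weight s 1 y))"
        unfolding resolvent_defect_def ip_def normalized_bd_poly
        by (rule integral_psi) (simp add: resolvent_weight_def[abs_def])
      \<comment> \<open>The bound \<open>y / (y + s) \<le> 1\<close> absorbs both the density of
        \<open>psi\<close> and the resolvent weight. What remains is the squared norm
        \<open>S n\<close> of \<open>q n\<close> in \<open>phit\<close>, against
        \<open>q n (- s) \<ge> S n\<close> squared.\<close>
      also have "\<dots> \<le> (LINT y|phit. 1 / (lt 0 * (q n (- s))\<^sup>2) * (q n y * q n y))"
      proof (rule integral_mono_AE)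
        show "integrable phit (\<lambda>y. y / lt 0 * ((q n y / q n (- s)) * (q n y / q n (- s)) * resolvent_weight s 1 y))"
          using T.weight_integrable[OF weight_resolvent[OF s, of 1], of "smult (1 / (lt 0 * (q n (- s))\<^sup>2)) (pCons 0 (bd_qpoly l m n * bd_qpoly l m n))"]
          by (simp add: power2_eq_square mult_ac)
        show "integrable phit (\<lambda>y. 1 / (lt 0 * (q n (- s))\<^sup>2) * (q n y * q n y))"
          by (intro integrable_mult_right int[OF poly_bd_qpoly[symmetric]])
        show "AE y in phit. y / lt 0 * ((q n y / q n (- s)) * (q n y / q n (- s)) * resolvent_weight s 1 y)
            \<le> 1 / (lt 0 * (q n (- s))\<^sup>2) * (q n y * q n y)"
          using T.AE_nonneg
        proof eventually_elim
          case (elim y)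
          have c: "1 / (lt 0 * (q n (- s))\<^sup>2) * (q n y * q n y) \<ge> 0"
            using lt_pos[of 0] by (simp flip: power2_eq_square)
          have "y / lt 0 * ((q n y / q n (- s)) * (q n y / q n (- s)) * resolvent_weight s 1 y) =
              (1 / (lt 0 * (q n (- s))\<^sup>2) * (q n y * q n y)) * (y / (y + s))"
            by (simp add: resolvent_weight_def power2_eq_square mult_ac)
          also have "\<dots> \<le> 1 / (lt 0 * (q n (- s))\<^sup>2) * (q n y * q n y)"
            by (rule mult_left_le[OF _ c]) (use elim s in simp)
          finally show ?case .
        qed
      qed
      also have "\<dots> = 1 / (lt 0 * (q n (- s))\<^sup>2) * S n" by (simp add: q2)
      also have "\<dots> \<le> 1 / (lt 0 * (S n)\<^sup>2) * S n"
        using qS[of n] Spos[of n] lt_pos[of 0]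
        by (intro mult_right_mono divide_left_mono mult_left_mono power_mono mult_pos_pos) auto
      also have "\<dots> = 1 / lt 0 * inverse (S n)" using Spos[of n] by (simp add: power2_eq_square field_simps)
      finally show ?thesis .
    qed
    have "D \<ge> 0" by (rule LIMSEQ_le_const[OF D]) (use resolvent_defect_nonneg[OF s] in auto)
    moreover have False if "D > 0"
    proof -
      have "(\<Sum>k<n. pt k) \<le> 1 / lt 0 / D" for n
      proof -
        have "(\<Sum>k<n. pt k) \<le> S n" unfolding S_def by (intro sum_mono2) (auto simp: pt_pos less_imp_le)
        moreover have "D \<le> 1 / lt 0 / S n"
          using decseq_ge[OF resolvent_defect_decseq[OF s] D, of n] le[of n] by (simp add: divide_inverse)
        then have "S n \<le> 1 / lt 0 / D" using \<open>D > 0\<close> Spos[of n]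
          by (simp only: pos_le_divide_eq mult.commute)
        ultimately show ?thesis by simp
      qed
      then have "summable pt" by (intro summableI_nonneg_bounded) (auto simp: pt_pos less_imp_le)
      then show False using 1 by simp
    qed
    ultimately show ?thesis by fastforce
  next
    case 2
    show ?thesis
    proof (rule limit_zero_if_weighted_squares_bounded[OF _ 2 D])
      fix n
      show "pd n \<ge> 0" using pd_pos[of n] by simp
      \<comment> \<open>Up to the divisor \<open>q k (- s) \<ge> 1\<close>, the defect is a Fourier
        coefficient of the resolvent function, to which Bessel's inequality applies.\<close>
      define g where "g x = (if x \<ge> 0 then 1 / (x + s) else 0)" for x :: real
      have gm [measurable]: "g \<in> borel_measurable borel" unfolding g_def[abs_def] by measurable
      have gb: "\<bar>g x\<bar> \<le> 1 / s" for x using s by (auto simp: g_def intro: divide_left_mono)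
      have a: "resolvent_defect s k = (LINT x|psi. g x * poly (bd_qpoly l m k) x) / q k (- s)" for k
      proof -
        have "resolvent_defect s k = (LINT x|psi. g x * poly (bd_qpoly l m k) x / q k (- s))"
          unfolding resolvent_defect_eq[OF s] ip_def normalized_bd_poly
        proof (rule integral_cong_AE)
          show "AE x in psi. q k x / q k (- s) * poly 1 x * resolvent_weight s 1 x = g x * poly (bd_qpoly l m k) x / q k (- s)"
            using AE_nonneg by eventually_elim (simp add: g_def resolvent_weight_def mult_ac)
        qed (auto simp: resolvent_weight_def[abs_def])
        then show ?thesis by simp
      qed
      have le: "(resolvent_defect s k)\<^sup>2 \<le> (LINT x|psi. g x * poly (bd_qpoly l m k) x)\<^sup>2" for k
      proof -
        have "(resolvent_defect s k)\<^sup>2 = (LINT x|psi. g x * poly (bd_qpoly l m k) x)\<^sup>2 / (q k (- s))\<^sup>2"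
          unfolding a by (rule power_divide)
        also have "\<dots> \<le> (LINT x|psi. g x * poly (bd_qpoly l m k) x)\<^sup>2 / 1"
          using q_neg[OF s, of k] by (intro divide_left_mono) auto
        finally show ?thesis by simp
      qed
      have "(\<Sum>k<n. pd k * (resolvent_defect s k)\<^sup>2) \<le> (\<Sum>k<n. pd k * (LINT x|psi. g x * poly (bd_qpoly l m k) x)\<^sup>2)"
        by (intro sum_mono mult_left_mono le) (simp add: pd_pos less_imp_le)
      also have "\<dots> \<le> (LINT x|psi. (g x)\<^sup>2)"
      proof (rule bessel[OF gm])
        have "(g x)\<^sup>2 \<le> (1 / s)\<^sup>2" for x
          using power_mono[OF gb[of x], of 2] by simp
        then show "integrable psi (\<lambda>x. (g x)\<^sup>2)" by (intro integrable_const_bound[where B="(1 / s)\<^sup>2"]) auto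
        show "integrable psi (\<lambda>x. g x * poly p x)" for p
          using integrable_poly_mult[OF gm gb, of p] by (simp add: mult.commute)
        show "pd j * (LINT x|psi. poly (bd_qpoly l m i) x * poly (bd_qpoly l m j) x) = (if i = j then 1 else 0)" for i j
          using P_eq[of 0 i j] P_0[of i j] by simp
      qed
      finally show "(\<Sum>k<n. pd k * (resolvent_defect s k)\<^sup>2) \<le> (LINT x|psi. (g x)\<^sup>2)" .
    qed
  qed
  then show ?thesis using D by simp
qed

lemma natural_psi: "natural_measure psi"
  using natural_measureI[OF monic_orth_bd_poly] resolvent_defect_tendsto_0 unfolding resolvent_defect_def[abs_def] by blast

section \<open>Recovering \<open>phit\<close> and its atom at zero\<close>

lemma atom_less_1: "measure phit {0} < 1"
proof (rule ccontr)
  assume "\<not> measure phit {0} < 1"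
  then have "measure phit {0} = 1" using T.prob_le_1[of "{0}"] by linarith
  then have "AE x in phit. x \<in> {0}" using T.prob_eq_1[of "{0}"] by simp
  then have "supp phit \<subseteq> {0}" by (rule supp_subset_closed) auto
  then show False using T.infinite_supp finite_subset by blast
qed

text \<open>At \<open>0\<close> the density vanishes while the inverse is infinite. Their product in
  \<open>ennreal\<close> is \<open>0\<close>, so the atom of \<open>phit\<close> drops out.\<close>

lemma nn_integral_psi_inverse:
  assumes A: "A \<in> sets borel"
  shows "(\<integral>\<^sup>+y. inverse (ennreal y) * indicator (A \<inter> {0..}) y \<partial>psi) = ennreal (1 / lt 0) * emeasure phit (A - {0})"
proof -
  have [measurable]: "A \<inter> {0..} \<in> sets borel" "A - {0} \<in> sets borel" using A by auto
  have "(\<integral>\<^sup>+y. inverse (ennreal y) * indicator (A \<inter> {0..}) y \<partial>psi) =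
      (\<integral>\<^sup>+y. ennreal (y / lt 0) * (inverse (ennreal y) * indicator (A \<inter> {0..}) y) \<partial>phit)"
    unfolding psi_def by (rule nn_integral_density) measurable
  also have "\<dots> = (\<integral>\<^sup>+y. ennreal (1 / lt 0) * indicator (A - {0}) y \<partial>phit)"
  proof (rule nn_integral_cong_AE)
    show "AE y in phit. ennreal (y / lt 0) * (inverse (ennreal y) * indicator (A \<inter> {0..}) y) =
        ennreal (1 / lt 0) * indicator (A - {0}) y"
      using T.AE_nonneg
    proof eventually_elim
      case (elim y)
      show ?case
      proof (cases "y = 0")
        case False
        then have y: "y > 0" using elim by simp
        have "ennreal (y / lt 0) * inverse (ennreal y) = ennreal (1 / lt 0)"
          using y lt_pos[of 0] by (simp add: inverse_ennreal flip: ennreal_mult)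
        then show ?thesis using y by (auto simp: indicator_def)
      qed simp
    qed
  qed
  also have "\<dots> = ennreal (1 / lt 0) * emeasure phit (A - {0})"
    by (rule nn_integral_cmult_indicator) simp
  finally show ?thesis .
qed

lemma m_inv_psi: "m_inv psi = ennreal ((1 - measure phit {0}) / lt 0)"
proof -
  have "emeasure phit (UNIV - {0}) = ennreal (1 - measure phit {0})"
    using T.prob_compl[of "{0}"] by (simp add: T.emeasure_eq_measure)
  then show ?thesis
    using nn_integral_psi_inverse[of UNIV] lt_pos[of 0] T.prob_le_1[of "{0}"]
    by (simp add: m_inv_def flip: ennreal_mult)
qed

text \<open>With \<open>p\<close> the atom, \<open>phi0 psi\<close> is \<open>phit\<close>
  conditioned on the complement of \<open>{0}\<close>. As \<open>a + 1 = 1 / (1 - p)\<close> and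
  \<open>a / (a + 1) = p\<close>, the mixture \<open>phi a psi\<close> restores the original
  masses.\<close>

lemma phit_eq_phi:
  assumes a: "a = measure phit {0} / (1 - measure phit {0})"
  shows "phit = phi a psi"
proof (rule measure_eqI)
  show "sets phit = sets (phi a psi)" by simp
  fix A assume "A \<in> sets phit"
  then have A [measurable]: "A \<in> sets borel" by simp
  define p where "p = measure phit {0}"
  have p: "p < 1" "p \<ge> 0" using atom_less_1 by (auto simp: p_def)
  define r where "r = measure phit (A - {0})"
  have r: "emeasure phit (A - {0}) = ennreal r" "r \<ge> 0" by (auto simp: r_def T.emeasure_eq_measure)
  have "emeasure (phi0 psi) A = (\<integral>\<^sup>+y. (inverse (ennreal y) * indicator (A \<inter> {0..}) y) / m_inv psi \<partial>psi)"
    unfolding phi0_def by (subst emeasure_density) (auto intro!: nn_integral_cong split: split_indicator)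
  also have "\<dots> = (\<integral>\<^sup>+y. inverse (ennreal y) * indicator (A \<inter> {0..}) y \<partial>psi) / m_inv psi"
    by (rule nn_integral_divide) measurable
  also have "\<dots> = ennreal (1 / lt 0) * ennreal r / ennreal ((1 - p) / lt 0)"
    unfolding nn_integral_psi_inverse[OF A] m_inv_psi r(1) p_def ..
  also have "\<dots> = ennreal (r / (1 - p))"
    using p r lt_pos[of 0] by (simp add: divide_ennreal flip: ennreal_mult) 
  finally have phi0: "emeasure (phi0 psi) A = ennreal (r / (1 - p))" .
  have a1: "a + 1 = 1 / (1 - p)" and a0: "a = p / (1 - p)" using p by (simp_all add: a p_def[symmetric] field_simps)
  have "emeasure (phi a psi) A = inverse (ennreal (1 / (1 - p))) *
      (ennreal (p / (1 - p)) * indicator A 0 + ennreal (r / (1 - p)))"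
    unfolding emeasure_phi[OF sets_psi A] phi0 a1 unfolding a0 by (simp add: emeasure_return)
  also have "\<dots> = ennreal ((1 - p) * (p / (1 - p) * indicator A 0 + r / (1 - p)))"
    using p r by (auto simp: inverse_ennreal indicator_def simp flip: ennreal_mult ennreal_plus)
  also have "(1 - p) * (p / (1 - p) * indicator A 0 + r / (1 - p)) = p * indicator A 0 + r"
    using p by (simp add: distrib_left)
  also have "\<dots> = measure phit A"
  proof (cases "0 \<in> A")
    case True
    then have "measure phit A = measure phit ({0} \<union> (A - {0}))" by (intro arg_cong[of _ _ "measure phit"]) auto
    also have "\<dots> = p + r" unfolding p_def r_def by (rule T.finite_measure_Union) auto
    finally show ?thesis using True by simp
  next
    case False
    then show ?thesis by (simp add: r_def)
  qed
  finally show "emeasure phit A = emeasure (phi a psi) A" by (simp add: T.emeasure_eq_measure)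
qed

end

theorem theorem4p3:
  fixes lt mt :: "nat \<Rightarrow> real" and Pt :: "real \<Rightarrow> nat \<Rightarrow> nat \<Rightarrow> real"
    and phit :: "real measure" and a :: real
  assumes "rate_set lt mt" and "mt 0 = 0"
    and "\<not> summable (\<lambda>n. pi_coeff lt mt n + 1 / (lt n * pi_coeff lt mt n))"
    and "bd_process lt mt Pt"
    and "corresponding_measure lt mt Pt phit"
    and "a = measure phit {0} / (1 - measure phit {0})"
  shows "\<exists>l m P psi.
           uniquely_determined l m P \<and>
           corresponding_measure l m P psi \<and> natural_measure psi \<and> m_inv psi < \<infinity> \<and>
           m 0 = inverse ((a + 1) * enn2real (m_inv psi)) \<and> m 0 > 0 \<and>
           phit = phi a psi \<and>
           is_dual_process l m P lt mt Pt"
proof -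
  interpret dual_setup lt mt Pt phit
    by unfold_locales (use assms in auto)
  define p where "p = measure phit {0}"
  have p: "p < 1" using atom_less_1 by (simp add: p_def)
  have "a + 1 = 1 / (1 - p)" using p by (simp add: assms(6) p_def[symmetric] field_simps)
  moreover have "enn2real (m_inv psi) = (1 - p) / lt 0"
    unfolding m_inv_psi using p lt_pos[of 0] by (simp add: p_def)
  \<comment> \<open>The factor \<open>1 - p\<close> lost with the atom cancels against
    \<open>a + 1\<close>, which leaves \<open>lt 0\<close> as the death rate at
    \<open>0\<close>.\<close>
  ultimately have "(a + 1) * enn2real (m_inv psi) = 1 / (1 - p) * ((1 - p) / lt 0)"
    by (simp only:)
  also have "\<dots> = 1 / lt 0" using p by simp
  finally have "lt 0 = inverse ((a + 1) * enn2real (m_inv psi))"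
    by simp
  moreover have "m_inv psi < \<infinity>" unfolding m_inv_psi by simp
  moreover have "is_dual_process (\<lambda>n. mt (Suc n)) lt P lt mt Pt"
    unfolding is_dual_process_def
    using lt_pos[of 0] uniquely_determined_P uniquely_determined_Pt mt0
    by (auto simp: dual_birth_def dual_death_def fun_eq_iff split: nat.split)
  ultimately show ?thesis
    using uniquely_determined_P corresponding_psi natural_psi lt_pos[of 0] phit_eq_phi[OF assms(6)]
    by (intro exI[of _ "\<lambda>n. mt (Suc n)"] exI[of _ lt] exI[of _ P] exI[of _ psi]) simp
qed

end
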